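(* If $\mathcal{M}$ is a model of $\mathrm{PA}$ of countable cofinality that has an expansion to a model of $\mathrm{PAI}^-$, then $\mathcal{M}$ has an expansion to a model of $\mathrm{PAI}_0$. However, every countable model of $\mathrm{PA}$ has an uncountable elementary end extension that has an expansion to a model of $\mathrm{PAI}^-$ but no expansion to a model of $\mathrm{PAI}_0$.
   Context: $\mathcal{L}_{\mathrm{A}}=\{+,\cdot,\mathrm{S},<,0\}$. Consider the axioms in $\mathcal{L}_{\mathrm{A}}\cup\{I\}$: (2) "$I$ is unbounded"; (3) for each $\mathcal{L}_{\mathrm{A}}$-formula $\varphi(v_1,\dots,v_n)$: for all $x_1<\dots<x_n$ and $y_1<\dots<y_n$ in $I$, $\varphi(\bar x)\leftrightarrow\varphi(\bar y)$. $\mathrm{PAI}^-$ is $\mathrm{PA}$ (induction only for $\mathcal{L}_{\mathrm{A}}$-formulae) plus (2) and (3); thus $(\mathcal{M},I)\models\mathrm{PAI}^-$ iff $I$ is an unbounded set of order indiscernibles in $\mathcal{M}$. $\mathrm{PAI}_0$ is $\mathrm{PAI}^-$ plus the induction scheme for $\Delta_0(I)$-formulae (formulae of $\mathcal{L}_{\mathrm{A}}\cup\{I\}$ all of whose quantifiers are bounded by terms). *)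

theory Defs
  imports Main "HOL-Library.Countable_Set"
begin

datatype tm = Var nat | Zero | Sc tm | Add tm tm | Mul tm tm

text \<open>
  Formulae in the language of arithmetic together with a unary predicate symbol for the set of
  indiscernibles.  The remaining connectives and the universal quantifier are abbreviations in
  classical logic.
\<close>

datatype fm =
    Eq tm tm
  | Less tm tm
  | InI tm
  | Neg fm
  | Conj fm fm
  | Ex nat fm

primrec tvars :: "tm \<Rightarrow> nat set" where
  "tvars (Var k) = {k}"
| "tvars Zero = {}"
| "tvars (Sc t) = tvars t"
| "tvars (Add s t) = tvars s \<union> tvars t"
| "tvars (Mul s t) = tvars s \<union> tvars t"

primrec fvars :: "fm \<Rightarrow> nat set" where
  "fvars (Eq s t) = tvars s \<union> tvars t"
| "fvars (Less s t) = tvars s \<union> tvars t"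
| "fvars (InI t) = tvars t"
| "fvars (Neg p) = fvars p"
| "fvars (Conj p q) = fvars p \<union> fvars q"
| "fvars (Ex k p) = fvars p - {k}"

primrec LA_formula :: "fm \<Rightarrow> bool" where
  "LA_formula (Eq s t) \<longleftrightarrow> True"
| "LA_formula (Less s t) \<longleftrightarrow> True"
| "LA_formula (InI t) \<longleftrightarrow> False"
| "LA_formula (Neg p) \<longleftrightarrow> LA_formula p"
| "LA_formula (Conj p q) \<longleftrightarrow> LA_formula p \<and> LA_formula q"
| "LA_formula (Ex k p) \<longleftrightarrow> LA_formula p"

text \<open>
  The bounded universal quantifier is covered as the negation of a bounded existential one.  The
  quantified variable must not occur in the bounding term.
\<close>

inductive Delta0_I :: "fm \<Rightarrow> bool" where
  "Delta0_I (Eq s t)"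
| "Delta0_I (Less s t)"
| "Delta0_I (InI t)"
| "Delta0_I p \<Longrightarrow> Delta0_I (Neg p)"
| "Delta0_I p \<Longrightarrow> Delta0_I q \<Longrightarrow> Delta0_I (Conj p q)"
| "Delta0_I p \<Longrightarrow> k \<notin> tvars t \<Longrightarrow> Delta0_I (Ex k (Conj (Less (Var k) t) p))"

record 'a LA_struct =
  carr :: "'a set"
  zeroM :: 'a
  sucM :: "'a \<Rightarrow> 'a"
  addM :: "'a \<Rightarrow> 'a \<Rightarrow> 'a"
  mulM :: "'a \<Rightarrow> 'a \<Rightarrow> 'a"
  ltM :: "'a \<Rightarrow> 'a \<Rightarrow> bool"

definition LA_structure :: "'a LA_struct \<Rightarrow> bool" where
  "LA_structure M \<longleftrightarrow>
     zeroM M \<in> carr M \<and>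
     (\<forall>a\<in>carr M. sucM M a \<in> carr M) \<and>
     (\<forall>a\<in>carr M. \<forall>b\<in>carr M. addM M a b \<in> carr M \<and> mulM M a b \<in> carr M)"

primrec tval :: "'a LA_struct \<Rightarrow> (nat \<Rightarrow> 'a) \<Rightarrow> tm \<Rightarrow> 'a" where
  "tval M e (Var k) = e k"
| "tval M e Zero = zeroM M"
| "tval M e (Sc t) = sucM M (tval M e t)"
| "tval M e (Add s t) = addM M (tval M e s) (tval M e t)"
| "tval M e (Mul s t) = mulM M (tval M e s) (tval M e t)"

text \<open>
  Satisfaction in the expansion \<open>(M, I)\<close>.  For formulae satisfying \<^const>\<open>LA_formula\<close> the set
  \<open>I\<close> plays no role, and satisfaction in \<open>M\<close> itself is written with \<open>I = {}\<close>.
\<close>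

primrec sat :: "'a LA_struct \<Rightarrow> 'a set \<Rightarrow> (nat \<Rightarrow> 'a) \<Rightarrow> fm \<Rightarrow> bool" where
  "sat M I e (Eq s t) \<longleftrightarrow> tval M e s = tval M e t"
| "sat M I e (Less s t) \<longleftrightarrow> ltM M (tval M e s) (tval M e t)"
| "sat M I e (InI t) \<longleftrightarrow> tval M e t \<in> I"
| "sat M I e (Neg p) \<longleftrightarrow> \<not> sat M I e p"
| "sat M I e (Conj p q) \<longleftrightarrow> sat M I e p \<and> sat M I e q"
| "sat M I e (Ex k p) \<longleftrightarrow> (\<exists>a\<in>carr M. sat M I (e(k := a)) p)"

text \<open>
  \<open>(M, I)\<close> satisfies the universal closure of the induction axiom of \<open>p\<close> with respect to every
  variable \<open>k\<close>; the other free variables of \<open>p\<close> are parameters.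
\<close>

definition induction_axiom :: "'a LA_struct \<Rightarrow> 'a set \<Rightarrow> fm \<Rightarrow> bool" where
  "induction_axiom M I p \<longleftrightarrow>
     (\<forall>e k. (\<forall>j. e j \<in> carr M) \<longrightarrow>
        sat M I (e(k := zeroM M)) p \<longrightarrow>
        (\<forall>a\<in>carr M. sat M I (e(k := a)) p \<longrightarrow> sat M I (e(k := sucM M a)) p) \<longrightarrow>
        (\<forall>a\<in>carr M. sat M I (e(k := a)) p))"

definition model_PA :: "'a LA_struct \<Rightarrow> bool" where
  "model_PA M \<longleftrightarrow>
     LA_structure M \<and>
     (\<forall>a\<in>carr M. sucM M a \<noteq> zeroM M) \<and>
     (\<forall>a\<in>carr M. \<forall>b\<in>carr M. sucM M a = sucM M b \<longrightarrow> a = b) \<and>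
     (\<forall>a\<in>carr M. addM M a (zeroM M) = a) \<and>
     (\<forall>a\<in>carr M. \<forall>b\<in>carr M. addM M a (sucM M b) = sucM M (addM M a b)) \<and>
     (\<forall>a\<in>carr M. mulM M a (zeroM M) = zeroM M) \<and>
     (\<forall>a\<in>carr M. \<forall>b\<in>carr M. mulM M a (sucM M b) = addM M (mulM M a b) a) \<and>
     (\<forall>a\<in>carr M. \<not> ltM M a (zeroM M)) \<and>
     (\<forall>a\<in>carr M. \<forall>b\<in>carr M. ltM M a (sucM M b) \<longleftrightarrow> ltM M a b \<or> a = b) \<and>
     (\<forall>p. LA_formula p \<longrightarrow> induction_axiom M {} p)"

definition unbounded_in :: "'a LA_struct \<Rightarrow> 'a set \<Rightarrow> bool" where
  "unbounded_in M I \<longleftrightarrow> (\<forall>a\<in>carr M. \<exists>i\<in>I. ltM M a i)"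

text \<open>
  Only the values \<open>x 0, \<dots>, x (n - 1)\<close> of the assignment \<open>x\<close> matter here, and likewise for \<open>y\<close>.
\<close>

definition order_indiscernibles :: "'a LA_struct \<Rightarrow> 'a set \<Rightarrow> bool" where
  "order_indiscernibles M I \<longleftrightarrow>
     (\<forall>p n x y. LA_formula p \<longrightarrow> fvars p \<subseteq> {..<n} \<longrightarrow>
        (\<forall>i<n. x i \<in> I \<and> y i \<in> I) \<longrightarrow>
        (\<forall>j<n. \<forall>i<j. ltM M (x i) (x j) \<and> ltM M (y i) (y j)) \<longrightarrow>
        (sat M {} x p \<longleftrightarrow> sat M {} y p))"

definition model_PAI_minus :: "'a LA_struct \<Rightarrow> 'a set \<Rightarrow> bool" where
  "model_PAI_minus M I \<longleftrightarrow>
     model_PA M \<and> I \<subseteq> carr M \<and> unbounded_in M I \<and> order_indiscernibles M I"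

definition model_PAI0 :: "'a LA_struct \<Rightarrow> 'a set \<Rightarrow> bool" where
  "model_PAI0 M I \<longleftrightarrow>
     model_PAI_minus M I \<and> (\<forall>p. Delta0_I p \<longrightarrow> induction_axiom M I p)"

definition countable_cofinality :: "'a LA_struct \<Rightarrow> bool" where
  "countable_cofinality M \<longleftrightarrow>
     (\<exists>C\<subseteq>carr M. countable C \<and> (\<forall>a\<in>carr M. \<exists>c\<in>C. a = c \<or> ltM M a c))"

definition elementary_embedding :: "('a \<Rightarrow> 'b) \<Rightarrow> 'a LA_struct \<Rightarrow> 'b LA_struct \<Rightarrow> bool" where
  "elementary_embedding f M N \<longleftrightarrow>
     f ` carr M \<subseteq> carr N \<and>
     (\<forall>p e. LA_formula p \<longrightarrow> (\<forall>k. e k \<in> carr M) \<longrightarrow> (sat M {} e p \<longleftrightarrow> sat N {} (f \<circ> e) p))"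

text \<open>
  \<open>N\<close> is an elementary end extension of \<open>M\<close>, with \<open>M\<close> identified with its image under \<open>f\<close>.
\<close>

definition elementary_end_extension_via ::
    "('a \<Rightarrow> 'b) \<Rightarrow> 'a LA_struct \<Rightarrow> 'b LA_struct \<Rightarrow> bool" where
  "elementary_end_extension_via f M N \<longleftrightarrow>
     LA_structure N \<and> elementary_embedding f M N \<and>
     (\<forall>a\<in>carr M. \<forall>b\<in>carr N. ltM N b (f a) \<longrightarrow> b \<in> f ` carr M)"

end

theory Submission
  imports Defs "HOL-Library.Countable_Set_Type"
begin

text \<open>
  If \<open>M\<close> has countable cofinality, thin out the given set \<open>I\<close> to a cofinal subset of order type
  \<open>\<omega>\<close>.  Only finitely many of its elements lie below any bound, so a bounded formula restricted to
  bounded arguments is equivalent to an arithmetical one with parameters, and induction for it is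
  induction in \<open>M\<close>.

  For the second part, follow MacDowell--Specker and Gaifman to obtain an ultrafilter on the definable
  subsets of \<open>M\<close> that is itself definable, and iterate it along the index set \<open>\<omega>\<^sub>1\<close>.  This gives
  an elementary end extension \<open>N\<close>, generated over \<open>M\<close> by an unbounded set of indiscernibles
  \<open>c l\<close>, that is a conservative extension of each cut \<open>H\<close> generated by the indiscernibles with
  index in an initial segment.  Suppose that \<open>(N, J)\<close> satisfied \<open>PAI\<^sub>0\<close>.  Interleave \<open>J\<close> with the
  \<open>c l\<close> to find such a cut \<open>H\<close>, of countable cofinality and hence bounded in \<open>N\<close>, in which
  \<open>J\<close> is cofinal.  Bounded induction codes the part of \<open>J\<close> below a bound of \<open>H\<close> by an element of
  \<open>N\<close>, so by conservativity \<open>J\<close> is definable in \<open>H\<close> with parameters in \<open>H\<close>.  But then so is the successor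
  function of \<open>J\<close>, whereas indiscernibles outgrow every function definable from smaller parameters.
\<close>

text \<open>Definability of the ultrafilter is used three times. It turns \<open>Uq\<close> into a
  quantifier that maps definable predicates to definable predicates, so that it can be iterated
  inside \<open>M\<close>. It makes the predicate "\<open>f\<close> is at least k almost everywhere"
  accessible to induction on k, so that a bounded definable function is constant almost everywhere
  and the extension adds no element below an old one. And it allows a generic coordinate to be
  eliminated from a formula, which is conservativity. The only link between \<open>J\<close> and the
  generating indiscernibles is that both are unbounded. A cut in which they interleave is reached by
  bounded induction only if it lies below some element of \<open>N\<close>. This is why every
  countable set of indices must have a strict upper bound, and why the index set is omega_1: the
  interleaving takes countably many steps, and the same property makes the extension
  uncountable.\<close>

instance tm :: countable
  by countable_datatype

instance fm :: countable
  by countable_datatype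

section \<open>Variables of formulae: dependence, renaming, identification\<close>

lemma finite_tvars [simp]: "finite (tvars t)"
  by (induction t) auto

lemma finite_fvars [simp]: "finite (fvars p)"
  by (induction p) auto

lemma tval_cong: "(\<And>k. k \<in> tvars t \<Longrightarrow> e k = e' k) \<Longrightarrow> tval M e t = tval M e' t"
  by (induction t) auto

lemma sat_cong: "(\<And>k. k \<in> fvars p \<Longrightarrow> e k = e' k) \<Longrightarrow> sat M I e p \<longleftrightarrow> sat M I e' p"
proof (induction p arbitrary: e e')
  case (Eq s t)
  then show ?case using tval_cong[of s e e' M] tval_cong[of t e e' M] by auto
next
  case (Less s t)
  then show ?case using tval_cong[of s e e' M] tval_cong[of t e e' M] by auto
next
  case (InI t)
  then show ?case using tval_cong[of t e e' M] by auto
next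
  case (Neg p)
  then show ?case by (metis fvars.simps(4) sat.simps(4))
next
  case (Conj p q)
  then show ?case by (metis UnCI fvars.simps(5) sat.simps(5))
next
  case (Ex k p)
  have "sat M I (e(k := a)) p \<longleftrightarrow> sat M I (e'(k := a)) p" for a
    using Ex.prems by (intro Ex.IH) auto
  then show ?case by simp
qed

primrec tm_rename :: "(nat \<Rightarrow> nat) \<Rightarrow> tm \<Rightarrow> tm" where
  "tm_rename r (Var k) = Var (r k)"
| "tm_rename r Zero = Zero"
| "tm_rename r (Sc t) = Sc (tm_rename r t)"
| "tm_rename r (Add s t) = Add (tm_rename r s) (tm_rename r t)"
| "tm_rename r (Mul s t) = Mul (tm_rename r s) (tm_rename r t)"

text \<open>Bound variables are renamed together with the free ones; for injective \<open>r\<close>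
  this excludes capture.\<close>

primrec fm_rename :: "(nat \<Rightarrow> nat) \<Rightarrow> fm \<Rightarrow> fm" where
  "fm_rename r (Eq s t) = Eq (tm_rename r s) (tm_rename r t)"
| "fm_rename r (Less s t) = Less (tm_rename r s) (tm_rename r t)"
| "fm_rename r (InI t) = InI (tm_rename r t)"
| "fm_rename r (Neg p) = Neg (fm_rename r p)"
| "fm_rename r (Conj p q) = Conj (fm_rename r p) (fm_rename r q)"
| "fm_rename r (Ex k p) = Ex (r k) (fm_rename r p)"

lemma tval_rename: "tval M e (tm_rename r t) = tval M (e \<circ> r) t"
  by (induction t) auto

lemma sat_rename: "inj r \<Longrightarrow> sat M I e (fm_rename r p) \<longleftrightarrow> sat M I (e \<circ> r) p"
proof (induction p arbitrary: e)
  case (Ex k p)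
  have "(e(r k := a)) \<circ> r = (e \<circ> r)(k := a)" for a
    using Ex.prems by (auto simp: fun_eq_iff inj_eq)
  then show ?case by (simp only: fm_rename.simps sat.simps Ex.IH[OF Ex.prems])
qed (simp_all only: fm_rename.simps sat.simps tval_rename)

lemma LA_rename [simp]: "LA_formula (fm_rename r p) \<longleftrightarrow> LA_formula p"
  by (induction p) auto

lemma tvars_rename: "tvars (tm_rename r t) = r ` tvars t"
  by (induction t) auto

lemma fvars_rename: "inj r \<Longrightarrow> fvars (fm_rename r p) = r ` fvars p"
  by (induction p) (auto simp: tvars_rename inj_eq)

text \<open>Substitution of the variable \<open>w\<close> for the variables \<open>ks\<close>,
  expressed by quantifiers with equations so that capture never has to be considered.\<close>

primrec unify_vars :: "nat \<Rightarrow> nat list \<Rightarrow> fm \<Rightarrow> fm" where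
  "unify_vars w [] p = p"
| "unify_vars w (k # ks) p = Ex k (Conj (Eq (Var k) (Var w)) (unify_vars w ks p))"

lemma LA_unify_vars [simp]: "LA_formula (unify_vars w ks p) \<longleftrightarrow> LA_formula p"
  by (induction ks) auto

lemma sat_unify_vars:
  "w \<notin> set ks \<Longrightarrow> e w \<in> carr M \<Longrightarrow>
   sat M I e (unify_vars w ks p) \<longleftrightarrow> sat M I (\<lambda>j. if j \<in> set ks then e w else e j) p"
proof (induction ks arbitrary: e)
  case (Cons k ks)
  have "sat M I e (unify_vars w (k # ks) p) \<longleftrightarrow> sat M I (e(k := e w)) (unify_vars w ks p)"
    using Cons.prems by (simp cong: conj_cong)
  also have "\<dots> \<longleftrightarrow> sat M I (\<lambda>j. if j \<in> set ks then (e(k := e w)) w else (e(k := e w)) j) p"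
    using Cons.prems by (intro Cons.IH) simp_all
  also have "(\<lambda>j. if j \<in> set ks then (e(k := e w)) w else (e(k := e w)) j) =
      (\<lambda>j. if j \<in> set (k # ks) then e w else e j)"
    using Cons.prems by auto
  finally show ?case .
qed simp

section \<open>Definable predicates\<close>

text \<open>
  Definability with parameters for predicates on an arbitrary type of contexts: \<open>D\<close> is the set of
  admissible contexts, \<open>C\<close> the set of coordinate functions that may be assigned to variables, and
  \<open>A\<close> the set of parameters.  Contexts are extended to the right by pairing, which allows
  bound variables to be treated as \<open>\<lambda>\<close>-bound variables.
\<close>

definition ext :: "('x \<Rightarrow> 'a) set \<Rightarrow> ('x \<times> 'a \<Rightarrow> 'a) set" where
  "ext C = insert snd ((\<lambda>c z. c (fst z)) ` C)"

definition pconsts :: "'a LA_struct \<Rightarrow> 'a set \<Rightarrow> ('x \<Rightarrow> 'a) set" where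
  "pconsts M A = (\<lambda>a _. a) ` insert (zeroM M) A"

definition dp ::
    "'a LA_struct \<Rightarrow> 'a set \<Rightarrow> 'x set \<Rightarrow> ('x \<Rightarrow> 'a) set \<Rightarrow> ('x \<Rightarrow> bool) \<Rightarrow> bool" where
  "dp M A D C P \<longleftrightarrow> (\<exists>p e. LA_formula p \<and> (\<forall>k. e k \<in> C \<union> pconsts M A) \<and>
      (\<forall>x\<in>D. P x \<longleftrightarrow> sat M {} (\<lambda>k. e k x) p))"

definition df ::
    "'a LA_struct \<Rightarrow> 'a set \<Rightarrow> 'x set \<Rightarrow> ('x \<Rightarrow> 'a) set \<Rightarrow> ('x \<Rightarrow> 'a) \<Rightarrow> bool" where
  "df M A D C f \<longleftrightarrow> (\<forall>x\<in>D. f x \<in> carr M) \<and>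
      dp M A (D \<times> carr M) (ext C) (\<lambda>z. f (fst z) = snd z)"

lemma dpI:
  assumes "LA_formula p" "\<And>k. e k \<in> C \<union> pconsts M A"
    "\<And>x. x \<in> D \<Longrightarrow> P x \<longleftrightarrow> sat M {} (\<lambda>k. e k x) p"
  shows "dp M A D C P"
  using assms unfolding dp_def by blast

lemma dpE:
  assumes "dp M A D C P"
  obtains p e where "LA_formula p" "\<And>k. e k \<in> C \<union> pconsts M A"
    "\<And>x. x \<in> D \<Longrightarrow> P x \<longleftrightarrow> sat M {} (\<lambda>k. e k x) p"
  using assms unfolding dp_def by blast

lemma dp_cong: "dp M A D C P \<Longrightarrow> (\<And>x. x \<in> D \<Longrightarrow> P x \<longleftrightarrow> Q x) \<Longrightarrow> dp M A D C Q"
  unfolding dp_def by (elim exE conjE, intro exI conjI) (assumption, assumption, simp)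

lemma dp_mono:
  assumes "dp M A D C P" "A \<subseteq> B"
  shows "dp M B D C P"
proof -
  have "C \<union> pconsts M A \<subseteq> C \<union> pconsts M B"
    using assms(2) unfolding pconsts_def by (intro Un_mono image_mono insert_mono) auto
  with assms(1) show ?thesis unfolding dp_def by (meson subsetD)
qed

lemma zero_pconsts [simp]: "(\<lambda>_. zeroM M) \<in> pconsts M A"
  unfolding pconsts_def by auto

lemma const_pconsts: "a \<in> A \<Longrightarrow> (\<lambda>_. a) \<in> pconsts M A"
  unfolding pconsts_def by auto

definition basic ::
    "'a LA_struct \<Rightarrow> 'a set \<Rightarrow> 'x set \<Rightarrow> ('x \<Rightarrow> 'a) set \<Rightarrow> ('x \<Rightarrow> 'a) \<Rightarrow> bool" where
  "basic M A D C f \<longleftrightarrow> (\<exists>c\<in>C \<union> pconsts M A. \<forall>x\<in>D. f x = c x)"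

lemma basic_coord: "c \<in> C \<Longrightarrow> basic M A D C c"
  unfolding basic_def by blast

lemma basic_const: "a \<in> A \<Longrightarrow> basic M A D C (\<lambda>x. a)"
  unfolding basic_def by (intro bexI[of _ "\<lambda>_. a"]) (auto intro: const_pconsts)

lemma basic_zero: "basic M A D C (\<lambda>x. zeroM M)"
  unfolding basic_def by (intro bexI[of _ "\<lambda>_. zeroM M"]) auto

lemma basic_snd: "basic M A D (ext C) snd"
  unfolding basic_def ext_def by blast

lemma basic_cong: "basic M A D C f \<Longrightarrow> (\<And>x. x \<in> D \<Longrightarrow> f x = g x) \<Longrightarrow> basic M A D C g"
  unfolding basic_def by (elim bexE, rule_tac x = c in bexI) simp_all

lemma ext_cases:
  assumes "c \<in> ext C"
  obtains "c = snd" | c' where "c' \<in> C" "c = (\<lambda>z. c' (fst z))"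
  using assms unfolding ext_def by blast

lemma ext_fst: "c \<in> C \<Longrightarrow> (\<lambda>z. c (fst z)) \<in> ext C"
  unfolding ext_def by (intro insertI2) (rule imageI)

lemma ext_snd: "snd \<in> ext C"
  unfolding ext_def by (rule insertI1)

lemma basic_fst:
  assumes "basic M A D C f"
  shows "basic M A (D \<times> E) (ext C) (\<lambda>z. f (fst z))"
proof -
  obtain c where c: "c \<in> C \<union> pconsts M A" and f: "\<And>x. x \<in> D \<Longrightarrow> f x = c x"
    using assms unfolding basic_def by blast
  have "basic M A (D \<times> E) (ext C) (\<lambda>z. c (fst z))"
    using c
  proof
    assume "c \<in> C"
    then show ?thesis by (intro basic_coord ext_fst)
  next
    assume "c \<in> pconsts M A"
    then obtain a where a: "a = zeroM M \<or> a \<in> A" and c: "c = (\<lambda>_. a)"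
      unfolding pconsts_def by blast
    show ?thesis using a unfolding c by (elim disjE) (simp_all add: basic_zero basic_const)
  qed
  then show ?thesis by (rule basic_cong) (auto simp: f)
qed

lemma basic_coords_or_const:
  assumes "\<And>c. c \<in> C \<Longrightarrow> basic M A D' C' (\<lambda>x. c (g x))" and "c \<in> C \<union> pconsts M A"
  shows "basic M A D' C' (\<lambda>x. c (g x))"
  using assms(2)
proof
  assume "c \<in> pconsts M A"
  then obtain a where a: "a = zeroM M \<or> a \<in> A" and c: "c = (\<lambda>_. a)"
    unfolding pconsts_def by blast
  show ?thesis using a unfolding c by (elim disjE) (simp_all add: basic_zero basic_const)
qed (rule assms(1))

lemma basic_choose:
  assumes "\<And>k :: 'k. basic M A D C (f k)"
  obtains e where "\<And>k. e k \<in> C \<union> pconsts M A" "\<And>k x. x \<in> D \<Longrightarrow> f k x = e k x"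
proof -
  have "\<exists>e. \<forall>k. e k \<in> C \<union> pconsts M A \<and> (\<forall>x\<in>D. f k x = e k x)"
  proof (rule choice, rule allI)
    show "\<exists>c. c \<in> C \<union> pconsts M A \<and> (\<forall>x\<in>D. f k x = c x)" for k
      using assms[of k] unfolding basic_def Bex_def .
  qed
  then obtain e where e: "\<forall>k. e k \<in> C \<union> pconsts M A \<and> (\<forall>x\<in>D. f k x = e k x)" ..
  show thesis
    by (rule that[of e]) (use e in simp_all)
qed

lemma dpI_basic:
  assumes "LA_formula p" "\<And>k. basic M A D C (f k)"
    "\<And>x. x \<in> D \<Longrightarrow> P x \<longleftrightarrow> sat M {} (\<lambda>k. f k x) p"
  shows "dp M A D C P"
proof -
  obtain e where e: "\<And>k. e k \<in> C \<union> pconsts M A" "\<And>k x. x \<in> D \<Longrightarrow> f k x = e k x"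
    by (rule basic_choose[of M A D C f, OF assms(2)]) (rule that)
  show ?thesis
  proof (rule dpI[OF assms(1) e(1)])
    fix x assume x: "x \<in> D"
    show "P x \<longleftrightarrow> sat M {} (\<lambda>k. e k x) p"
      unfolding assms(3)[OF x] e(2)[OF x] ..
  qed
qed

text \<open>Change of context: the formula stays the same and only its assignment is composed with
  \<open>g\<close>, so it suffices that every old coordinate becomes a coordinate or a constant of
  the new context. Weakening and updates of assignments are instances.\<close>

lemma dp_reindex:
  assumes P: "dp M A D C P" and g: "\<And>x. x \<in> D' \<Longrightarrow> g x \<in> D"
    and c: "\<And>c. c \<in> C \<Longrightarrow> basic M A D' C' (\<lambda>x. c (g x))"
  shows "dp M A D' C' (\<lambda>x. P (g x))"
proof -
  obtain p e where p: "LA_formula p" and e: "\<And>k. e k \<in> C \<union> pconsts M A"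
    and P: "\<And>x. x \<in> D \<Longrightarrow> P x \<longleftrightarrow> sat M {} (\<lambda>k. e k x) p"
    using P by (rule dpE) (rule that)
  show ?thesis
  proof (rule dpI_basic[OF p])
    show "basic M A D' C' (\<lambda>x. e k (g x))" for k
      using basic_coords_or_const[where g = g, OF c e] .
    show "P (g x) \<longleftrightarrow> sat M {} (\<lambda>k. e k (g x)) p" if "x \<in> D'" for x
      by (rule P[OF g[OF that]])
  qed
qed

text \<open>Total assignments over an arbitrary index type: \<open>nat\<close> for the variables of
  formulae, a linear order of indices for the iterated ultrapower.\<close>

definition envs :: "'a LA_struct \<Rightarrow> ('i \<Rightarrow> 'a) set" where
  "envs M = {y. \<forall>k. y k \<in> carr M}"

definition coords :: "(('i \<Rightarrow> 'a) \<Rightarrow> 'a) set" where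
  "coords = range (\<lambda>k y. y k)"

lemma envs_upd [simp]: "y \<in> envs M \<Longrightarrow> v \<in> carr M \<Longrightarrow> y(k := v) \<in> envs M"
  unfolding envs_def by auto

lemma envs_app [simp]: "y \<in> envs M \<Longrightarrow> y k \<in> carr M"
  unfolding envs_def by auto

lemma coords_app [simp]: "(\<lambda>y. y k) \<in> coords"
  unfolding coords_def by auto

lemma basic_coords:
  assumes "c \<in> coords" "\<And>k. basic M A D C (\<lambda>z. g z k)"
  shows "basic M A D C (\<lambda>z. c (g z))"
  using assms(1) unfolding coords_def by (rule imageE) (simp add: assms(2))

lemma basic_upd:
  "basic M A D C f \<Longrightarrow> (j \<noteq> k \<Longrightarrow> basic M A D C (\<lambda>z. g z j)) \<Longrightarrow>
    basic M A D C (\<lambda>z. ((g z)(k := f z)) j)"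
  by (cases "j = k") simp_all

lemma dp_reindex_pair:
  assumes P: "dp M A (D \<times> E) (ext C) (\<lambda>z. P (fst z) (snd z))"
    and D: "\<And>z. z \<in> D' \<Longrightarrow> g z \<in> D \<and> f z \<in> E"
    and g: "\<And>c. c \<in> C \<Longrightarrow> basic M A D' C' (\<lambda>z. c (g z))" and f: "basic M A D' C' f"
  shows "dp M A D' C' (\<lambda>z. P (g z) (f z))"
proof -
  have "dp M A D' C' (\<lambda>z. P (fst (g z, f z)) (snd (g z, f z)))"
  proof (rule dp_reindex[OF P, where g = "\<lambda>z. (g z, f z)"])
    fix c assume "c \<in> ext C"
    then show "basic M A D' C' (\<lambda>z. c (g z, f z))"
    proof (rule ext_cases)
      fix c' assume c': "c' \<in> C" and c: "c = (\<lambda>z. c' (fst z))"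
      show ?thesis unfolding c fst_conv by (rule g[OF c'])
    qed (simp add: f)
  qed (simp add: D)
  then show ?thesis by simp
qed

lemma dp_weaken_mid:
  assumes "dp M A (D \<times> E) (ext C) (\<lambda>z. P (fst z) (snd z))"
  shows "dp M A ((D \<times> E') \<times> E) (ext (ext C)) (\<lambda>z. P (fst (fst z)) (snd z))"
proof (rule dp_reindex_pair[where P = P and g = "\<lambda>z. fst (fst z)" and f = snd, OF assms])
  fix c assume "c \<in> C"
  then show "basic M A ((D \<times> E') \<times> E) (ext (ext C)) (\<lambda>z. c (fst (fst z)))"
    by (rule basic_fst[OF basic_fst[OF basic_coord]])
qed (auto intro: basic_snd)

lemma dp_upd:
  fixes P :: "('i \<Rightarrow> 'a) \<Rightarrow> bool"
  assumes "dp M A (envs M) coords P"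
  shows "dp M A (envs M \<times> carr M) (ext coords) (\<lambda>z. P ((fst z)(k := snd z)))"
proof (rule dp_reindex[OF assms, where g = "\<lambda>z. (fst z)(k := snd z)"])
  fix c :: "('i \<Rightarrow> 'a) \<Rightarrow> 'a" assume "c \<in> coords"
  then show "basic M A (envs M \<times> carr M) (ext coords) (\<lambda>z. c ((fst z)(k := snd z)))"
    by (rule basic_coords) (intro basic_upd basic_snd basic_fst[OF basic_coord[OF coords_app]])
qed (auto intro: envs_upd)

lemma dp_neg:
  assumes "dp M A D C P"
  shows "dp M A D C (\<lambda>x. \<not> P x)"
proof -
  obtain p e where "LA_formula p" "\<And>k. e k \<in> C \<union> pconsts M A"
    "\<And>x. x \<in> D \<Longrightarrow> P x \<longleftrightarrow> sat M {} (\<lambda>k. e k x) p"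
    using assms by (rule dpE) (rule that)
  then show ?thesis
    by (intro dpI[of "Neg p" e]) simp_all
qed

lemma dp_conj:
  assumes "dp M A D C P" "dp M A D C Q"
  shows "dp M A D C (\<lambda>x. P x \<and> Q x)"
proof -
  obtain p e where p: "LA_formula p" "\<And>k. e k \<in> C \<union> pconsts M A"
    "\<And>x. x \<in> D \<Longrightarrow> P x \<longleftrightarrow> sat M {} (\<lambda>k. e k x) p"
    using assms(1) by (rule dpE) (rule that)
  obtain q d where q: "LA_formula q" "\<And>k. d k \<in> C \<union> pconsts M A"
    "\<And>x. x \<in> D \<Longrightarrow> Q x \<longleftrightarrow> sat M {} (\<lambda>k. d k x) q"
    using assms(2) by (rule dpE) (rule that)
  \<comment> \<open>\<open>p\<close> and \<open>q\<close> come with different assignments; even and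
    odd variables keep them apart.\<close>
  define c where "c k = (if even k then e (k div 2) else d (k div 2))" for k :: nat
  have inj: "inj (\<lambda>k::nat. 2 * k)" "inj (\<lambda>k::nat. 2 * k + 1)"
    by (auto simp: inj_def)
  show ?thesis
  proof (rule dpI[of "Conj (fm_rename (\<lambda>k. 2 * k) p) (fm_rename (\<lambda>k. 2 * k + 1) q)" c])
    show "P x \<and> Q x \<longleftrightarrow> sat M {} (\<lambda>k. c k x)
        (Conj (fm_rename (\<lambda>k. 2 * k) p) (fm_rename (\<lambda>k. 2 * k + 1) q))" if "x \<in> D" for x
      using p(3)[OF that] q(3)[OF that]
      by (simp only: sat.simps sat_rename[OF inj(1)] sat_rename[OF inj(2)])
        (simp add: o_def c_def)
  qed (use p q in \<open>auto simp: c_def\<close>)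
qed

lemma dp_disj:
  assumes "dp M A D C P" "dp M A D C Q"
  shows "dp M A D C (\<lambda>x. P x \<or> Q x)"
proof -
  have "dp M A D C (\<lambda>x. \<not> (\<not> P x \<and> \<not> Q x))"
    by (intro dp_neg dp_conj assms)
  then show ?thesis by (rule dp_cong) blast
qed

lemma dp_imp:
  assumes "dp M A D C P" "dp M A D C Q"
  shows "dp M A D C (\<lambda>x. P x \<longrightarrow> Q x)"
proof -
  have "dp M A D C (\<lambda>x. \<not> P x \<or> Q x)"
    by (intro dp_neg dp_disj assms)
  then show ?thesis by (rule dp_cong) blast
qed

lemma dp_iff:
  assumes "dp M A D C P" "dp M A D C Q"
  shows "dp M A D C (\<lambda>x. P x \<longleftrightarrow> Q x)"
proof -
  have "dp M A D C (\<lambda>x. (P x \<longrightarrow> Q x) \<and> (Q x \<longrightarrow> P x))"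
    by (intro dp_conj dp_imp assms)
  then show ?thesis by (rule dp_cong) blast
qed

lemma dp_const: "dp M A D C (\<lambda>x. b)"
proof (rule dpI[of "if b then Eq Zero Zero else Neg (Eq Zero Zero)" "\<lambda>_ _. zeroM M"])
qed auto

text \<open>Several variables of \<open>p\<close> may denote the last coordinate, but a quantifier
  binds only one. After a shift by one they are all identified with variable 0, and the remaining
  variables denote coordinates of the smaller context or constants.\<close>

lemma dp_normal_form:
  assumes "dp M A (D \<times> carr M) (ext C) P"
  obtains q d where "LA_formula q" "\<And>k. d k \<in> C \<union> pconsts M A"
    "\<And>x v. x \<in> D \<Longrightarrow> v \<in> carr M \<Longrightarrow> P (x, v) \<longleftrightarrow> sat M {} ((\<lambda>k. d k x)(0 := v)) q"
proof -
  obtain p e where p: "LA_formula p" and e: "\<And>k. e k \<in> ext C \<union> pconsts M A"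
    and P: "\<And>x. x \<in> D \<times> carr M \<Longrightarrow> P x \<longleftrightarrow> sat M {} (\<lambda>k. e k x) p"
    using assms by (rule dpE) (rule that)
  \<comment> \<open>Only free variables are collected, because infinitely many variables may be
    assigned to \<open>snd\<close>.\<close>
  define K where "K = {k \<in> fvars p. e k = snd}"
  have "finite K" unfolding K_def using finite_fvars[of p] by (rule finite_subset[rotated]) blast
  then have "finite (Suc ` K)" by (rule finite_imageI)
  from finite_list[OF this] obtain ks where ks: "set ks = Suc ` K" ..
  have "\<exists>c. c \<in> C \<union> pconsts M A \<and> (e k = snd \<or> e k = (\<lambda>z. c (fst z)))" for k
    using e[of k]
  proof
    assume "e k \<in> ext C"
    then show ?thesis
    proof (rule ext_cases)
      assume "e k = snd"
      then show ?thesis by (intro exI[of _ "\<lambda>_. zeroM M"]) simp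
    next
      fix c' assume "c' \<in> C" "e k = (\<lambda>z. c' (fst z))"
      then show ?thesis by (intro exI[of _ c']) simp
    qed
  next
    assume "e k \<in> pconsts M A"
    then obtain a where a: "a \<in> insert (zeroM M) A" and ek: "e k = (\<lambda>_. a)"
      unfolding pconsts_def by blast
    have "(\<lambda>_. a) \<in> C \<union> pconsts M A"
      unfolding pconsts_def by (rule UnI2, rule imageI, rule a)
    with ek show ?thesis by (intro exI[of _ "\<lambda>_. a"]) simp
  qed
  then have "\<forall>k. \<exists>c. c \<in> C \<union> pconsts M A \<and> (e k = snd \<or> e k = (\<lambda>z. c (fst z)))" ..
  from choice[OF this] obtain c where
    c: "\<forall>k. c k \<in> C \<union> pconsts M A \<and> (e k = snd \<or> e k = (\<lambda>z. c k (fst z)))" ..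
  have ev: "e k (x, v) = (if e k = snd then v else c k x)" for k x v
  proof (cases "e k = snd")
    case False
    with c have "e k = (\<lambda>z. c k (fst z))" by blast
    then have "e k (x, v) = c k (fst (x, v))" by (rule fun_cong)
    with False show ?thesis by simp
  qed simp
  show thesis
  proof (rule that)
    show "LA_formula (unify_vars 0 ks (fm_rename Suc p))" using p by simp
    show "c (k - 1) \<in> C \<union> pconsts M A" for k
      using c[THEN spec, of "k - 1"] by (rule conjunct1)
    fix x v assume xv: "x \<in> D" "v \<in> carr M"
    let ?d = "(\<lambda>k. c (k - 1) x)(0 := v)"
    let ?d' = "\<lambda>j. if j \<in> set ks then ?d 0 else ?d j"
    have "sat M {} ?d (unify_vars 0 ks (fm_rename Suc p)) \<longleftrightarrow> sat M {} ?d' (fm_rename Suc p)"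
      by (rule sat_unify_vars) (simp_all add: ks xv)
    also have "\<dots> \<longleftrightarrow> sat M {} (?d' \<circ> Suc) p"
      by (rule sat_rename) simp
    also have "\<dots> \<longleftrightarrow> sat M {} (\<lambda>k. e k (x, v)) p"
    proof (rule sat_cong)
      fix k assume "k \<in> fvars p"
      then have "Suc k \<in> set ks \<longleftrightarrow> e k = snd"
        unfolding ks K_def by auto
      then show "(?d' \<circ> Suc) k = e k (x, v)"
        unfolding ev by simp
    qed
    also have "\<dots> \<longleftrightarrow> P (x, v)"
      by (rule P[symmetric]) (simp add: xv)
    finally show "P (x, v) \<longleftrightarrow> sat M {} ?d (unify_vars 0 ks (fm_rename Suc p))"
      by (rule sym)
  qed
qed

lemma dp_ex:
  assumes "dp M A (D \<times> carr M) (ext C) (\<lambda>z. P (fst z) (snd z))"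
  shows "dp M A D C (\<lambda>x. \<exists>v\<in>carr M. P x v)"
proof -
  obtain q d where q: "LA_formula q" "\<And>k. d k \<in> C \<union> pconsts M A"
    and P: "\<And>x v. x \<in> D \<Longrightarrow> v \<in> carr M \<Longrightarrow>
      P (fst (x, v)) (snd (x, v)) \<longleftrightarrow> sat M {} ((\<lambda>k. d k x)(0 := v)) q"
    by (rule dp_normal_form[OF assms]) (rule that)
  show ?thesis
  proof (rule dpI[OF _ q(2)])
    show "LA_formula (Ex 0 q)" using q by simp
    fix x assume "x \<in> D"
    from P[OF this, unfolded fst_conv snd_conv]
    show "(\<exists>v\<in>carr M. P x v) \<longleftrightarrow> sat M {} (\<lambda>k. d k x) (Ex 0 q)"
      unfolding sat.simps by blast
  qed
qed

lemma dp_all: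
  assumes "dp M A (D \<times> carr M) (ext C) (\<lambda>z. P (fst z) (snd z))"
  shows "dp M A D C (\<lambda>x. \<forall>v\<in>carr M. P x v)"
proof -
  have "dp M A D C (\<lambda>x. \<not> (\<exists>v\<in>carr M. \<not> P x v))"
    by (intro dp_neg dp_ex assms)
  then show ?thesis by (rule dp_cong) blast
qed

lemma dp_weaken: "dp M A D C P \<Longrightarrow> dp M A (D \<times> E) (ext C) (\<lambda>z. P (fst z))"
  by (rule dp_reindex[where g = fst]) (auto intro: basic_fst basic_coord)

lemma df_weaken:
  assumes "df M A D C f"
  shows "df M A (D \<times> E) (ext C) (\<lambda>z. f (fst z))"
  unfolding df_def
proof
  show "\<forall>x\<in>D \<times> E. f (fst x) \<in> carr M" using assms unfolding df_def by auto
  have "dp M A (D \<times> carr M) (ext C) (\<lambda>z. f (fst z) = snd z)"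
    using assms unfolding df_def by auto
  then show "dp M A ((D \<times> E) \<times> carr M) (ext (ext C)) (\<lambda>z. f (fst (fst z)) = snd z)"
    by (rule dp_weaken_mid[where P = "\<lambda>x v. f x = v"])
qed

lemma df_coord:
  assumes "c \<in> C" "\<And>x. x \<in> D \<Longrightarrow> c x \<in> carr M"
  shows "df M A D C c"
  unfolding df_def
proof
  show "dp M A (D \<times> carr M) (ext C) (\<lambda>z. c (fst z) = snd z)"
    by (rule dpI[of "Eq (Var 0) (Var 1)" "\<lambda>k. if k = 0 then (\<lambda>z. c (fst z)) else snd"])
      (use assms in \<open>auto intro: ext_fst ext_snd\<close>)
qed (use assms in auto)

lemma df_const:
  assumes "a \<in> A" "a \<in> carr M"
  shows "df M A D C (\<lambda>x. a)"
  unfolding df_def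
proof
  show "dp M A (D \<times> carr M) (ext C) (\<lambda>z. a = snd z)"
    by (rule dpI[of "Eq (Var 0) (Var 1)" "\<lambda>k. if k = 0 then (\<lambda>z. a) else snd"])
      (use assms in \<open>auto intro: ext_snd const_pconsts\<close>)
qed (use assms in auto)

lemma df_snd: "df M A (D \<times> carr M) (ext C) snd"
  by (rule df_coord) (auto intro: ext_snd)

lemma df_id: "df M A (carr M) {\<lambda>x. x} (\<lambda>x. x)"
  by (rule df_coord) auto

lemma dp_subst:
  assumes P: "dp M A (D \<times> carr M) (ext C) (\<lambda>z. P (fst z) (snd z))" and f: "df M A D C f"
  shows "dp M A D C (\<lambda>x. P x (f x))"
proof -
  have "dp M A D C (\<lambda>x. \<exists>v\<in>carr M. f x = v \<and> P x v)"
    by (rule dp_ex, rule dp_conj) (use assms in \<open>auto simp: df_def\<close>)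
  then show ?thesis
    by (rule dp_cong) (use f in \<open>auto simp: df_def\<close>)
qed

lemma dp_app1:
  assumes P: "dp M A (carr M) {\<lambda>x. x} P" and f: "df M A D C f"
  shows "dp M A D C (\<lambda>x. P (f x))"
proof (rule dp_subst[OF _ f, where P = "\<lambda>_. P"])
  show "dp M A (D \<times> carr M) (ext C) (\<lambda>z. P (snd z))"
    by (rule dp_reindex[OF P]) (auto intro!: basic_snd basic_fst basic_zero intro: basic_coord)
qed

abbreviation dp2 :: "'a LA_struct \<Rightarrow> 'a set \<Rightarrow> ('a \<Rightarrow> 'a \<Rightarrow> bool) \<Rightarrow> bool" where
  "dp2 M A P \<equiv> dp M A (carr M \<times> carr M) (ext {\<lambda>x. x}) (\<lambda>z. P (fst z) (snd z))"

lemma dp_app2: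
  assumes P: "dp2 M A P" and f: "df M A D C f" and g: "df M A D C g"
  shows "dp M A D C (\<lambda>x. P (f x) (g x))"
proof -
  have "dp M A ((D \<times> carr M) \<times> carr M) (ext (ext C)) (\<lambda>z. P (snd (fst z)) (snd z))"
    by (rule dp_reindex_pair[where P = P and g = "\<lambda>z. snd (fst z)" and f = snd, OF P])
      (auto intro: basic_snd basic_fst[OF basic_snd])
  then have "dp M A (D \<times> carr M) (ext C) (\<lambda>z. P (snd z) (g (fst z)))"
    by (rule dp_subst[OF _ df_weaken[OF g], where P = "\<lambda>z v. P (snd z) v"])
  then show ?thesis
    by (rule dp_subst[OF _ f, where P = "\<lambda>x v. P v (g x)"])
qed

lemma dp2_basic:
  "dp2 M A (\<lambda>x y. x = y)" "dp2 M A (ltM M)"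
proof -
  let ?e = "\<lambda>k::nat. if k = 0 then fst else (snd :: 'a \<times> 'a \<Rightarrow> 'a)"
  have fst: "fst \<in> ext {\<lambda>x :: 'a. x}" by (auto simp: ext_def)
  have snd: "snd \<in> ext {\<lambda>x :: 'a. x}" by (auto simp: ext_def)
  show "dp2 M A (\<lambda>x y. x = y)"
    by (rule dpI[of "Eq (Var 0) (Var 1)" ?e]) (use fst snd in auto)
  show "dp2 M A (ltM M)"
    by (rule dpI[of "Less (Var 0) (Var 1)" ?e]) (use fst snd in auto)
qed

lemma dp_eq: "df M A D C f \<Longrightarrow> df M A D C g \<Longrightarrow> dp M A D C (\<lambda>x. f x = g x)"
  by (rule dp_app2[where P = "(=)", OF dp2_basic(1)])

lemma dp_lt: "df M A D C f \<Longrightarrow> df M A D C g \<Longrightarrow> dp M A D C (\<lambda>x. ltM M (f x) (g x))"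
  by (rule dp_app2[where P = "ltM M", OF dp2_basic(2)])

lemma df_app1:
  assumes h: "df M A (carr M) {\<lambda>x. x} h" and f: "df M A D C f"
  shows "df M A D C (\<lambda>x. h (f x))"
  unfolding df_def
proof
  have "dp2 M A (\<lambda>u v. h u = v)" using h unfolding df_def by auto
  from dp_app2[OF this df_weaken[OF f] df_snd]
  show "dp M A (D \<times> carr M) (ext C) (\<lambda>z. h (f (fst z)) = snd z)" .
qed (use assms in \<open>auto simp: df_def\<close>)

lemma df_app2:
  assumes h: "df M A (carr M \<times> carr M) (ext {\<lambda>x. x}) (\<lambda>z. h (fst z) (snd z))"
    and f: "df M A D C f" and g: "df M A D C g"
  shows "df M A D C (\<lambda>x. h (f x) (g x))"
  unfolding df_def
proof
  have "dp M A ((carr M \<times> carr M) \<times> carr M) (ext (ext {\<lambda>x. x}))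
      (\<lambda>z. h (fst (fst z)) (snd (fst z)) = snd z)"
    using h unfolding df_def by auto
  \<comment> \<open>The value is moved in front of the two arguments, so that
    \<open>dp_subst\<close> can fill in \<open>g\<close> and then \<open>f\<close> as last
    coordinate.\<close>
  then have "dp M A ((((D \<times> carr M) \<times> carr M) \<times> carr M)) (ext (ext (ext C)))
      (\<lambda>z. h (snd (fst z)) (snd z) = snd (fst (fst z)))"
    by (rule dp_reindex[where g = "\<lambda>z. ((snd (fst z), snd z), snd (fst (fst z)))" and
          P = "\<lambda>z. h (fst (fst z)) (snd (fst z)) = snd z", unfolded fst_conv snd_conv])
      (auto elim!: ext_cases intro!: basic_snd basic_fst basic_zero intro: basic_coord)
  then have "dp M A ((D \<times> carr M) \<times> carr M) (ext (ext C))
      (\<lambda>z. h (snd z) (g (fst (fst z))) = snd (fst z))"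
    by (rule dp_subst[OF _ df_weaken[OF df_weaken[OF g]],
          where P = "\<lambda>z v. h (snd z) v = snd (fst z)"])
  then show "dp M A (D \<times> carr M) (ext C) (\<lambda>z. h (f (fst z)) (g (fst z)) = snd z)"
    by (rule dp_subst[OF _ df_weaken[OF f], where P = "\<lambda>z v. h v (g (fst z)) = snd z"])
qed (use assms in \<open>auto simp: df_def\<close>)

lemma dp_sat_env: "LA_formula p \<Longrightarrow> dp M A (envs M) coords (\<lambda>y. sat M {} y p)"
  by (rule dpI[where e = "\<lambda>k y. y k"]) auto

text \<open>
  The replacement of coordinates by definable functions goes through the mixed context
  \<open>(x, y)\<close>, in which only finitely many coordinates have been replaced so far; this keeps the
  type of the context fixed during the induction.
\<close>

lemma dp_subst_env:
  fixes P :: "(nat \<Rightarrow> 'a) \<Rightarrow> bool" and f :: "nat \<Rightarrow> 'x \<Rightarrow> 'a"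
  assumes P: "dp M A (envs M) coords P" and K: "finite K"
    and dep: "\<And>y y'. y \<in> envs M \<Longrightarrow> y' \<in> envs M \<Longrightarrow> (\<And>k. k \<in> K \<Longrightarrow> y k = y' k) \<Longrightarrow> P y \<longleftrightarrow> P y'"
    and f: "\<And>k. df M A D C (f k)" and Z: "zeroM M \<in> carr M"
  shows "dp M A D C (\<lambda>x. P (\<lambda>k. f k x))"
proof -
  let ?C = "(\<lambda>c (z :: 'x \<times> (nat \<Rightarrow> 'a)). c (fst z)) ` C \<union> range (\<lambda>k z. snd z k)"
  have C_cases: thesis if "c \<in> ?C" "\<And>c0. c0 \<in> C \<Longrightarrow> c = (\<lambda>z. c0 (fst z)) \<Longrightarrow> thesis"
    "\<And>k. c = (\<lambda>z. snd z k) \<Longrightarrow> thesis" for c thesis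
    using that(1)
  proof
    assume "c \<in> (\<lambda>c z. c (fst z)) ` C"
    then show thesis by (rule imageE) (rule that(2))
  next
    assume "c \<in> range (\<lambda>k z. snd z k)"
    then show thesis by (rule imageE) (rule that(3))
  qed
  have C1: "basic M A E ?C (\<lambda>z. c0 (fst z))" if "c0 \<in> C" for c0 E
    by (rule basic_coord, rule UnI1, rule imageI, rule that)
  have C2: "basic M A E ?C (\<lambda>z. snd z k)" for k E
    by (rule basic_coord, rule UnI2, rule rangeI)
  have fc: "f k x \<in> carr M" if "x \<in> D" for k x
    using f[of k, unfolded df_def, THEN conjunct1] that by (rule bspec)
  have *: "dp M A (D \<times> envs M) ?C (\<lambda>z. P (\<lambda>k. if k \<in> S then f k (fst z) else snd z k))"
    if "finite S" for S
    using that
  proof (induction S rule: finite_induct)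
    case empty
    have "dp M A (D \<times> envs M) ?C (\<lambda>z. P (snd z))"
    proof (rule dp_reindex[OF P, where g = snd])
      fix c :: "(nat \<Rightarrow> 'a) \<Rightarrow> 'a" assume "c \<in> coords"
      then obtain k where c: "c = (\<lambda>y. y k)" unfolding coords_def by (rule imageE)
      show "basic M A (D \<times> envs M) ?C (\<lambda>x. c (snd x))"
        unfolding c by (rule C2)
    qed (erule SigmaE, simp)
    then show ?case by simp
  next
    case (insert s S)
    let ?Q = "\<lambda>z. P (\<lambda>k. if k \<in> S then f k (fst z) else snd z k)"
    have "dp M A ((D \<times> envs M) \<times> carr M) (ext ?C)
        (\<lambda>z. ?Q (fst (fst z), (snd (fst z))(s := snd z)))"
    proof (rule dp_reindex[OF insert.IH, where g = "\<lambda>z. (fst (fst z), (snd (fst z))(s := snd z))"])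
      fix c assume "c \<in> ?C"
      then show "basic M A ((D \<times> envs M) \<times> carr M) (ext ?C)
          (\<lambda>x. c (fst (fst x), (snd (fst x))(s := snd x)))"
      proof (rule C_cases)
        fix c0 assume c0: "c0 \<in> C" "c = (\<lambda>z. c0 (fst z))"
        show ?thesis unfolding c0(2) fst_conv by (rule basic_fst[OF C1[OF c0(1)]])
      next
        fix k assume k: "c = (\<lambda>z. snd z k)"
        show ?thesis
        proof (cases "k = s")
          case True
          then show ?thesis unfolding k by (simp add: basic_snd)
        next
          case False
          show ?thesis unfolding k snd_conv fun_upd_other[OF False] by (rule basic_fst[OF C2])
        qed
      qed
    qed auto
    moreover have "df M A (D \<times> envs M) ?C (\<lambda>z. f s (fst z))"
      unfolding df_def
    proof
      have d: "dp M A (D \<times> carr M) (ext C) (\<lambda>z. f s (fst z) = snd z)"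
        by (rule f[of s, unfolded df_def, THEN conjunct2])
      show "dp M A ((D \<times> envs M) \<times> carr M) (ext ?C) (\<lambda>z. f s (fst (fst z)) = snd z)"
      proof (rule dp_reindex[OF d, where g = "\<lambda>z. (fst (fst z), snd z)", unfolded fst_conv snd_conv])
        fix c assume "c \<in> ext C"
        then show "basic M A ((D \<times> envs M) \<times> carr M) (ext ?C) (\<lambda>x. c (fst (fst x), snd x))"
        proof (rule ext_cases)
          fix c' assume c': "c' \<in> C" "c = (\<lambda>z. c' (fst z))"
          show ?thesis unfolding c'(2) fst_conv by (rule basic_fst[OF C1[OF c'(1)]])
        qed (simp add: basic_snd)
      qed auto
    qed (use fc in auto)
    ultimately have "dp M A (D \<times> envs M) ?C (\<lambda>z. ?Q (fst z, (snd z)(s := f s (fst z))))"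
      by (rule dp_subst[where P = "\<lambda>z v. ?Q (fst z, (snd z)(s := v))" and f = "\<lambda>z. f s (fst z)"])
    then show ?case
    proof (rule dp_cong)
      fix x :: "'x \<times> (nat \<Rightarrow> 'a)" assume "x \<in> D \<times> envs M"
      have "(\<lambda>k. if k \<in> S then f k (fst x) else ((snd x)(s := f s (fst x))) k) =
          (\<lambda>k. if k \<in> insert s S then f k (fst x) else snd x k)"
        by auto
      then show "?Q (fst x, (snd x)(s := f s (fst x))) =
          P (\<lambda>k. if k \<in> insert s S then f k (fst x) else snd x k)"
        unfolding fst_conv snd_conv by (simp only:)
    qed
  qed
  \<comment> \<open>Outside \<open>K\<close> the assignment is set to zero, a constant of every
    context; \<open>dep\<close> permits this.\<close>
  have "dp M A D C (\<lambda>x. P (\<lambda>k. if k \<in> K then f k x else zeroM M))"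
  proof (rule dp_reindex[OF *[OF K], where g = "\<lambda>x. (x, \<lambda>_. zeroM M)" and D' = D and C' = C,
        unfolded fst_conv snd_conv])
    show "(x, \<lambda>_. zeroM M) \<in> D \<times> envs M" if "x \<in> D" for x
      using that Z unfolding envs_def by simp
    show "basic M A D C (\<lambda>x. c (x, \<lambda>_. zeroM M))" if "c \<in> ?C" for c
      using that
    proof (rule C_cases)
      fix c0 assume c0: "c0 \<in> C" "c = (\<lambda>z. c0 (fst z))"
      show ?thesis unfolding c0(2) fst_conv by (rule basic_coord[OF c0(1)])
    next
      fix k assume k: "c = (\<lambda>z. snd z k)"
      show ?thesis unfolding k snd_conv by (rule basic_zero)
    qed
  qed
  then show ?thesis
  proof (rule dp_cong)
    fix x assume x: "x \<in> D"
    have "(\<lambda>k. if k \<in> K then f k x else zeroM M) \<in> envs M" "(\<lambda>k. f k x) \<in> envs M"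
      unfolding envs_def using fc[OF x] Z by simp_all
    then show "P (\<lambda>k. if k \<in> K then f k x else zeroM M) = P (\<lambda>k. f k x)"
      by (rule dep) simp
  qed
qed

lemma dp_sat:
  assumes "LA_formula p" "\<And>k. df M A D C (f k)" "zeroM M \<in> carr M"
  shows "dp M A D C (\<lambda>x. sat M {} (\<lambda>k. f k x) p)"
  by (rule dp_subst_env[OF dp_sat_env[OF assms(1)] finite_fvars[of p] _ assms(2,3)])
    (rule sat_cong)

lemma dp_single_variable:
  assumes "dp M A (carr M) {\<lambda>x. x} P"
  obtains q d where "LA_formula q" "\<And>k. d k \<in> insert (zeroM M) A"
    "\<And>v. v \<in> carr M \<Longrightarrow> P v \<longleftrightarrow> sat M {} (d(0 := v)) q"
proof -
  \<comment> \<open>A one-point context leaves the argument of \<open>P\<close> as the only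
    coordinate, so that the normal form consists of variable 0 and constants.\<close>
  have "dp M A ((UNIV :: unit set) \<times> carr M) (ext {}) (\<lambda>z. P (snd z))"
  proof (rule dp_reindex[OF assms, where g = snd])
    show "basic M A (UNIV \<times> carr M) (ext {}) (\<lambda>x. c (snd x))" if "c \<in> {\<lambda>x. x}" for c
      using that by (simp add: basic_snd)
  qed auto
  then obtain q and d :: "nat \<Rightarrow> unit \<Rightarrow> 'a" where q: "LA_formula q" "\<And>k. d k \<in> {} \<union> pconsts M A"
    and P: "\<And>x v. x \<in> UNIV \<Longrightarrow> v \<in> carr M \<Longrightarrow> P (snd (x, v)) \<longleftrightarrow> sat M {} ((\<lambda>k. d k x)(0 := v)) q"
    by (rule dp_normal_form) (rule that)
  have "d k () \<in> insert (zeroM M) A" for k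
    using q(2)[of k] unfolding pconsts_def by auto
  then show thesis
    by (rule that[OF q(1)]) (use P[of "()"] in simp)
qed

section \<open>Elementary arithmetic in a model of PA\<close>

locale arith =
  fixes M :: "'a LA_struct"
  assumes PA: "model_PA M"
begin

abbreviation Z :: 'a where "Z \<equiv> zeroM M"
abbreviation S :: "'a \<Rightarrow> 'a" where "S \<equiv> sucM M"
abbreviation add :: "'a \<Rightarrow> 'a \<Rightarrow> 'a" (infixl \<open>\<oplus>\<close> 65) where "a \<oplus> b \<equiv> addM M a b"
abbreviation mul :: "'a \<Rightarrow> 'a \<Rightarrow> 'a" (infixl \<open>\<otimes>\<close> 70) where "a \<otimes> b \<equiv> mulM M a b"
abbreviation lt :: "'a \<Rightarrow> 'a \<Rightarrow> bool" (infix \<open>\<prec>\<close> 50) where "a \<prec> b \<equiv> ltM M a b"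
abbreviation K :: "'a set" where "K \<equiv> carr M"

definition le :: "'a \<Rightarrow> 'a \<Rightarrow> bool" (infix \<open>\<preceq>\<close> 50) where
  "a \<preceq> b \<longleftrightarrow> a \<prec> b \<or> a = b"

lemma carr_closed [simp]:
  "Z \<in> K" "a \<in> K \<Longrightarrow> S a \<in> K" "a \<in> K \<Longrightarrow> b \<in> K \<Longrightarrow> a \<oplus> b \<in> K" "a \<in> K \<Longrightarrow> b \<in> K \<Longrightarrow> a \<otimes> b \<in> K"
  using PA unfolding model_PA_def LA_structure_def by blast+

lemma PA_axioms [simp]:
  "a \<in> K \<Longrightarrow> S a \<noteq> Z"
  "a \<in> K \<Longrightarrow> b \<in> K \<Longrightarrow> S a = S b \<longleftrightarrow> a = b"
  "a \<in> K \<Longrightarrow> a \<oplus> Z = a"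
  "a \<in> K \<Longrightarrow> b \<in> K \<Longrightarrow> a \<oplus> S b = S (a \<oplus> b)"
  "a \<in> K \<Longrightarrow> a \<otimes> Z = Z"
  "a \<in> K \<Longrightarrow> b \<in> K \<Longrightarrow> a \<otimes> S b = a \<otimes> b \<oplus> a"
  "a \<in> K \<Longrightarrow> \<not> a \<prec> Z"
  "a \<in> K \<Longrightarrow> b \<in> K \<Longrightarrow> a \<prec> S b \<longleftrightarrow> a \<prec> b \<or> a = b"
  using PA unfolding model_PA_def by blast+

lemma zero_neq_suc [simp]: "a \<in> K \<Longrightarrow> Z \<noteq> S a"
  using PA_axioms(1)[of a] by metis

lemma PA_induction: "LA_formula p \<Longrightarrow> induction_axiom M {} p"
  using PA unfolding model_PA_def by blast

lemma tval_carr [simp]: "(\<And>k. e k \<in> K) \<Longrightarrow> tval M e t \<in> K"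
  by (induction t) simp_all

abbreviation dpM :: "'x set \<Rightarrow> ('x \<Rightarrow> 'a) set \<Rightarrow> ('x \<Rightarrow> bool) \<Rightarrow> bool" where
  "dpM \<equiv> dp M K"

abbreviation dfM :: "'x set \<Rightarrow> ('x \<Rightarrow> 'a) set \<Rightarrow> ('x \<Rightarrow> 'a) \<Rightarrow> bool" where
  "dfM \<equiv> df M K"

abbreviation dp1 :: "('a \<Rightarrow> bool) \<Rightarrow> bool" where
  "dp1 \<equiv> dpM K {\<lambda>x. x}"

lemma dp1_single_variable:
  assumes "dp1 P"
  obtains q d where "LA_formula q" "\<And>k. d k \<in> K" "\<And>v. v \<in> K \<Longrightarrow> P v \<longleftrightarrow> sat M {} (d(0 := v)) q"
  using dp_single_variable[OF assms] by (metis carr_closed(1) insert_absorb)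

lemma induct [consumes 1, case_names dp zero suc]:
  assumes "a \<in> K" "dp1 P" "P Z" and step: "\<And>x. x \<in> K \<Longrightarrow> P x \<Longrightarrow> P (S x)"
  shows "P a"
proof -
  obtain q d where q: "LA_formula q" "\<And>k. d k \<in> K"
    and P: "\<And>v. v \<in> K \<Longrightarrow> P v \<longleftrightarrow> sat M {} (d(0 := v)) q"
    using dp1_single_variable[OF assms(2)] by metis
  have "\<forall>a\<in>K. sat M {} (d(0 := a)) q"
    using PA_induction[OF q(1)] unfolding induction_axiom_def
  proof (elim allE impE)
    show "\<forall>j. d j \<in> K" using q(2) by simp
    show "sat M {} (d(0 := Z)) q" using P[of Z] assms(3) by simp
    show "\<forall>a\<in>K. sat M {} (d(0 := a)) q \<longrightarrow> sat M {} (d(0 := S a)) q"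
      using P step by simp
  qed
  with P assms(1) show ?thesis by simp
qed

lemma df_const': "a \<in> K \<Longrightarrow> dfM D C (\<lambda>x. a)"
  by (rule df_const)

lemma df_add:
  assumes "dfM D C f" "dfM D C g"
  shows "dfM D C (\<lambda>x. f x \<oplus> g x)"
proof (rule df_app2[where h = "addM M", OF _ assms])
  let ?f = "\<lambda>k :: nat. if k = 0 then (\<lambda>z. fst (fst z)) else if k = 1 then (\<lambda>z. snd (fst z)) else snd"
  have b: "basic M K ((K \<times> K) \<times> K) (ext (ext {\<lambda>x. x})) (?f k)" for k
    by (simp add: basic_snd basic_fst[OF basic_snd] basic_fst[OF basic_fst[OF basic_coord], of "\<lambda>x. x"])
  have "dpM ((K \<times> K) \<times> K) (ext (ext {\<lambda>x. x})) (\<lambda>z. fst (fst z) \<oplus> snd (fst z) = snd z)"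
    by (rule dpI_basic[where p = "Eq (Add (Var 0) (Var 1)) (Var 2)" and f = ?f, OF _ b]) simp_all
  then show "dfM (K \<times> K) (ext {\<lambda>x. x}) (\<lambda>z. fst z \<oplus> snd z)"
    unfolding df_def by simp
qed

lemma df_mul:
  assumes "dfM D C f" "dfM D C g"
  shows "dfM D C (\<lambda>x. f x \<otimes> g x)"
proof (rule df_app2[where h = "mulM M", OF _ assms])
  let ?f = "\<lambda>k :: nat. if k = 0 then (\<lambda>z. fst (fst z)) else if k = 1 then (\<lambda>z. snd (fst z)) else snd"
  have b: "basic M K ((K \<times> K) \<times> K) (ext (ext {\<lambda>x. x})) (?f k)" for k
    by (simp add: basic_snd basic_fst[OF basic_snd] basic_fst[OF basic_fst[OF basic_coord], of "\<lambda>x. x"])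
  have "dpM ((K \<times> K) \<times> K) (ext (ext {\<lambda>x. x})) (\<lambda>z. fst (fst z) \<otimes> snd (fst z) = snd z)"
    by (rule dpI_basic[where p = "Eq (Mul (Var 0) (Var 1)) (Var 2)" and f = ?f, OF _ b]) simp_all
  then show "dfM (K \<times> K) (ext {\<lambda>x. x}) (\<lambda>z. fst z \<otimes> snd z)"
    unfolding df_def by simp
qed

lemma df_suc:
  assumes "dfM D C f"
  shows "dfM D C (\<lambda>x. S (f x))"
proof (rule df_app1[where h = "sucM M", OF _ assms])
  let ?f = "\<lambda>k :: nat. if k = 0 then fst else snd"
  have b: "basic M K (K \<times> K) (ext {\<lambda>x. x}) (?f k)" for k
    by (simp add: basic_snd basic_fst[OF basic_coord, of "\<lambda>x. x"])
  have "dpM (K \<times> K) (ext {\<lambda>x. x}) (\<lambda>z. S (fst z) = snd z)"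
    by (rule dpI_basic[where p = "Eq (Sc (Var 0)) (Var 1)" and f = ?f, OF _ b]) simp_all
  then show "dfM K {\<lambda>x. x} (\<lambda>z. S z)"
    unfolding df_def by simp
qed

lemma dp_le: "dfM D C f \<Longrightarrow> dfM D C g \<Longrightarrow> dpM D C (\<lambda>x. f x \<preceq> g x)"
  unfolding le_def by (intro dp_disj dp_lt dp_eq)

lemmas dp_rules = dp_conj dp_neg dp_disj dp_imp dp_iff dp_ex dp_all dp_eq dp_lt dp_le
  df_suc df_add df_mul df_snd df_const' df_id df_weaken

lemma zero_add [simp]:
  assumes "a \<in> K"
  shows "Z \<oplus> a = a"
  using assms(1)
proof (induction a rule: induct)
  show "dp1 (\<lambda>a. Z \<oplus> a = a)" by (intro dp_rules | simp)+
qed simp_all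

lemma suc_add [simp]:
  assumes "b \<in> K" and [simp]: "a \<in> K"
  shows "S a \<oplus> b = S (a \<oplus> b)"
  using assms(1)
proof (induction b rule: induct)
  show "dp1 (\<lambda>b. S a \<oplus> b = S (a \<oplus> b))"
    by (intro dp_rules | simp)+
qed simp_all

lemma add_comm:
  assumes "b \<in> K" and [simp]: "a \<in> K"
  shows "a \<oplus> b = b \<oplus> a"
  using assms(1)
proof (induction b rule: induct)
  show "dp1 (\<lambda>b. a \<oplus> b = b \<oplus> a)"
    by (intro dp_rules | simp)+
qed simp_all


lemma add_assoc:
  assumes "c \<in> K" and [simp]: "a \<in> K" "b \<in> K"
  shows "(a \<oplus> b) \<oplus> c = a \<oplus> (b \<oplus> c)"
  using assms(1)
proof (induction c rule: induct)
  show "dp1 (\<lambda>c. (a \<oplus> b) \<oplus> c = a \<oplus> (b \<oplus> c))"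
    by (intro dp_rules | simp)+
qed simp_all

lemma add_left_comm: "a \<in> K \<Longrightarrow> b \<in> K \<Longrightarrow> c \<in> K \<Longrightarrow> b \<oplus> (a \<oplus> c) = a \<oplus> (b \<oplus> c)"
  using add_assoc[of c a b] add_assoc[of c b a] add_comm[of a b] by simp

lemmas add_ac = add_assoc add_comm add_left_comm

lemma add_right_cancel [simp]:
  assumes "c \<in> K" and [simp]: "a \<in> K" "b \<in> K"
  shows "a \<oplus> c = b \<oplus> c \<longleftrightarrow> a = b"
  using assms(1)
proof (induction c rule: induct)
  show "dp1 (\<lambda>c. (a \<oplus> c = b \<oplus> c) \<longleftrightarrow> a = b)"
    by (intro dp_rules | simp)+
qed simp_all

lemma add_left_cancel [simp]: "c \<in> K \<Longrightarrow> a \<in> K \<Longrightarrow> b \<in> K \<Longrightarrow> c \<oplus> a = c \<oplus> b \<longleftrightarrow> a = b"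
  using add_right_cancel[of c a b] add_comm[of a c] add_comm[of b c] by simp

lemma zero_mul [simp]:
  assumes "a \<in> K"
  shows "Z \<otimes> a = Z"
  using assms(1)
proof (induction a rule: induct)
  show "dp1 (\<lambda>a. Z \<otimes> a = Z)" by (intro dp_rules | simp)+
qed simp_all

lemma suc_mul [simp]:
  assumes "b \<in> K" and [simp]: "a \<in> K"
  shows "S a \<otimes> b = a \<otimes> b \<oplus> b"
  using assms(1)
proof (induction b rule: induct)
  show "dp1 (\<lambda>b. S a \<otimes> b = a \<otimes> b \<oplus> b)"
    by (intro dp_rules | simp)+
next
  fix x assume "x \<in> K" "S a \<otimes> x = a \<otimes> x \<oplus> x"
  then show "S a \<otimes> S x = a \<otimes> S x \<oplus> S x"
    using add_assoc[of a "a \<otimes> x" x] add_assoc[of x "a \<otimes> x" a] add_comm[of a x] by simp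
qed simp_all

lemma mul_comm:
  assumes "b \<in> K" and [simp]: "a \<in> K"
  shows "a \<otimes> b = b \<otimes> a"
  using assms(1)
proof (induction b rule: induct)
  show "dp1 (\<lambda>b. a \<otimes> b = b \<otimes> a)"
    by (intro dp_rules | simp)+
qed simp_all

lemma distrib_left:
  assumes "c \<in> K" and [simp]: "a \<in> K" "b \<in> K"
  shows "a \<otimes> (b \<oplus> c) = a \<otimes> b \<oplus> a \<otimes> c"
  using assms(1)
proof (induction c rule: induct)
  show "dp1 (\<lambda>c. a \<otimes> (b \<oplus> c) = a \<otimes> b \<oplus> a \<otimes> c)"
    by (intro dp_rules | simp)+
qed (simp_all add: add_assoc)

lemma distrib_right: "c \<in> K \<Longrightarrow> a \<in> K \<Longrightarrow> b \<in> K \<Longrightarrow> (b \<oplus> c) \<otimes> a = b \<otimes> a \<oplus> c \<otimes> a"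
  using distrib_left[of c a b] mul_comm[of a "b \<oplus> c"] mul_comm[of b a] mul_comm[of c a] by simp

lemma mul_assoc:
  assumes "c \<in> K" and [simp]: "a \<in> K" "b \<in> K"
  shows "(a \<otimes> b) \<otimes> c = a \<otimes> (b \<otimes> c)"
  using assms(1)
proof (induction c rule: induct)
  show "dp1 (\<lambda>c. (a \<otimes> b) \<otimes> c = a \<otimes> (b \<otimes> c))"
    by (intro dp_rules | simp)+
qed (simp_all add: distrib_left)

lemma mul_left_comm: "a \<in> K \<Longrightarrow> b \<in> K \<Longrightarrow> c \<in> K \<Longrightarrow> b \<otimes> (a \<otimes> c) = a \<otimes> (b \<otimes> c)"
  using mul_assoc[of c a b] mul_assoc[of c b a] mul_comm[of a b] by simp

lemma zero_or_suc:
  assumes "a \<in> K"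
  shows "a = Z \<or> (\<exists>b\<in>K. a = S b)"
  using assms(1)
proof (induction a rule: induct)
  show "dp1 (\<lambda>a. a = Z \<or> (\<exists>b\<in>K. a = S b))" by (intro dp_rules | simp)+
qed auto

text \<open>The axioms describe \<open>\<prec>\<close> only at zero and at successors. Expressing it
  by addition reduces order facts such as transitivity and monotonicity to algebra.\<close>

lemma lt_iff:
  assumes "b \<in> K" and [simp]: "a \<in> K"
  shows "a \<prec> b \<longleftrightarrow> (\<exists>c\<in>K. b = a \<oplus> S c)"
  using assms(1)
proof (induction b rule: induct)
  show "dp1 (\<lambda>b. a \<prec> b \<longleftrightarrow> (\<exists>c\<in>K. b = a \<oplus> S c))"
    by (intro dp_rules | simp)+
next
  fix b assume b: "b \<in> K" and IH: "a \<prec> b \<longleftrightarrow> (\<exists>c\<in>K. b = a \<oplus> S c)"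
  have a: "a \<in> K" by simp
  have "(\<exists>c\<in>K. S b = a \<oplus> S c) \<longleftrightarrow> (\<exists>c\<in>K. b = a \<oplus> c)"
    using a b by auto
  also have "\<dots> \<longleftrightarrow> b = a \<or> (\<exists>c\<in>K. b = a \<oplus> S c)"
    using zero_or_suc a by (metis PA_axioms(3) carr_closed(1,2))
  finally show "a \<prec> S b \<longleftrightarrow> (\<exists>c\<in>K. S b = a \<oplus> S c)"
    using IH a b by auto
qed auto

lemma le_iff: "a \<in> K \<Longrightarrow> b \<in> K \<Longrightarrow> a \<preceq> b \<longleftrightarrow> (\<exists>c\<in>K. b = a \<oplus> c)"
  unfolding le_def lt_iff using zero_or_suc by (metis PA_axioms(3) carr_closed(1,2))

lemma lt_irrefl [simp]: "a \<in> K \<Longrightarrow> \<not> a \<prec> a"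
proof
  assume a: "a \<in> K" "a \<prec> a"
  then obtain c where c: "c \<in> K" "a = a \<oplus> S c" using lt_iff by blast
  then have "a \<oplus> Z = a \<oplus> S c" using a by simp
  then show False using add_left_cancel[of a Z "S c"] a c by simp
qed

lemma lt_trans: "a \<prec> b \<Longrightarrow> b \<prec> c \<Longrightarrow> a \<in> K \<Longrightarrow> b \<in> K \<Longrightarrow> c \<in> K \<Longrightarrow> a \<prec> c"
proof -
  assume "a \<prec> b" "b \<prec> c" and K: "a \<in> K" "b \<in> K" "c \<in> K"
  then obtain d e where d: "d \<in> K" "e \<in> K" and e: "b = a \<oplus> S d" "c = b \<oplus> S e"
    using lt_iff[of b a] lt_iff[of c b] by blast
  have "c = a \<oplus> S (S d \<oplus> e)" unfolding e using d K by (simp add: add_assoc)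
  moreover have "S d \<oplus> e \<in> K" using d by simp
  ultimately show "a \<prec> c" unfolding lt_iff[OF K(3,1)] by blast
qed

lemma zero_le [simp]: "a \<in> K \<Longrightarrow> Z \<preceq> a"
  using le_iff[of Z a] by force

lemma suc_le_iff: "a \<in> K \<Longrightarrow> b \<in> K \<Longrightarrow> S a \<preceq> b \<longleftrightarrow> a \<prec> b"
  using le_iff[of "S a" b] lt_iff[of b a] by simp

lemma lt_total:
  assumes "b \<in> K" and [simp]: "a \<in> K"
  shows "a \<prec> b \<or> a = b \<or> b \<prec> a"
  using assms(1)
proof (induction b rule: induct)
  show "dp1 (\<lambda>b. a \<prec> b \<or> a = b \<or> b \<prec> a)"
    by (intro dp_rules | simp)+
next
  show "a \<prec> Z \<or> a = Z \<or> Z \<prec> a"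
    using zero_le[of a] unfolding le_def by simp blast
next
  fix b assume "b \<in> K" "a \<prec> b \<or> a = b \<or> b \<prec> a"
  then show "a \<prec> S b \<or> a = S b \<or> S b \<prec> a"
    using suc_le_iff[of b a] unfolding le_def by auto
qed

lemma not_lt: "a \<in> K \<Longrightarrow> b \<in> K \<Longrightarrow> \<not> a \<prec> b \<longleftrightarrow> b \<preceq> a"
  unfolding le_def using lt_total lt_trans lt_irrefl by blast

lemma le_refl [simp]: "a \<preceq> a"
  unfolding le_def by blast

lemma lt_imp_le: "a \<prec> b \<Longrightarrow> a \<preceq> b"
  unfolding le_def by blast

lemma le_trans: "a \<preceq> b \<Longrightarrow> b \<preceq> c \<Longrightarrow> a \<in> K \<Longrightarrow> b \<in> K \<Longrightarrow> c \<in> K \<Longrightarrow> a \<preceq> c"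
  unfolding le_def using lt_trans by blast

lemma le_lt_trans: "a \<preceq> b \<Longrightarrow> b \<prec> c \<Longrightarrow> a \<in> K \<Longrightarrow> b \<in> K \<Longrightarrow> c \<in> K \<Longrightarrow> a \<prec> c"
  unfolding le_def using lt_trans by blast

lemma lt_le_trans: "a \<prec> b \<Longrightarrow> b \<preceq> c \<Longrightarrow> a \<in> K \<Longrightarrow> b \<in> K \<Longrightarrow> c \<in> K \<Longrightarrow> a \<prec> c"
  unfolding le_def using lt_trans by blast

lemma lt_asym: "a \<prec> b \<Longrightarrow> b \<prec> a \<Longrightarrow> a \<in> K \<Longrightarrow> b \<in> K \<Longrightarrow> False"
  using lt_trans lt_irrefl by blast

lemma lt_suc_le: "a \<in> K \<Longrightarrow> b \<in> K \<Longrightarrow> a \<prec> S b \<longleftrightarrow> a \<preceq> b"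
  unfolding le_def by simp

lemma lt_suc [simp]: "a \<in> K \<Longrightarrow> a \<prec> S a"
  by simp

lemma le_add1: "a \<in> K \<Longrightarrow> b \<in> K \<Longrightarrow> a \<preceq> a \<oplus> b"
  using le_iff[of a "a \<oplus> b"] by auto

lemma le_add2: "a \<in> K \<Longrightarrow> b \<in> K \<Longrightarrow> b \<preceq> a \<oplus> b"
  using le_add1[of b a] add_comm[of b a] by simp

lemma add_mono: "a \<preceq> b \<Longrightarrow> c \<preceq> d \<Longrightarrow> a \<in> K \<Longrightarrow> b \<in> K \<Longrightarrow> c \<in> K \<Longrightarrow> d \<in> K \<Longrightarrow> a \<oplus> c \<preceq> b \<oplus> d"
proof -
  assume "a \<preceq> b" "c \<preceq> d" and K: "a \<in> K" "b \<in> K" "c \<in> K" "d \<in> K"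
  then obtain e f where e: "e \<in> K" "f \<in> K" and b: "b = a \<oplus> e" and d: "d = c \<oplus> f"
    using le_iff[of a b] le_iff[of c d] by blast
  have "b \<oplus> d = (a \<oplus> c) \<oplus> (e \<oplus> f)"
    unfolding b d using e K by (simp add: add_ac)
  then show ?thesis using le_add1[of "a \<oplus> c" "e \<oplus> f"] e K by simp
qed

lemma mul_mono: "a \<preceq> b \<Longrightarrow> c \<preceq> d \<Longrightarrow> a \<in> K \<Longrightarrow> b \<in> K \<Longrightarrow> c \<in> K \<Longrightarrow> d \<in> K \<Longrightarrow> a \<otimes> c \<preceq> b \<otimes> d"
proof -
  assume "a \<preceq> b" "c \<preceq> d" and K: "a \<in> K" "b \<in> K" "c \<in> K" "d \<in> K"
  then obtain e f where e: "e \<in> K" "f \<in> K" and b: "b = a \<oplus> e" and d: "d = c \<oplus> f"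
    using le_iff[of a b] le_iff[of c d] by blast
  have "b \<otimes> d = (a \<otimes> c) \<oplus> (a \<otimes> f \<oplus> e \<otimes> (c \<oplus> f))"
    unfolding b d using e K by (simp add: add_ac distrib_left distrib_right)
  then show ?thesis
    using le_add1[of "a \<otimes> c" "a \<otimes> f \<oplus> e \<otimes> (c \<oplus> f)"] e K by simp
qed

lemma suc_mono: "a \<preceq> b \<Longrightarrow> a \<in> K \<Longrightarrow> b \<in> K \<Longrightarrow> S a \<preceq> S b"
  unfolding le_def using suc_le_iff[of a "S b"] by (auto simp: le_def)

lemma upper_bound2:
  assumes "a \<in> K" "b \<in> K"
  obtains c where "c \<in> K" "a \<preceq> c" "b \<preceq> c"
  using that[of "a \<oplus> b"] le_add1[OF assms] le_add2[OF assms] assms by simp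

lemma finite_upper_bound:
  assumes "finite F" "F \<subseteq> K"
  obtains b where "b \<in> K" "\<And>a. a \<in> F \<Longrightarrow> a \<preceq> b"
proof -
  have "\<exists>b\<in>K. \<forall>a\<in>F. a \<preceq> b"
    using assms
  proof (induction F rule: finite_induct)
    case empty
    show ?case using carr_closed(1) by blast
  next
    case (insert x F)
    then obtain b where b: "b \<in> K" "\<forall>a\<in>F. a \<preceq> b" by auto
    have x: "x \<in> K" using insert.prems by simp
    obtain c where "c \<in> K" "x \<preceq> c" "b \<preceq> c" using upper_bound2[OF x b(1)] .
    with b insert.prems show ?case by (metis insert_iff le_trans subsetD)
  qed
  with that show ?thesis by blast
qed

lemma least:
  assumes P: "dp1 P" and a: "a \<in> K" "P a"
  obtains m where "m \<in> K" "P m" "\<And>x. x \<in> K \<Longrightarrow> x \<prec> m \<Longrightarrow> \<not> P x"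
proof (rule ccontr)
  assume neg: "\<not> thesis"
  note least_intro = that
  have step: "\<not> P x" if "x \<in> K" "\<forall>y\<in>K. y \<prec> x \<longrightarrow> \<not> P y" for x
    using neg that least_intro[of x] by blast
  \<comment> \<open>Without a least element, "nothing below x satisfies \<open>P\<close>" is
    inductive.\<close>
  have "\<forall>y\<in>K. y \<prec> x \<longrightarrow> \<not> P y" if "x \<in> K" for x
    using that
  proof (induction x rule: induct)
    show "dp1 (\<lambda>x. \<forall>y\<in>K. y \<prec> x \<longrightarrow> \<not> P y)"
      by (intro dp_rules dp_app1[OF P])
    show "\<forall>y\<in>K. y \<prec> S x \<longrightarrow> \<not> P y" if "x \<in> K" "\<forall>y\<in>K. y \<prec> x \<longrightarrow> \<not> P y" for x
      using that step[of x] by auto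
  qed simp
  from this[of "S a"] a lt_suc[of a] carr_closed(2)[of a] show False by blast
qed

section \<open>A definable ultrafilter\<close>


definition unb :: "('a \<Rightarrow> bool) \<Rightarrow> bool" where
  "unb X \<longleftrightarrow> (\<forall>b\<in>K. \<exists>x\<in>K. X x \<and> b \<prec> x)"

definition evt :: "('a \<Rightarrow> bool) \<Rightarrow> ('a \<Rightarrow> bool) \<Rightarrow> bool" where
  "evt X P \<longleftrightarrow> (\<exists>b\<in>K. \<forall>x\<in>K. X x \<and> b \<prec> x \<longrightarrow> P x)"

text \<open>
  The argument of MacDowell and Specker: sequences of truth values of length \<open>y\<close> are represented
  by the elements \<open>x0\<close> that realise them, so that the leftmost branch through the tree of those
  sequences that are realised unboundedly often in \<open>X\<close> is definable without coding of sequences.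
  The new set \<open>X'\<close> follows this branch.
\<close>

lemma decide_binary:
  assumes X: "dp1 X" and unb: "unb X" and \<phi>: "dp2 M K \<phi>"
  obtains X' where "dp1 X'" "unb X'" "\<And>x. X' x \<Longrightarrow> X x"
    "\<And>y. y \<in> K \<Longrightarrow> evt X' (\<lambda>x. \<phi> x y) \<or> evt X' (\<lambda>x. \<not> \<phi> x y)"
proof -
  define agr where "agr x0 x y \<longleftrightarrow> (\<forall>i\<in>K. i \<prec> y \<longrightarrow> (\<phi> x i \<longleftrightarrow> \<phi> x0 i))" for x0 x y
  define Big where "Big x0 y \<longleftrightarrow> (\<forall>b\<in>K. \<exists>x\<in>K. X x \<and> b \<prec> x \<and> agr x0 x y)" for x0 y
  \<comment> \<open>False is the left branch: \<open>G\<close> allows the value True at i only where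
    the sibling node with value False is not realised unboundedly often.\<close>
  define G where "G x0 y \<longleftrightarrow> Big x0 y \<and>
      (\<forall>i\<in>K. i \<prec> y \<and> \<phi> x0 i \<longrightarrow> \<not> (\<exists>x1\<in>K. Big x1 (S i) \<and> agr x0 x1 i \<and> \<not> \<phi> x1 i))" for x0 y
  have dp_Big: "dp2 M K Big"
    unfolding Big_def agr_def by (intro dp_rules dp_app1[OF X] dp_app2[OF \<phi>])
  have dp_G: "dp2 M K G"
    unfolding G_def agr_def by (intro dp_rules dp_app2[OF dp_Big] dp_app2[OF \<phi>])
  have agr_sym: "agr x0 x1 y \<Longrightarrow> agr x1 x0 y" for x0 x1 y
    unfolding agr_def by blast
  have agr_trans: "agr x0 x1 y \<Longrightarrow> agr x1 x2 y \<Longrightarrow> agr x0 x2 y" for x0 x1 x2 y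
    unfolding agr_def by blast
  have agr_mono: "agr x0 x1 y \<Longrightarrow> y' \<preceq> y \<Longrightarrow> y \<in> K \<Longrightarrow> y' \<in> K \<Longrightarrow> agr x0 x1 y'" for x0 x1 y y'
    unfolding agr_def using lt_le_trans by blast
  have agr_suc: "agr x0 x1 (S y) \<longleftrightarrow> agr x0 x1 y \<and> (\<phi> x1 y \<longleftrightarrow> \<phi> x0 y)" if "y \<in> K" for x0 x1 y
    unfolding agr_def using that by auto
  have Big_agr: "Big x1 y" if "Big x0 y" "agr x0 x1 y" for x0 x1 y
    using that agr_trans[OF agr_sym] unfolding Big_def by blast
  have Big_mono: "Big x0 y'" if "Big x0 y" "y' \<preceq> y" "y \<in> K" "y' \<in> K" for x0 y y'
    using that agr_mono unfolding Big_def by blast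
  have G_Big: "G x0 y \<Longrightarrow> Big x0 y" for x0 y
    unfolding G_def by blast
  have G_mono: "G x0 y'" if "G x0 y" "y' \<preceq> y" "y \<in> K" "y' \<in> K" for x0 y y'
    using that Big_mono[of x0 y y'] lt_le_trans[of _ y' y] unfolding G_def by blast
  have G_agr: "G x1 y" if "G x0 y" "agr x0 x1 y" "y \<in> K" for x0 x1 y
    unfolding G_def
  proof (intro conjI ballI impI notI)
    show "Big x1 y" using Big_agr[OF G_Big[OF that(1)] that(2)] .
    fix i assume i: "i \<in> K" "i \<prec> y \<and> \<phi> x1 i"
      and "\<exists>x2\<in>K. Big x2 (S i) \<and> agr x1 x2 i \<and> \<not> \<phi> x2 i"
    then obtain x2 where x2: "x2 \<in> K" "Big x2 (S i)" "agr x1 x2 i" "\<not> \<phi> x2 i" by blast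
    have "\<phi> x0 i" using that(2) i unfolding agr_def by blast
    moreover have "agr x0 x2 i"
      using agr_trans[OF agr_mono[OF that(2)] x2(3)] i that(3) lt_imp_le by blast
    ultimately show False using that(1) i x2 unfolding G_def by blast
  qed
  have G_unique: "agr x0 x1 y" if G: "G x0 y" "G x1 y" and K: "x0 \<in> K" "x1 \<in> K" "y \<in> K" for x0 x1 y
  proof (rule ccontr)
    assume "\<not> agr x0 x1 y"
    then obtain i where i: "i \<in> K" "i \<prec> y \<and> (\<phi> x1 i \<longleftrightarrow> \<not> \<phi> x0 i)"
      unfolding agr_def by blast
    \<comment> \<open>At the first difference one of the two elements turns right although the other
      one shows that the left turn was available.\<close>
    have "dp1 (\<lambda>i. i \<prec> y \<and> (\<phi> x1 i \<longleftrightarrow> \<not> \<phi> x0 i))"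
      by (intro dp_rules dp_app2[OF \<phi>] K)
    from least[OF this i] obtain j where j: "j \<in> K" "j \<prec> y" "\<phi> x1 j \<longleftrightarrow> \<not> \<phi> x0 j"
      and min: "\<And>x. x \<in> K \<Longrightarrow> x \<prec> j \<Longrightarrow> \<not> (x \<prec> y \<and> (\<phi> x1 x \<longleftrightarrow> \<not> \<phi> x0 x))" by metis
    have a: "agr x0 x1 j"
      unfolding agr_def using min lt_trans[OF _ j(2)] j(1) K(3) by blast
    have le: "S j \<preceq> y" using suc_le_iff j K by blast
    have B: "Big x0 (S j)" "Big x1 (S j)"
      using Big_mono[OF G_Big[OF G(1)] le] Big_mono[OF G_Big[OF G(2)] le] j K by simp_all
    show False
    proof (cases "\<phi> x0 j")
      case True
      with G(1) j B a K show False unfolding G_def by blast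
    next
      case False
      with G(2) j B agr_sym[OF a] K show False unfolding G_def by blast
    qed
  qed
  have G_ex: "\<exists>x0\<in>K. G x0 y" if "y \<in> K" for y
    using that
  proof (induction y rule: induct)
    show "dp1 (\<lambda>y. \<exists>x0\<in>K. G x0 y)" by (intro dp_rules dp_app2[OF dp_G])
    have "G Z Z" unfolding G_def Big_def agr_def using unb unfolding unb_def by auto
    then show "\<exists>x0\<in>K. G x0 Z" using carr_closed(1) by blast
  next
    fix y assume y: "y \<in> K" and "\<exists>x0\<in>K. G x0 y"
    then obtain x0 where x0: "x0 \<in> K" "G x0 y" by blast
    have step: "G x1 (S y)" if "x1 \<in> K" "Big x1 (S y)" "agr x0 x1 y"
      "\<phi> x1 y \<Longrightarrow> \<not> (\<exists>x2\<in>K. Big x2 (S y) \<and> agr x1 x2 y \<and> \<not> \<phi> x2 y)" for x1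
    proof -
      have "G x1 y" using G_agr[OF x0(2) that(3) y] .
      then show ?thesis using that(2,4) y unfolding G_def by auto
    qed
    show "\<exists>x0\<in>K. G x0 (S y)"
    proof (cases "\<exists>x1\<in>K. Big x1 (S y) \<and> agr x0 x1 y \<and> \<not> \<phi> x1 y")
      case True
      with step show ?thesis by blast
    next
      case False
      \<comment> \<open>If the right child were not realised beyond some b, all realisations of the
        node beyond b would go left, and the left child would be \<open>Big\<close>.\<close>
      have claim: "\<exists>x\<in>K. X x \<and> b \<prec> x \<and> agr x0 x y \<and> \<phi> x y" if b: "b \<in> K" for b
      proof (rule ccontr)
        assume none: "\<not> (\<exists>x\<in>K. X x \<and> b \<prec> x \<and> agr x0 x y \<and> \<phi> x y)"
        obtain x1 where x1: "x1 \<in> K" "X x1" "b \<prec> x1" "agr x0 x1 y"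
          using G_Big[OF x0(2)] b unfolding Big_def by blast
        have "Big x1 (S y)"
          unfolding Big_def
        proof
          fix b' assume b': "b' \<in> K"
          obtain c where c: "c \<in> K" "b \<preceq> c" "b' \<preceq> c" using upper_bound2[OF b b'] .
          obtain x where x: "x \<in> K" "X x" "c \<prec> x" "agr x0 x y"
            using G_Big[OF x0(2)] c unfolding Big_def by blast
          have "b \<prec> x" "b' \<prec> x" using le_lt_trans c x b b' by blast+
          moreover from this have "\<not> \<phi> x y" "\<not> \<phi> x1 y" using none x x1 by blast+
          moreover have "agr x1 x y" using agr_trans[OF agr_sym[OF x1(4)] x(4)] .
          ultimately show "\<exists>x\<in>K. X x \<and> b' \<prec> x \<and> agr x1 x (S y)"
            using x agr_suc[OF y] by blast
        qed
        moreover have "\<not> \<phi> x1 y" using none x1 by blast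
        ultimately show False using False x1 by blast
      qed
      obtain x1 where x1: "x1 \<in> K" "agr x0 x1 y" "\<phi> x1 y" using claim[OF carr_closed(1)] by blast
      have "Big x1 (S y)"
        unfolding Big_def
      proof
        fix b assume "b \<in> K"
        from claim[OF this] obtain x where x: "x \<in> K" "X x" "b \<prec> x" "agr x0 x y" "\<phi> x y" by blast
        then have "agr x1 x (S y)"
          using agr_suc[OF y] agr_trans[OF agr_sym[OF x1(2)] x(4)] x1(3) by blast
        with x show "\<exists>x\<in>K. X x \<and> b \<prec> x \<and> agr x1 x (S y)" by blast
      qed
      with step[OF x1(1) _ x1(2)] False agr_trans[OF x1(2)] x1(1) show ?thesis by blast
    qed
  qed
  have G_unb: "\<exists>x\<in>K. X x \<and> y \<prec> x \<and> G x y" if "y \<in> K" for y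
    using G_ex[OF that] G_Big G_agr that unfolding Big_def by blast
  have least_G: "\<exists>m\<in>K. X m \<and> y \<prec> m \<and> G m y \<and> (\<forall>x\<in>K. x \<prec> m \<longrightarrow> \<not> (X x \<and> y \<prec> x \<and> G x y))"
    if y: "y \<in> K" for y
  proof -
    have "dp1 (\<lambda>x. X x \<and> y \<prec> x \<and> G x y)"
      by (intro dp_rules dp_app1[OF X] dp_app2[OF dp_G] y)
    from least[OF this] G_unb[OF y] show ?thesis by metis
  qed
  \<comment> \<open>One element is picked per level: the least member of \<open>X\<close> above y
    that lies on the branch up to y. From some point on all picks agree at any given index.\<close>
  define X' where "X' x \<longleftrightarrow> X x \<and> (\<exists>y\<in>K. y \<prec> x \<and> G x y \<and>
      (\<forall>x'\<in>K. x' \<prec> x \<longrightarrow> \<not> (X x' \<and> y \<prec> x' \<and> G x' y)))" for x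
  show thesis
  proof (rule that[of X'])
    show "dp1 X'"
      unfolding X'_def by (intro dp_rules dp_app1[OF X] dp_app2[OF dp_G])
    show "unb X'"
      unfolding unb_def X'_def using least_G by blast
    show "X' x \<Longrightarrow> X x" for x unfolding X'_def by blast
    fix i assume i: "i \<in> K"
    then have Si: "S i \<in> K" by simp
    obtain m where m: "m \<in> K" "X m" "S i \<prec> m" "G m (S i)" using least_G[OF Si] by blast
    have "G x (S i)" if x: "x \<in> K" "X' x" "m \<prec> x" for x
    proof -
      obtain y where y: "y \<in> K" "y \<prec> x" "G x y"
        and min: "\<And>x'. x' \<in> K \<Longrightarrow> x' \<prec> x \<Longrightarrow> \<not> (X x' \<and> y \<prec> x' \<and> G x' y)"
        using x(2) unfolding X'_def by blast
      show ?thesis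
      proof (cases "y \<prec> S i")
        \<comment> \<open>At a level y below \<open>S i\<close> the element m would be a smaller
          candidate than x, so x was not picked there.\<close>
        case True
        then have "y \<prec> m" "G m y"
          using lt_trans[OF True m(3)] G_mono[OF m(4) lt_imp_le[OF True]] y m Si by blast+
        with min[OF m(1) x(3)] m(2) show ?thesis by blast
      next
        case False
        then show ?thesis using G_mono[OF y(3)] not_lt[OF y(1) Si] y Si by blast
      qed
    qed
    then have "agr m x (S i)" if "x \<in> K" "X' x" "m \<prec> x" for x
      using G_unique[OF m(4)] m(1) Si that by blast
    then have "\<phi> x i \<longleftrightarrow> \<phi> m i" if "x \<in> K" "X' x" "m \<prec> x" for x
      using agr_suc[OF i] that by blast
    then show "evt X' (\<lambda>x. \<phi> x i) \<or> evt X' (\<lambda>x. \<not> \<phi> x i)"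
      unfolding evt_def using m(1) by blast
  qed
qed

section \<open>Pairing and codes of tuples\<close>

definition pr :: "'a \<Rightarrow> 'a \<Rightarrow> 'a" where
  "pr a b = (a \<oplus> b) \<otimes> (a \<oplus> b) \<oplus> a"

lemma pr_carr [simp]: "a \<in> K \<Longrightarrow> b \<in> K \<Longrightarrow> pr a b \<in> K"
  unfolding pr_def by simp

text \<open>With s = a + b the code lies between s^2 and s^2 + s, hence below (s + 1)^2. Codes with
  different sums therefore lie in disjoint intervals, which gives injectivity without halving or
  subtraction.\<close>

lemma pr_lt:
  assumes "a \<oplus> b \<prec> c \<oplus> d" and [simp]: "a \<in> K" "b \<in> K" "c \<in> K" "d \<in> K"
  shows "pr a b \<prec> pr c d"
proof -
  define s where "s = a \<oplus> b"
  define t where "t = c \<oplus> d"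
  have [simp]: "s \<in> K" "t \<in> K" unfolding s_def t_def by simp_all
  have st: "S s \<preceq> t" using assms(1) suc_le_iff[of s t] unfolding s_def t_def by simp
  have "pr a b \<preceq> s \<otimes> s \<oplus> s"
    unfolding pr_def s_def[symmetric] by (rule add_mono) (simp_all add: s_def le_add1)
  moreover have "s \<otimes> s \<oplus> s \<preceq> s \<otimes> s \<oplus> s \<oplus> s"
    by (rule le_add1) simp_all
  ultimately have "pr a b \<preceq> s \<otimes> s \<oplus> s \<oplus> s" by (rule le_trans) (simp_all add: pr_def)
  then have 1: "pr a b \<prec> S (s \<otimes> s \<oplus> s \<oplus> s)" unfolding le_def by simp
  have 2: "S (s \<otimes> s \<oplus> s \<oplus> s) \<preceq> t \<otimes> t"
    using mul_mono[OF st st] by simp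
  have 3: "t \<otimes> t \<preceq> pr c d" unfolding pr_def t_def[symmetric] by (rule le_add1) simp_all
  show ?thesis
    by (rule lt_le_trans[OF lt_le_trans[OF 1 2] 3]) simp_all
qed

lemma pr_inject:
  assumes "pr a b = pr c d" and K: "a \<in> K" "b \<in> K" "c \<in> K" "d \<in> K"
  shows "a = c \<and> b = d"
proof -
  have "a \<oplus> b = c \<oplus> d"
    using lt_total[of "c \<oplus> d" "a \<oplus> b"] pr_lt[of a b c d] pr_lt[of c d a b] assms
      lt_irrefl[of "pr a b"] by auto
  moreover from this have "a = c" using assms(1) K unfolding pr_def by simp
  ultimately show ?thesis using K by simp
qed

text \<open>Coordinate 0 is left out: it is the variable over which the ultrafilter will quantify,
  and the code collects the parameters at 1, ..., n.\<close>

primrec enc :: "nat \<Rightarrow> (nat \<Rightarrow> 'a) \<Rightarrow> 'a" where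
  "enc 0 y = Z"
| "enc (Suc n) y = pr (y (Suc n)) (enc n y)"

lemma enc_carr [simp]: "y \<in> envs M \<Longrightarrow> enc n y \<in> K"
  by (induction n) simp_all

lemma enc_cong: "(\<And>k. 0 < k \<Longrightarrow> k \<le> n \<Longrightarrow> y k = y' k) \<Longrightarrow> enc n y = enc n y'"
  by (induction n) simp_all

lemma enc_inject:
  "enc n y = enc n y' \<Longrightarrow> y \<in> envs M \<Longrightarrow> y' \<in> envs M \<Longrightarrow> 0 < k \<Longrightarrow> k \<le> n \<Longrightarrow> y k = y' k"
proof (induction n)
  case (Suc n)
  have "y (Suc n) = y' (Suc n)" "enc n y = enc n y'"
    using pr_inject[of "y (Suc n)" "enc n y" "y' (Suc n)" "enc n y'"] Suc.prems by simp_all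
  with Suc show ?case by (cases "k = Suc n") simp_all
qed simp

text \<open>In place of projections from a code there is an existential quantifier over the tuples
  with that code. Peeling off the outermost pair gives \<open>dec_Suc\<close>, and definability
  follows by recursion on the standard number n. \<open>y0\<close> supplies the coordinates outside
  1, ..., n.\<close>

definition dec :: "((nat \<Rightarrow> 'a) \<Rightarrow> bool) \<Rightarrow> nat \<Rightarrow> (nat \<Rightarrow> 'a) \<Rightarrow> 'a \<Rightarrow> bool" where
  "dec P n y0 c \<longleftrightarrow>
    (\<exists>y\<in>envs M. (\<forall>k. k = 0 \<or> n < k \<longrightarrow> y k = y0 k) \<and> c = enc n y \<and> P y)"

lemma dec_0: "y0 \<in> envs M \<Longrightarrow> dec P 0 y0 c \<longleftrightarrow> c = Z \<and> P y0"
proof -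
  have "(\<forall>k. k = 0 \<or> 0 < k \<longrightarrow> y k = y0 k) \<longleftrightarrow> y = y0" for y :: "nat \<Rightarrow> 'a"
    by (auto simp: fun_eq_iff)
  then show "y0 \<in> envs M \<Longrightarrow> ?thesis" unfolding dec_def by auto
qed

lemma dec_Suc:
  assumes "y0 \<in> envs M"
  shows "dec P (Suc n) y0 c \<longleftrightarrow> (\<exists>u\<in>K. \<exists>c'\<in>K. c = pr u c' \<and> dec P n (y0(Suc n := u)) c')"
proof
  assume "dec P (Suc n) y0 c"
  then obtain y where y: "y \<in> envs M" "\<forall>k. k = 0 \<or> Suc n < k \<longrightarrow> y k = y0 k"
    "c = enc (Suc n) y" "P y"
    unfolding dec_def by blast
  have "\<forall>k. k = 0 \<or> n < k \<longrightarrow> y k = (y0(Suc n := y (Suc n))) k"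
    using y(2) by (auto simp: less_Suc_eq_le order_less_le)
  then have "dec P n (y0(Suc n := y (Suc n))) (enc n y)"
    unfolding dec_def using y by blast
  moreover have "c = pr (y (Suc n)) (enc n y)" using y(3) by simp
  moreover have "y (Suc n) \<in> K" "enc n y \<in> K" using y(1) by simp_all
  ultimately show "\<exists>u\<in>K. \<exists>c'\<in>K. c = pr u c' \<and> dec P n (y0(Suc n := u)) c'"
    by blast
next
  assume "\<exists>u\<in>K. \<exists>c'\<in>K. c = pr u c' \<and> dec P n (y0(Suc n := u)) c'"
  then obtain u c' y where u: "u \<in> K" "c = pr u c'" and y: "y \<in> envs M"
    "\<forall>k. k = 0 \<or> n < k \<longrightarrow> y k = (y0(Suc n := u)) k" "c' = enc n y" "P y"
    unfolding dec_def by blast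
  have "y (Suc n) = u" using y(2) by simp
  moreover have "\<forall>k. k = 0 \<or> Suc n < k \<longrightarrow> y k = y0 k" using y(2) by auto
  ultimately show "dec P (Suc n) y0 c"
    unfolding dec_def using u y by (intro bexI[of _ y]) simp_all
qed

lemma dp_dec:
  assumes P: "dpM (envs M) coords P"
  shows "dpM (envs M \<times> K) (ext coords) (\<lambda>z. dec P n (fst z) (snd z))"
proof (induction n)
  case 0
  have "dpM (envs M \<times> K) (ext coords) (\<lambda>z. snd z = Z \<and> P (fst z))"
    by (intro dp_rules dp_weaken[OF P] carr_closed)
  then show ?case by (rule dp_cong) (auto simp: dec_0)
next
  case (Suc n)
  have "dpM (((envs M \<times> K) \<times> K) \<times> K) (ext (ext (ext coords)))
      (\<lambda>z. dec P n ((fst (fst (fst z)))(Suc n := snd (fst z))) (snd z))"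
  proof (rule dp_reindex_pair[where P = "dec P n" and f = snd and
        g = "\<lambda>z. (fst (fst (fst z)))(Suc n := snd (fst z))", OF Suc.IH])
    fix c :: "(nat \<Rightarrow> 'a) \<Rightarrow> 'a" assume "c \<in> coords"
    then show "basic M K (((envs M \<times> K) \<times> K) \<times> K) (ext (ext (ext coords)))
        (\<lambda>z. c ((fst (fst (fst z)))(Suc n := snd (fst z))))"
      by (rule basic_coords) (intro basic_upd basic_fst[OF basic_snd]
          basic_fst[OF basic_fst[OF basic_fst[OF basic_coord[OF coords_app]]]])
  qed (auto intro: basic_snd)
  moreover have "dpM (((envs M \<times> K) \<times> K) \<times> K) (ext (ext (ext coords)))
      (\<lambda>z. snd (fst (fst z)) = pr (snd (fst z)) (snd z))"
    unfolding pr_def by (intro dp_rules)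
  ultimately have "dpM (envs M \<times> K) (ext coords)
     (\<lambda>z. \<exists>u\<in>K. \<exists>c'\<in>K. snd z = pr u c' \<and> dec P n ((fst z)(Suc n := u)) c')"
    by (intro dp_ex dp_conj)
  then show ?case
  proof (rule dp_cong)
    fix z :: "(nat \<Rightarrow> 'a) \<times> 'a" assume "z \<in> envs M \<times> K"
    then have "fst z \<in> envs M" by (rule mem_Times_iff[THEN iffD1, THEN conjunct1])
    from dec_Suc[OF this, of P n "snd z"]
    show "(\<exists>u\<in>K. \<exists>c'\<in>K. snd z = pr u c' \<and> dec P n ((fst z)(Suc n := u)) c') =
        dec P (Suc n) (fst z) (snd z)" by (rule sym)
  qed
qed

text \<open>Packing the parameters into one element reduces this to \<open>decide_binary\<close>. A
  code determines the coordinates from 1 to n, and no later variable is free in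
  \<open>q\<close>.\<close>

lemma decide_formula:
  assumes q: "LA_formula q" and X: "dp1 X" "unb X"
  obtains X' where "dp1 X'" "unb X'" "\<And>x. X' x \<Longrightarrow> X x"
    "\<And>y. y \<in> envs M \<Longrightarrow> evt X' (\<lambda>x. sat M {} (y(0 := x)) q) \<or> evt X' (\<lambda>x. \<not> sat M {} (y(0 := x)) q)"
proof -
  obtain n where n: "\<And>k. k \<in> fvars q \<Longrightarrow> k \<le> n"
    using finite_nat_set_iff_bounded_le[of "fvars q"] by auto
  define \<phi> where "\<phi> x c = dec (\<lambda>y. sat M {} y q) n ((\<lambda>_. Z)(0 := x)) c" for x c
  have "dp2 M K \<phi>"
    unfolding \<phi>_def
  proof (rule dp_reindex_pair[where P = "dec (\<lambda>y. sat M {} y q) n" and f = snd and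
        g = "\<lambda>z. (\<lambda>_. Z)(0 := fst z)", OF dp_dec[OF dp_sat_env[OF q]]])
    fix c :: "(nat \<Rightarrow> 'a) \<Rightarrow> 'a" assume "c \<in> coords"
    then show "basic M K (K \<times> K) (ext {\<lambda>x. x}) (\<lambda>z. c ((\<lambda>_. Z)(0 := fst z)))"
      by (rule basic_coords)
        (intro basic_upd basic_zero basic_fst[of M K K "{\<lambda>x. x}" "\<lambda>x. x"] basic_coord singletonI)
  next
    fix z assume "z \<in> K \<times> K"
    moreover have "(\<lambda>_ :: nat. Z) \<in> envs M" unfolding envs_def by simp
    ultimately show "(\<lambda>_ :: nat. Z)(0 := fst z) \<in> envs M \<and> snd z \<in> K" by auto
  qed (rule basic_snd)
  from decide_binary[OF X this] obtain X' where X': "dp1 X'" "unb X'" "\<And>x. X' x \<Longrightarrow> X x"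
    and dec: "\<And>y. y \<in> K \<Longrightarrow> evt X' (\<lambda>x. \<phi> x y) \<or> evt X' (\<lambda>x. \<not> \<phi> x y)" by metis
  show thesis
  proof (rule that[OF X'])
    fix y :: "nat \<Rightarrow> 'a" assume y: "y \<in> envs M"
    have "\<phi> x (enc n y) \<longleftrightarrow> sat M {} (y(0 := x)) q" if x: "x \<in> K" for x
    proof
      assume "\<phi> x (enc n y)"
      then obtain y' where y': "y' \<in> envs M" "\<forall>k. k = 0 \<or> n < k \<longrightarrow> y' k = ((\<lambda>_. Z)(0 := x)) k"
        "enc n y = enc n y'" "sat M {} y' q"
        unfolding \<phi>_def dec_def by blast
      have "y' k = (y(0 := x)) k" if "k \<in> fvars q" for k
        using n[OF that] y'(2) enc_inject[OF y'(3) y y'(1), of k] by (cases "k = 0") auto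
      with sat_cong[of q y' "y(0 := x)"] y'(4) show "sat M {} (y(0 := x)) q" by blast
    next
      assume s: "sat M {} (y(0 := x)) q"
      define y' where "y' k = (if k = 0 then x else if k \<le> n then y k else Z)" for k
      have e: "y' \<in> envs M" using x y unfolding envs_def y'_def by simp
      have a: "\<forall>k. k = 0 \<or> n < k \<longrightarrow> y' k = ((\<lambda>_. Z)(0 := x)) k" unfolding y'_def by auto
      have b: "enc n y = enc n y'" by (rule enc_cong) (simp add: y'_def)
      have "y' k = (y(0 := x)) k" if "k \<in> fvars q" for k
        using n[OF that] unfolding y'_def by simp
      with sat_cong[of q y' "y(0 := x)"] s have "sat M {} y' q" by blast
      with e a b show "\<phi> x (enc n y)" unfolding \<phi>_def dec_def by blast
    qed
    with dec[of "enc n y"] y show "evt X' (\<lambda>x. sat M {} (y(0 := x)) q) \<or>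
        evt X' (\<lambda>x. \<not> sat M {} (y(0 := x)) q)"
      unfolding evt_def by simp
  qed
qed

section \<open>The chain of sets generating the ultrafilter\<close>

definition chain :: "(nat \<Rightarrow> 'a \<Rightarrow> bool) \<Rightarrow> bool" where
  "chain X \<longleftrightarrow> (\<forall>n. dp1 (X n) \<and> unb (X n) \<and> (\<forall>x. X (Suc n) x \<longrightarrow> X n x) \<and>
    (\<forall>y\<in>envs M. LA_formula (from_nat n) \<longrightarrow> evt (X (Suc n)) (\<lambda>x. sat M {} (y(0 := x)) (from_nat n)) \<or>
      evt (X (Suc n)) (\<lambda>x. \<not> sat M {} (y(0 := x)) (from_nat n))))"

text \<open>Stage n decides the formula numbered n for all parameters at once, so countably many
  stages suffice whatever the size of \<open>M\<close>.\<close>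

lemma chain_exists: "\<exists>X. chain X"
proof -
  define Q where "Q n X X' \<longleftrightarrow> (\<forall>x. X' x \<longrightarrow> X x) \<and>
    (\<forall>y\<in>envs M. LA_formula (from_nat n) \<longrightarrow> evt X' (\<lambda>x. sat M {} (y(0 := x)) (from_nat n)) \<or>
      evt X' (\<lambda>x. \<not> sat M {} (y(0 := x)) (from_nat n)))" for n X X'
  have "\<exists>f. \<forall>n. (dp1 (f n) \<and> unb (f n)) \<and> Q n (f n) (f (Suc n))"
  proof (rule dependent_nat_choice)
    have "unb (\<lambda>_. True)" unfolding unb_def using lt_suc carr_closed(2) by blast
    then show "\<exists>X. dp1 X \<and> unb X" using dp_const by blast
    fix X n assume X: "dp1 X \<and> unb X"
    show "\<exists>X'. (dp1 X' \<and> unb X') \<and> Q n X X'"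
    proof (cases "LA_formula (from_nat n)")
      case True
      from decide_formula[OF this] X show ?thesis unfolding Q_def by metis
    next
      case False
      with X show ?thesis unfolding Q_def by blast
    qed
  qed
  then show ?thesis unfolding chain_def Q_def by blast
qed

definition Xs :: "nat \<Rightarrow> 'a \<Rightarrow> bool" where
  "Xs = (SOME X. chain X)"

lemma chain_Xs: "chain Xs"
  unfolding Xs_def by (rule someI_ex[OF chain_exists])

lemma Xs_mono: "m \<le> n \<Longrightarrow> Xs n x \<Longrightarrow> Xs m x"
  using chain_Xs unfolding chain_def by (induction n) (auto simp: le_Suc_eq)

text \<open>
  \<open>Uq\<close> is the quantifier of the filter generated by the sets \<open>Xs k\<close> and the final segments.  It is
  an ultrafilter on the definable sets and, since the \<open>k\<close>-th formula is decided by \<open>Xs (Suc k)\<close>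
  uniformly in its parameters, definable.
\<close>

definition Uq :: "('a \<Rightarrow> bool) \<Rightarrow> bool" where
  "Uq P \<longleftrightarrow> (\<exists>k. evt (Xs k) P)"

lemma Uq_mono: "Uq P \<Longrightarrow> (\<And>x. x \<in> K \<Longrightarrow> P x \<Longrightarrow> Q x) \<Longrightarrow> Uq Q"
  unfolding Uq_def evt_def by meson

lemma Uq_cong: "(\<And>x. x \<in> K \<Longrightarrow> P x \<longleftrightarrow> Q x) \<Longrightarrow> Uq P \<longleftrightarrow> Uq Q"
  using Uq_mono[of P Q] Uq_mono[of Q P] by blast

lemma Uq_conjI:
  assumes "Uq P" "Uq Q"
  shows "Uq (\<lambda>x. P x \<and> Q x)"
proof -
  obtain k b where k: "b \<in> K" "\<And>x. x \<in> K \<Longrightarrow> Xs k x \<Longrightarrow> b \<prec> x \<Longrightarrow> P x"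
    using assms(1) unfolding Uq_def evt_def by blast
  obtain l c where l: "c \<in> K" "\<And>x. x \<in> K \<Longrightarrow> Xs l x \<Longrightarrow> c \<prec> x \<Longrightarrow> Q x"
    using assms(2) unfolding Uq_def evt_def by blast
  obtain d where d: "d \<in> K" "b \<preceq> d" "c \<preceq> d" using upper_bound2[OF k(1) l(1)] .
  have "P x \<and> Q x" if "x \<in> K" "Xs (max k l) x" "d \<prec> x" for x
    using k(2)[OF that(1) Xs_mono[OF _ that(2)] le_lt_trans[OF d(2) that(3)]]
      l(2)[OF that(1) Xs_mono[OF _ that(2)] le_lt_trans[OF d(3) that(3)]] k(1) l(1) d(1) that(1)
    by simp
  then show ?thesis unfolding Uq_def evt_def using d(1) by blast
qed

lemma Uq_conj: "Uq (\<lambda>x. P x \<and> Q x) \<longleftrightarrow> Uq P \<and> Uq Q"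
  using Uq_conjI[of P Q] Uq_mono[of "\<lambda>x. P x \<and> Q x" P] Uq_mono[of "\<lambda>x. P x \<and> Q x" Q] by blast

lemma Uq_const [simp]: "Uq (\<lambda>_. b) \<longleftrightarrow> b"
proof (cases b)
  case False
  have "\<not> evt (Xs k) (\<lambda>_. False)" for k
    using chain_Xs unfolding chain_def unb_def evt_def by blast
  with False show ?thesis unfolding Uq_def by simp
next
  case True
  then show ?thesis unfolding Uq_def evt_def using carr_closed(1) by blast
qed

lemma Uq_gt: "b \<in> K \<Longrightarrow> Uq (\<lambda>x. b \<prec> x)"
  unfolding Uq_def evt_def by blast

lemma Uq_neg:
  assumes "dp1 P"
  shows "Uq (\<lambda>x. \<not> P x) \<longleftrightarrow> \<not> Uq P"
proof
  assume "Uq (\<lambda>x. \<not> P x)"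
  then show "\<not> Uq P" using Uq_conjI[of P "\<lambda>x. \<not> P x"] Uq_const[of False] by auto
next
  assume neg: "\<not> Uq P"
  obtain q d where q: "LA_formula q" "\<And>k. d k \<in> K"
    and P: "\<And>v. v \<in> K \<Longrightarrow> P v \<longleftrightarrow> sat M {} (d(0 := v)) q"
    using dp1_single_variable[OF assms] by metis
  have d: "d \<in> envs M" unfolding envs_def using q(2) by simp
  have "from_nat (to_nat q) = q" by simp
  with chain_Xs d q(1) have "evt (Xs (Suc (to_nat q))) (\<lambda>x. sat M {} (d(0 := x)) q) \<or>
      evt (Xs (Suc (to_nat q))) (\<lambda>x. \<not> sat M {} (d(0 := x)) q)"
    unfolding chain_def by metis
  with neg P show "Uq (\<lambda>x. \<not> P x)" unfolding Uq_def evt_def by metis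
qed

lemma dp_Uq:
  assumes P: "dpM (D \<times> K) (ext C) (\<lambda>z. P (fst z) (snd z))"
    and C: "\<forall>c\<in>C. \<forall>x\<in>D. c x \<in> K"
  shows "dpM D C (\<lambda>x. Uq (P x))"
proof -
  obtain q d where q: "LA_formula q" "\<And>k. d k \<in> C \<union> pconsts M K"
    and P': "\<And>x v. x \<in> D \<Longrightarrow> v \<in> K \<Longrightarrow>
      P (fst (x, v)) (snd (x, v)) \<longleftrightarrow> sat M {} ((\<lambda>k. d k x)(0 := v)) q"
    by (rule dp_normal_form[OF P]) (rule that)
  define k where "k = Suc (to_nat q)"
  have Xk: "dp1 (Xs k)" using chain_Xs unfolding chain_def by blast
  have dK: "d k x \<in> K" if "x \<in> D" for k x
    using q(2)[of k] that C unfolding pconsts_def by auto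
  have "dpM D C (\<lambda>x. \<exists>b\<in>K. \<forall>w\<in>K. Xs k w \<and> b \<prec> w \<longrightarrow> P x w)"
  proof (rule dp_ex, rule dp_all, rule dp_imp)
    show "dpM ((D \<times> K) \<times> K) (ext (ext C)) (\<lambda>z. Xs k (snd z) \<and> snd (fst z) \<prec> snd z)"
      by (intro dp_rules dp_app1[OF Xk])
    show "dpM ((D \<times> K) \<times> K) (ext (ext C)) (\<lambda>z. P (fst (fst z)) (snd z))"
      by (rule dp_weaken_mid[where P = P, OF P])
  qed
  then show ?thesis
  proof (rule dp_cong)
    fix x assume x: "x \<in> D"
    let ?y = "\<lambda>k. d k x"
    have y: "?y \<in> envs M" unfolding envs_def using dK[OF x] by simp
    have P: "P x v \<longleftrightarrow> sat M {} (?y(0 := v)) q" if "v \<in> K" for v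
      using P'[OF x that] by simp
    have "from_nat (to_nat q) = q" by simp
    with chain_Xs y q(1) have "evt (Xs k) (\<lambda>v. sat M {} (?y(0 := v)) q) \<or>
        evt (Xs k) (\<lambda>v. \<not> sat M {} (?y(0 := v)) q)"
      unfolding chain_def k_def by metis
    then have "evt (Xs k) (P x) \<or> evt (Xs k) (\<lambda>v. \<not> P x v)"
      unfolding evt_def using P by simp
    \<comment> \<open>The filter is proper, so a decision taken at stage k is not reversed at a
      later stage.\<close>
    moreover have "\<not> (Uq (P x) \<and> Uq (\<lambda>v. \<not> P x v))"
      using Uq_conjI[of "P x" "\<lambda>v. \<not> P x v"] Uq_const[of False] by auto
    ultimately have "evt (Xs k) (P x) \<longleftrightarrow> Uq (P x)"
      unfolding Uq_def by blast
    then show "(\<exists>b\<in>K. \<forall>w\<in>K. Xs k w \<and> b \<prec> w \<longrightarrow> P x w) \<longleftrightarrow> Uq (P x)"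
      unfolding evt_def .
  qed
qed

text \<open>If no value were taken almost everywhere, each step from k to \<open>S k\<close> would
  discard one more value. As \<open>Uq\<close> preserves definability, this is an induction in
  \<open>M\<close>, and it reaches the bound m. This property makes the ultrapower an end
  extension.\<close>

lemma Uq_bounded_imp_constant:
  assumes f: "dfM K {\<lambda>x. x} f" and m: "m \<in> K" "Uq (\<lambda>x. f x \<prec> m)"
  shows "\<exists>w\<in>K. Uq (\<lambda>x. f x = w)"
proof (rule ccontr)
  assume "\<not> (\<exists>w\<in>K. Uq (\<lambda>x. f x = w))"
  moreover have "Uq (\<lambda>x. \<not> f x = w) \<longleftrightarrow> \<not> Uq (\<lambda>x. f x = w)" if "w \<in> K" for w
    using that by (intro Uq_neg dp_rules f)
  ultimately have ne: "Uq (\<lambda>x. f x \<noteq> w)" if "w \<in> K" for w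
    using that by blast
  have fK: "f x \<in> K" if "x \<in> K" for x using f that unfolding df_def by blast
  have "Uq (\<lambda>x. \<not> f x \<prec> k)" if "k \<in> K" for k
    using that
  proof (induction k rule: induct)
    show "dp1 (\<lambda>k. Uq (\<lambda>x. \<not> f x \<prec> k))"
    proof (rule dp_Uq)
      show "dpM (K \<times> K) (ext {\<lambda>x. x}) (\<lambda>z. \<not> f (snd z) \<prec> fst z)"
        by (intro dp_rules df_app1[OF f])
    qed simp
    have "Uq (\<lambda>x. \<not> f x \<prec> Z) \<longleftrightarrow> Uq (\<lambda>x. True)"
      by (rule Uq_cong) (simp add: fK)
    then show "Uq (\<lambda>x. \<not> f x \<prec> Z)" by simp
  next
    fix k assume k: "k \<in> K" "Uq (\<lambda>x. \<not> f x \<prec> k)"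
    from Uq_conjI[OF this(2) ne[OF k(1)]] show "Uq (\<lambda>x. \<not> f x \<prec> S k)"
      by (rule Uq_mono) (simp add: fK k)
  qed
  from Uq_conjI[OF m(2) this[OF m(1)]] show False
    using Uq_const[of False] by simp
qed

end

section \<open>Indiscernibles of order type omega\<close>

lemma order_indiscernibles_subset:
  assumes I: "order_indiscernibles M I" and J: "J \<subseteq> I"
  shows "order_indiscernibles M J"
  unfolding order_indiscernibles_def
proof (intro allI impI)
  fix p n and x y :: "nat \<Rightarrow> 'a"
  assume p: "LA_formula p" "fvars p \<subseteq> {..<n}" and xy: "\<forall>i<n. x i \<in> J \<and> y i \<in> J"
    "\<forall>j<n. \<forall>i<j. ltM M (x i) (x j) \<and> ltM M (y i) (y j)"
  have "\<forall>i<n. x i \<in> I \<and> y i \<in> I" using xy(1) J by blast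
  with I p xy(2) show "sat M {} x p \<longleftrightarrow> sat M {} y p"
    unfolding order_indiscernibles_def by simp
qed

context arith
begin

lemma df_tval: "dfM (envs M) coords (\<lambda>y. tval M y t)"
proof (induction t)
  case (Var k)
  show ?case unfolding tval.simps by (rule df_coord) simp_all
qed (unfold tval.simps, intro dp_rules carr_closed; assumption)+

text \<open>Membership in a finite set is a finite disjunction of equations with parameters, so the
  predicate for it can be eliminated from any formula.\<close>

lemma dp_sat_finite:
  fixes p :: fm
  assumes F: "finite F" "F \<subseteq> K"
  shows "dpM (envs M :: (nat \<Rightarrow> 'a) set) coords (\<lambda>y. sat M F y p)"
proof (induction p)
  case (InI t)
  have "dpM (envs M) coords (\<lambda>y. tval M y t \<in> F)"
    using F
  proof (induction F rule: finite_induct)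
    case empty
    show ?case by (simp add: dp_const)
  next
    case (insert a F)
    then have "dpM (envs M) coords (\<lambda>y. tval M y t = a \<or> tval M y t \<in> F)"
      by (intro dp_disj dp_eq df_tval df_const') simp_all
    then show ?case by (rule dp_cong) simp
  qed
  then show ?case by simp
next
  case (Ex k p)
  have "dpM (envs M \<times> K) (ext coords) (\<lambda>z. sat M F ((fst z)(k := snd z)) p)"
    by (rule dp_upd[OF Ex.IH])
  then show ?case unfolding sat.simps by (rule dp_ex)
next
  case (Eq s t)
  show ?case unfolding sat.simps by (intro dp_eq df_tval)
next
  case (Less s t)
  show ?case unfolding sat.simps by (intro dp_lt df_tval)
next
  case (Neg p)
  then show ?case unfolding sat.simps by (rule dp_neg)
next
  case (Conj p q)
  then show ?case unfolding sat.simps by (rule dp_conj)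
qed

lemma tval_mono:
  assumes "\<And>k. e k \<in> K" "b \<in> K" "\<And>k. k \<in> tvars t \<Longrightarrow> e k \<preceq> b"
  shows "tval M e t \<preceq> tval M (\<lambda>_. b) t"
  using assms(3)
proof (induction t)
  case (Sc t)
  then show ?case using suc_mono assms(1,2) by simp
next
  case (Add s t)
  then show ?case using add_mono assms(1,2) by simp
next
  case (Mul s t)
  then show ?case using mul_mono assms(1,2) by simp
qed simp_all

text \<open>Terms are monotone, so arguments below b keep all terms and all bounded quantifiers
  below an element computed from b. The bound is found before \<open>e\<close>, \<open>I\<close> and
  \<open>J\<close> are given, which lets one finite part of \<open>I\<close> serve all arguments of
  an induction.\<close>

lemma Delta0_depends_on_bounded_part:
  assumes "Delta0_I p" "b \<in> K"
  shows "\<exists>B\<in>K. \<forall>e I J. (\<forall>k. e k \<in> K) \<longrightarrow> (\<forall>k\<in>fvars p. e k \<preceq> b) \<longrightarrow>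
    (\<forall>i\<in>K. i \<prec> B \<longrightarrow> (i \<in> I \<longleftrightarrow> i \<in> J)) \<longrightarrow> (sat M I e p \<longleftrightarrow> sat M J e p)"
  using assms
proof (induction p arbitrary: b rule: Delta0_I.induct)
  case (3 t)
  show ?case
  proof (intro bexI allI impI)
    fix e :: "nat \<Rightarrow> 'a" and I J
    assume e: "\<forall>k. e k \<in> K" "\<forall>k\<in>fvars (InI t). e k \<preceq> b"
      and IJ: "\<forall>i\<in>K. i \<prec> S (tval M (\<lambda>_. b) t) \<longrightarrow> (i \<in> I \<longleftrightarrow> i \<in> J)"
    have "tval M e t \<prec> S (tval M (\<lambda>_. b) t)"
      using tval_mono[of e b t] e 3 unfolding le_def by simp
    with IJ e(1) show "sat M I e (InI t) \<longleftrightarrow> sat M J e (InI t)" by simp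
  qed (use 3 in simp)
next
  case (4 p)
  then show ?case by simp
next
  case (5 p q)
  obtain B where B: "B \<in> K" "\<And>e I J. (\<forall>k. e k \<in> K) \<Longrightarrow> (\<forall>k\<in>fvars p. e k \<preceq> b) \<Longrightarrow>
    (\<forall>i\<in>K. i \<prec> B \<longrightarrow> (i \<in> I \<longleftrightarrow> i \<in> J)) \<Longrightarrow> (sat M I e p \<longleftrightarrow> sat M J e p)"
    using 5(3)[OF 5(5)] by blast
  obtain C where C: "C \<in> K" "\<And>e I J. (\<forall>k. e k \<in> K) \<Longrightarrow> (\<forall>k\<in>fvars q. e k \<preceq> b) \<Longrightarrow>
    (\<forall>i\<in>K. i \<prec> C \<longrightarrow> (i \<in> I \<longleftrightarrow> i \<in> J)) \<Longrightarrow> (sat M I e q \<longleftrightarrow> sat M J e q)"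
    using 5(4)[OF 5(5)] by blast
  obtain D where D: "D \<in> K" "B \<preceq> D" "C \<preceq> D" using upper_bound2[OF B(1) C(1)] .
  show ?case
  proof (intro bexI allI impI)
    fix e :: "nat \<Rightarrow> 'a" and I J
    assume e: "\<forall>k. e k \<in> K" "\<forall>k\<in>fvars (Conj p q). e k \<preceq> b"
      and IJ: "\<forall>i\<in>K. i \<prec> D \<longrightarrow> (i \<in> I \<longleftrightarrow> i \<in> J)"
    have "\<forall>i\<in>K. i \<prec> B \<longrightarrow> (i \<in> I \<longleftrightarrow> i \<in> J)" "\<forall>i\<in>K. i \<prec> C \<longrightarrow> (i \<in> I \<longleftrightarrow> i \<in> J)"
      using IJ lt_le_trans[OF _ D(2)] lt_le_trans[OF _ D(3)] B(1) C(1) D(1) by blast+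
    with B(2)[of e I J] C(2)[of e I J] e show "sat M I e (Conj p q) \<longleftrightarrow> sat M J e (Conj p q)" by simp
  qed (rule D)
next
  case (6 p k t)
  have tb: "tval M (\<lambda>_. b) t \<in> K" using 6 by simp
  \<comment> \<open>\<open>b'\<close> bounds the old arguments and, through the bounding term, also
    the quantified variable.\<close>
  obtain b' where b': "b' \<in> K" "b \<preceq> b'" "tval M (\<lambda>_. b) t \<preceq> b'"
    using upper_bound2[OF 6(4) tb] .
  obtain B where B: "B \<in> K" "\<And>e I J. (\<forall>k. e k \<in> K) \<Longrightarrow> (\<forall>k\<in>fvars p. e k \<preceq> b') \<Longrightarrow>
    (\<forall>i\<in>K. i \<prec> B \<longrightarrow> (i \<in> I \<longleftrightarrow> i \<in> J)) \<Longrightarrow> (sat M I e p \<longleftrightarrow> sat M J e p)"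
    using 6(3)[OF b'(1)] by blast
  show ?case
  proof (intro bexI allI impI)
    fix e :: "nat \<Rightarrow> 'a" and I J
    assume e: "\<forall>k. e k \<in> K" "\<forall>j\<in>fvars (Ex k (Conj (Less (Var k) t) p)). e j \<preceq> b"
      and IJ: "\<forall>i\<in>K. i \<prec> B \<longrightarrow> (i \<in> I \<longleftrightarrow> i \<in> J)"
    have eb: "e j \<preceq> b" if "j \<noteq> k" "j \<in> tvars t \<union> fvars p" for j
      using e(2) that by simp
    have "sat M I (e(k := a)) p \<longleftrightarrow> sat M J (e(k := a)) p"
      if a: "a \<in> K" "a \<prec> tval M (e(k := a)) t" for a
    proof (rule B(2))
      have "tval M (e(k := a)) t = tval M e t"
        by (rule tval_cong) (use 6(2) in auto)
      moreover have "tval M e t \<preceq> tval M (\<lambda>_. b) t"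
      proof (rule tval_mono)
        show "e j \<in> K" for j using e(1) by blast
        show "e j \<preceq> b" if "j \<in> tvars t" for j using eb[of j] that 6(2) by blast
      qed (rule 6(4))
      ultimately have "a \<prec> tval M (\<lambda>_. b) t"
        using lt_le_trans[OF a(2)] a(1) e(1) tb by simp
      then have "a \<preceq> b'" using lt_le_trans[OF _ b'(3)] a(1) tb b'(1) lt_imp_le by blast
      moreover have "e j \<preceq> b'" if "j \<noteq> k" "j \<in> fvars p" for j
        using le_trans[OF eb b'(2)] that e(1) 6(4) b'(1) by blast
      ultimately show "\<forall>j\<in>fvars p. (e(k := a)) j \<preceq> b'" by simp
      show "\<forall>j. (e(k := a)) j \<in> K" using e(1) a(1) by simp
    qed (rule IJ)
    then show "sat M I e (Ex k (Conj (Less (Var k) t) p)) \<longleftrightarrow>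
        sat M J e (Ex k (Conj (Less (Var k) t) p))"
      by auto
  qed (rule B)
qed (use carr_closed(1) in auto)

lemma Delta0_induction_of_locally_finite:
  assumes I: "I \<subseteq> K" and fin: "\<And>B. B \<in> K \<Longrightarrow> finite {i \<in> I. i \<prec> B}" and p: "Delta0_I p"
  shows "induction_axiom M I p"
  unfolding induction_axiom_def
proof (intro allI impI ballI)
  fix e k a
  assume e: "\<forall>j. e j \<in> K" and zero: "sat M I (e(k := Z)) p"
    and step: "\<forall>a\<in>K. sat M I (e(k := a)) p \<longrightarrow> sat M I (e(k := S a)) p" and a: "a \<in> K"
  have "finite (insert a (e ` fvars p))" "insert a (e ` fvars p) \<subseteq> K" using e a by auto
  from finite_upper_bound[OF this] obtain b where b: "b \<in> K"
    "\<And>x. x \<in> insert a (e ` fvars p) \<Longrightarrow> x \<preceq> b" by metis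
  obtain B where B: "B \<in> K" "\<And>e I J. (\<forall>k. e k \<in> K) \<Longrightarrow> (\<forall>k\<in>fvars p. e k \<preceq> b) \<Longrightarrow>
    (\<forall>i\<in>K. i \<prec> B \<longrightarrow> (i \<in> I \<longleftrightarrow> i \<in> J)) \<Longrightarrow> (sat M I e p \<longleftrightarrow> sat M J e p)"
    using Delta0_depends_on_bounded_part[OF p b(1)] by blast
  define F where "F = {i \<in> I. i \<prec> B}"
  have F: "finite F" "F \<subseteq> K" using fin[OF B(1)] I unfolding F_def by auto
  have IF: "sat M I (e(k := x)) p \<longleftrightarrow> sat M F (e(k := x)) p" if x: "x \<in> K" "x \<preceq> a" for x
  proof (rule B(2))
    show "\<forall>j. (e(k := x)) j \<in> K" using e x by simp
    have "x \<preceq> b" using le_trans[OF x(2) b(2)] x a b(1) by simp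
    then show "\<forall>j\<in>fvars p. (e(k := x)) j \<preceq> b" using b(2) by simp
    show "\<forall>i\<in>K. i \<prec> B \<longrightarrow> (i \<in> I \<longleftrightarrow> i \<in> F)" unfolding F_def by blast
  qed
  have "dp1 (\<lambda>x. sat M F (e(k := x)) p)"
  proof (rule dp_reindex[OF dp_sat_finite[OF F], where g = "\<lambda>x. e(k := x)"])
    fix c :: "(nat \<Rightarrow> 'a) \<Rightarrow> 'a" assume "c \<in> coords"
    then show "basic M K K {\<lambda>x. x} (\<lambda>x. c (e(k := x)))"
      by (rule basic_coords) (intro basic_upd basic_const basic_coord singletonI, simp add: e)
  next
    show "e(k := x) \<in> envs M" if "x \<in> K" for x using that e unfolding envs_def by simp
  qed
  note dp = this
  \<comment> \<open>The guard \<open>x \<preceq> a\<close> keeps the arguments in the range where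
    the finite set \<open>F\<close> may stand for \<open>I\<close>.\<close>
  have "a \<preceq> a \<longrightarrow> sat M F (e(k := a)) p"
    using a
  proof (induction rule: induct[where P = "\<lambda>x. x \<preceq> a \<longrightarrow> sat M F (e(k := x)) p"])
    show "dp1 (\<lambda>x. x \<preceq> a \<longrightarrow> sat M F (e(k := x)) p)"
      by (intro dp_imp dp dp_rules a)
    show "Z \<preceq> a \<longrightarrow> sat M F (e(k := Z)) p" using IF[of Z] zero by simp
  next
    fix x assume x: "x \<in> K" "x \<preceq> a \<longrightarrow> sat M F (e(k := x)) p"
    show "S x \<preceq> a \<longrightarrow> sat M F (e(k := S x)) p"
    proof
      assume le: "S x \<preceq> a"
      then have "x \<preceq> a" using suc_le_iff[OF x(1) a] lt_imp_le by blast
      then show "sat M F (e(k := S x)) p"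
        using x step IF[of x] IF[of "S x"] le by simp
    qed
  qed
  then show "sat M I (e(k := a)) p" using IF[OF a] by simp
qed

lemma model_PAI0_of_countable_cofinality:
  assumes I: "model_PAI_minus M I" and "countable_cofinality M"
  shows "\<exists>I. model_PAI0 M I"
proof -
  obtain C where C: "C \<subseteq> K" "countable C" and "\<forall>a\<in>K. \<exists>c\<in>C. a = c \<or> a \<prec> c"
    using assms(2) unfolding countable_cofinality_def by (elim exE conjE) (rule that)
  then have C3: "\<exists>c\<in>C. a \<preceq> c" if "a \<in> K" for a
    using that unfolding le_def by blast
  have "C \<noteq> {}" using C3 carr_closed(1) by blast
  define c where "c = from_nat_into C"
  have c: "range c = C"
    unfolding c_def using \<open>C \<noteq> {}\<close> C(2) by (rule range_from_nat_into)
  have cK: "c n \<in> K" for n using c C(1) by blast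
  have IK: "I \<subseteq> K" and I_unb: "\<And>a. a \<in> K \<Longrightarrow> \<exists>i\<in>I. a \<prec> i"
    using I unfolding model_PAI_minus_def unbounded_in_def by blast+
  \<comment> \<open>\<open>s n\<close> exceeds \<open>c n\<close> and the sequence increases, so
    only its first m members can lie below \<open>c m\<close>.\<close>
  have "\<exists>s. \<forall>n. (s n \<in> I \<and> c n \<prec> s n) \<and> s n \<prec> s (Suc n)"
  proof (rule dependent_nat_choice)
    show "\<exists>x. x \<in> I \<and> c 0 \<prec> x" using I_unb[OF cK] by blast
    fix x n assume "x \<in> I \<and> c n \<prec> x"
    then have x: "x \<in> K" using IK by blast
    obtain d where d: "d \<in> K" "x \<preceq> d" "c (Suc n) \<preceq> d" using upper_bound2[OF x cK] .
    obtain i where i: "i \<in> I" "d \<prec> i" using I_unb[OF d(1)] by blast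
    then have "i \<in> K" using IK by blast
    have "x \<prec> i" "c (Suc n) \<prec> i"
      using le_lt_trans[OF d(2) i(2) x d(1) \<open>i \<in> K\<close>] le_lt_trans[OF d(3) i(2) cK d(1) \<open>i \<in> K\<close>] .
    with i(1) show "\<exists>y. (y \<in> I \<and> c (Suc n) \<prec> y) \<and> x \<prec> y"
      by blast
  qed
  then obtain s where s: "\<And>n. s n \<in> I" "\<And>n. c n \<prec> s n" "\<And>n. s n \<prec> s (Suc n)" by blast
  have sK: "s n \<in> K" for n using s(1) IK by blast
  have mono: "m \<le> n \<Longrightarrow> s m \<preceq> s n" for m n
  proof (induction n)
    case (Suc n)
    then show ?case
      using le_trans[OF _ lt_imp_le[OF s(3)[of n]]] sK by (cases "m = Suc n") simp_all
  qed simp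
  have "model_PAI0 M (range s)"
    unfolding model_PAI0_def model_PAI_minus_def
  proof (intro conjI allI impI)
    show "model_PA M" by (rule PA)
    show "range s \<subseteq> K" using sK by blast
    show "unbounded_in M (range s)"
      unfolding unbounded_in_def
    proof
      fix a assume a: "a \<in> K"
      then obtain n where "a \<preceq> c n" using C3 c by blast
      then show "\<exists>i\<in>range s. a \<prec> i" using le_lt_trans[OF _ s(2)] a cK sK by blast
    qed
    show "order_indiscernibles M (range s)"
      using order_indiscernibles_subset[of M I "range s"] I s(1)
      unfolding model_PAI_minus_def by blast
    fix p assume p: "Delta0_I p"
    show "induction_axiom M (range s) p"
    proof (rule Delta0_induction_of_locally_finite[OF _ _ p])
      show "range s \<subseteq> K" using sK by blast
      fix B assume B: "B \<in> K"
      then obtain m where m: "B \<preceq> c m" using C3 c by blast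
      have "n < m" if "s n \<prec> B" for n
      proof (rule ccontr)
        assume "\<not> n < m"
        then have "s m \<preceq> s n" using mono by simp
        moreover have "s n \<prec> s m"
          using lt_trans[OF lt_le_trans[OF that m] s(2)] sK cK B by blast
        ultimately show False
          using lt_le_trans[of "s n" "s m" "s n"] lt_irrefl[OF sK] sK by blast
      qed
      then have "{i \<in> range s. i \<prec> B} \<subseteq> s ` {..<m}" by blast
      then show "finite {i \<in> range s. i \<prec> B}" by (rule finite_subset) simp
    qed
  qed
  then show ?thesis by blast
qed

section \<open>Initial segments of sets satisfying bounded induction are definable\<close>

text \<open>The statement that nothing below w satisfies \<open>p\<close> is again a bounded
  formula, with w as a fresh variable, so bounded induction applies to it.\<close>

lemma Delta0_least:
  assumes ind: "\<And>p. Delta0_I p \<Longrightarrow> induction_axiom M J p"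
    and p: "Delta0_I p" and e: "\<And>j. e j \<in> K" and a: "a \<in> K" "sat M J (e(k := a)) p"
  shows "\<exists>m\<in>K. sat M J (e(k := m)) p \<and> (\<forall>x\<in>K. x \<prec> m \<longrightarrow> \<not> sat M J (e(k := x)) p)"
proof (rule ccontr)
  assume neg: "\<not> ?thesis"
  have "finite (insert k (fvars p))" by simp
  then obtain w where w: "w \<notin> insert k (fvars p)" using ex_new_if_finite infinite_UNIV_nat by blast
  define q where "q = Neg (Ex k (Conj (Less (Var k) (Var w)) p))"
  have q: "Delta0_I q"
    unfolding q_def using p w by (intro Delta0_I.intros) auto
  have sat_q: "sat M J (e(w := x)) q \<longleftrightarrow> (\<forall>y\<in>K. y \<prec> x \<longrightarrow> \<not> sat M J (e(k := y)) p)" for x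
  proof -
    have "sat M J ((e(w := x))(k := y)) p \<longleftrightarrow> sat M J (e(k := y)) p" for y
      by (rule sat_cong) (use w in auto)
    then show ?thesis unfolding q_def using w by auto
  qed
  have "\<forall>x\<in>K. sat M J (e(w := x)) q"
    using ind[OF q] unfolding induction_axiom_def
  proof (elim allE impE)
    show "\<forall>j. e j \<in> K" using e by simp
    show "sat M J (e(w := Z)) q" unfolding sat_q by simp
    show "\<forall>x\<in>K. sat M J (e(w := x)) q \<longrightarrow> sat M J (e(w := S x)) q"
      unfolding sat_q using neg by auto
  qed
  then have "sat M J (e(w := S a)) q" using a(1) by simp
  then show False unfolding sat_q using a lt_suc[OF a(1)] by blast
qed

section \<open>Divisibility and codes for initial segments of a set\<close>

definition dv :: "'a \<Rightarrow> 'a \<Rightarrow> bool" where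
  "dv x y \<longleftrightarrow> (\<exists>z\<in>K. y = x \<otimes> z)"

text \<open>If x + y and x have cofactors p and q, then p - q is a cofactor of y; if p is below q,
  then y can only be zero.\<close>

lemma dv_cancel:
  assumes "dv m (x \<oplus> y)" "dv m x" and [simp]: "m \<in> K" "x \<in> K" "y \<in> K"
  shows "dv m y"
proof -
  obtain p where p: "p \<in> K" "x \<oplus> y = m \<otimes> p" using assms(1) unfolding dv_def by blast
  obtain q where q: "q \<in> K" "x = m \<otimes> q" using assms(2) unfolding dv_def by blast
  show ?thesis
  proof (cases "q \<preceq> p")
    case True
    then obtain r where r: "r \<in> K" "p = q \<oplus> r" using le_iff[OF q(1) p(1)] by blast
    have "x \<oplus> y = x \<oplus> m \<otimes> r" using p(2) q r by (simp add: distrib_left)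
    then have "y = m \<otimes> r" using r(1) by simp
    then show ?thesis unfolding dv_def using r(1) by blast
  next
    case False
    then have "p \<prec> q" using lt_total[OF q(1) p(1)] unfolding le_def by blast
    then obtain r where r: "r \<in> K" "q = p \<oplus> S r" using lt_iff[OF q(1) p(1)] by blast
    have "x = m \<otimes> p \<oplus> m \<otimes> S r"
      unfolding q(2) r(2) using p(1) r(1) by (intro distrib_left) simp_all
    then have "x = (x \<oplus> y) \<oplus> m \<otimes> S r" unfolding p(2) .
    then have "(x \<oplus> y) \<oplus> Z = ((x \<oplus> y) \<oplus> m \<otimes> S r) \<oplus> y" by simp
    also have "\<dots> = (x \<oplus> y) \<oplus> (m \<otimes> S r \<oplus> y)"
      using r(1) by (intro add_assoc) simp_all
    finally have "Z = m \<otimes> S r \<oplus> y" using add_left_cancel[of "x \<oplus> y" Z "m \<otimes> S r \<oplus> y"] r(1) by simp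
    then have "y = Z" using zero_or_suc[of y] r(1) by auto
    then show ?thesis unfolding dv_def using carr_closed(1) by (intro bexI[of _ Z]) simp_all
  qed
qed

lemma dv_mul: "dv x y \<Longrightarrow> x \<in> K \<Longrightarrow> y \<in> K \<Longrightarrow> w \<in> K \<Longrightarrow> dv x (w \<otimes> y)"
  unfolding dv_def by (metis carr_closed(4) mul_left_comm)

lemma dv_self: "x \<in> K \<Longrightarrow> z \<in> K \<Longrightarrow> dv x (x \<otimes> z)"
  unfolding dv_def by blast

lemma mul_neq_zero: "a \<in> K \<Longrightarrow> b \<in> K \<Longrightarrow> a \<noteq> Z \<Longrightarrow> b \<noteq> Z \<Longrightarrow> a \<otimes> b \<noteq> Z"
  using zero_or_suc[of a] zero_or_suc[of b] by auto

text \<open>Stands in for factorials and products: at a successor the multiple found so far is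
  multiplied by the new value. Only the existence of a multiple is asserted, which one induction
  proves without defining a product function.\<close>

lemma common_multiple:
  assumes g: "dfM K {\<lambda>x. x} g" "\<And>i. i \<in> K \<Longrightarrow> g i \<noteq> Z" and a: "a \<in> K"
  shows "\<exists>w\<in>K. w \<noteq> Z \<and> (\<forall>i\<in>K. i \<prec> a \<longrightarrow> dv (g i) w)"
  using a
proof (induction a rule: induct)
  show "dp1 (\<lambda>a. \<exists>w\<in>K. w \<noteq> Z \<and> (\<forall>i\<in>K. i \<prec> a \<longrightarrow> dv (g i) w))"
    unfolding dv_def by (intro dp_rules df_app1[OF g(1)] carr_closed)
  show "\<exists>w\<in>K. w \<noteq> Z \<and> (\<forall>i\<in>K. i \<prec> Z \<longrightarrow> dv (g i) w)"
    by (intro bexI[of _ "S Z"]) auto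
next
  fix a assume a: "a \<in> K" and "\<exists>w\<in>K. w \<noteq> Z \<and> (\<forall>i\<in>K. i \<prec> a \<longrightarrow> dv (g i) w)"
  then obtain w where w: "w \<in> K" "w \<noteq> Z" "\<And>i. i \<in> K \<Longrightarrow> i \<prec> a \<Longrightarrow> dv (g i) w" by blast
  have gK: "g i \<in> K" if "i \<in> K" for i using g(1) that unfolding df_def by blast
  have "dv (g i) (g a \<otimes> w)" if "i \<in> K" "i \<prec> S a" for i
    using that w dv_mul[of "g i" w "g a"] dv_self[of "g a" w] gK a by auto
  moreover have "g a \<otimes> w \<noteq> Z" "g a \<otimes> w \<in> K" using mul_neq_zero gK g(2) w a by simp_all
  ultimately show "\<exists>w\<in>K. w \<noteq> Z \<and> (\<forall>i\<in>K. i \<prec> S a \<longrightarrow> dv (g i) w)" by blast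
qed

text \<open>
  The moduli of Goedel's beta function.  They are coprime in the sense of \<open>md_coprime\<close> because
  \<open>md v k - md v i = (k - i) v\<close>, \<open>k - i\<close> divides \<open>v\<close>, and \<open>v\<close> is invertible modulo \<open>md v i\<close>.
\<close>

definition md :: "'a \<Rightarrow> 'a \<Rightarrow> 'a" where
  "md v i = S (S i \<otimes> v)"

lemma md_carr [simp]: "v \<in> K \<Longrightarrow> i \<in> K \<Longrightarrow> md v i \<in> K"
  unfolding md_def by (intro carr_closed)

text \<open>Modulo \<open>md v i\<close> the product \<open>S i \<otimes> v\<close> is -1, so
  multiplication by \<open>S i\<close> undoes multiplication by v up to sign.\<close>

lemma md_dv_cancel:
  assumes "dv (md v i) (v \<otimes> x)" and K: "v \<in> K" "i \<in> K" "x \<in> K"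
  shows "dv (md v i) x"
proof (rule dv_cancel)
  have "S i \<otimes> (v \<otimes> x) \<oplus> x = md v i \<otimes> x"
    unfolding md_def using K suc_mul[of x "S i \<otimes> v"] mul_assoc[of x "S i" v] by simp
  then show "dv (md v i) (S i \<otimes> (v \<otimes> x) \<oplus> x)" using dv_self[of "md v i" x] K by (simp del: suc_mul)
  show "dv (md v i) (S i \<otimes> (v \<otimes> x))" using dv_mul[OF assms(1)] K by (simp del: suc_mul)
qed (use K in auto)

lemma md_add:
  assumes "v \<in> K" "i \<in> K" "d \<in> K"
  shows "md v (i \<oplus> S d) = md v i \<oplus> S d \<otimes> v"
proof -
  have "S (i \<oplus> S d) \<otimes> v = S i \<otimes> v \<oplus> S d \<otimes> v"
    using assms distrib_right[of "S d" v "S i"] by simp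
  then show ?thesis unfolding md_def using assms by simp
qed

lemma md_coprime:
  assumes K: "v \<in> K" "i \<in> K" "k \<in> K" "x \<in> K" "a \<in> K" and ik: "i \<noteq> k" "i \<prec> a" "k \<prec> a"
    and v: "\<And>d. d \<in> K \<Longrightarrow> d \<prec> a \<Longrightarrow> dv (S d) v"
    and dv: "dv (md v i) (md v k \<otimes> x)"
  shows "dv (md v i) x"
proof -
  \<comment> \<open>In either order of i and k, the modulus \<open>md v k\<close> may be replaced by
    its difference from \<open>md v i\<close>, a multiple \<open>S d \<otimes> v\<close>.\<close>
  have "\<exists>d\<in>K. d \<prec> a \<and> dv (md v i) ((S d \<otimes> v) \<otimes> x)"
  proof (cases "i \<prec> k")
    case True
    then obtain d where d: "d \<in> K" "k = i \<oplus> S d" using lt_iff K by blast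
    have "S d \<preceq> k" using le_add2[of i "S d"] d K by simp
    then have "d \<prec> a" using lt_trans[OF _ ik(3)] suc_le_iff[of d k] d(1) K by blast
    moreover have "md v k \<otimes> x = md v i \<otimes> x \<oplus> (S d \<otimes> v) \<otimes> x"
      unfolding d(2) md_add[OF K(1,2) d(1)] using distrib_right K d(1) by (simp del: suc_mul)
    then have "dv (md v i) ((S d \<otimes> v) \<otimes> x)"
      using dv_cancel[of "md v i" "md v i \<otimes> x" "(S d \<otimes> v) \<otimes> x"] dv dv_self[of "md v i" x] K d(1)
      by (simp del: suc_mul)
    ultimately show ?thesis using d(1) by blast
  next
    case False
    then have "k \<prec> i" using ik(1) lt_total[of k i] K by blast
    then obtain d where d: "d \<in> K" "i = k \<oplus> S d" using lt_iff K by blast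
    have "S d \<preceq> i" using le_add2[of k "S d"] d K by simp
    then have "d \<prec> a" using lt_trans[OF _ ik(2)] suc_le_iff[of d i] d(1) K by blast
    moreover have "md v i \<otimes> x = md v k \<otimes> x \<oplus> (S d \<otimes> v) \<otimes> x"
      unfolding d(2) md_add[OF K(1,3) d(1)] using distrib_right K d(1) by (simp del: suc_mul)
    then have "dv (md v i) ((S d \<otimes> v) \<otimes> x)"
      using dv_cancel[of "md v i" "md v k \<otimes> x" "(S d \<otimes> v) \<otimes> x"] dv dv_self[of "md v i" x] K d(1)
      by (simp del: suc_mul)
    ultimately show ?thesis using d(1) by blast
  qed
  then obtain d where d: "d \<in> K" "d \<prec> a" "dv (md v i) ((S d \<otimes> v) \<otimes> x)" by blast
  have "(S d \<otimes> v) \<otimes> x = v \<otimes> (S d \<otimes> x)"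
    using mul_assoc[of x "S d" v] mul_left_comm[of v "S d" x] d(1) K by (simp del: suc_mul)
  then have 1: "dv (md v i) (S d \<otimes> x)"
    using md_dv_cancel[of v i "S d \<otimes> x"] d(1,3) K by (simp del: suc_mul)
  \<comment> \<open>As \<open>S d\<close> divides v, the factor \<open>S d\<close> can be enlarged
    to v, which is cancelled as before.\<close>
  obtain w where w: "w \<in> K" "v = S d \<otimes> w" using v[OF d(1,2)] unfolding dv_def by blast
  have "w \<otimes> (S d \<otimes> x) = v \<otimes> x"
    unfolding w(2) using mul_assoc[of x "S d" w] mul_left_comm[of "S d" w x] d(1) w(1) K
    by (simp del: suc_mul)
  then have "dv (md v i) (v \<otimes> x)"
    using dv_mul[OF 1, of w] w(1) d(1) K by (simp del: suc_mul)
  then show ?thesis using md_dv_cancel K by blast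
qed

text \<open>The code of \<open>J\<close> below a is the least non-zero u divisible by
  \<open>md v i\<close> for all i in \<open>J\<close> below a; bounded induction supplies it. If
  some \<open>md v k\<close> with k below a but outside \<open>J\<close> also divided u, the
  quotient would, by coprimality, still be a common multiple, and a smaller one. Hence divisibility
  of u by \<open>md v i\<close> decides membership of i.\<close>

lemma Delta0_initial_segment_definable:
  assumes ind: "\<And>p. Delta0_I p \<Longrightarrow> induction_axiom M J p" and a: "a \<in> K"
  shows "\<exists>R. dp1 R \<and> (\<forall>i\<in>K. i \<prec> a \<longrightarrow> (i \<in> J \<longleftrightarrow> R i))"
proof -
  have "\<exists>v\<in>K. v \<noteq> Z \<and> (\<forall>d\<in>K. d \<prec> a \<longrightarrow> dv (S d) v)"
    by (rule common_multiple[OF _ _ a]) (intro dp_rules, simp)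
  then obtain v where v: "v \<in> K" "v \<noteq> Z" "\<And>d. d \<in> K \<Longrightarrow> d \<prec> a \<Longrightarrow> dv (S d) v" by blast
  have "\<exists>w\<in>K. w \<noteq> Z \<and> (\<forall>i\<in>K. i \<prec> a \<longrightarrow> dv (md v i) w)"
  proof (rule common_multiple[OF _ _ a])
    show "dfM K {\<lambda>x. x} (md v)" unfolding md_def by (intro dp_rules v)
    show "md v i \<noteq> Z" if "i \<in> K" for i unfolding md_def using that v(1) by (simp del: suc_mul)
  qed
  then obtain w where w: "w \<in> K" "w \<noteq> Z" "\<And>i. i \<in> K \<Longrightarrow> i \<prec> a \<Longrightarrow> dv (md v i) w" by blast
  \<comment> \<open>Variable 0 is the multiple, 1 is a, 2 is v, 3 runs over \<open>J\<close> below
    a, and 4 is the cofactor. The cofactor is at most the multiple, so the quantifier over it can be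
    bounded by \<open>Sc (Var 0)\<close>.\<close>
  define p where "p = Conj (Neg (Eq (Var 0) Zero)) (Neg (Ex 3 (Conj (Less (Var 3) (Var 1))
      (Conj (InI (Var 3)) (Neg (Ex 4 (Conj (Less (Var 4) (Sc (Var 0)))
        (Eq (Var 0) (Mul (Sc (Mul (Sc (Var 3)) (Var 2))) (Var 4))))))))))"
  have p: "Delta0_I p" unfolding p_def by (intro Delta0_I.intros) simp_all
  define e where "e = (\<lambda>k :: nat. if k = 1 then a else v)"
  have e: "e j \<in> K" for j unfolding e_def using a v(1) by simp
  have le: "z \<preceq> md v i \<otimes> z" if "i \<in> K" "z \<in> K" for i z
    unfolding md_def using that v(1) suc_mul[of z "S i \<otimes> v"] le_add2[of "(S i \<otimes> v) \<otimes> z" z]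
    by (simp del: suc_mul add: suc_mul[of z "S i \<otimes> v"])
  have sat_p: "sat M J (e(0 := u)) p \<longleftrightarrow> u \<noteq> Z \<and> (\<forall>i\<in>K. i \<prec> a \<and> i \<in> J \<longrightarrow> dv (md v i) u)"
    if u: "u \<in> K" for u
  proof -
    have "(\<exists>z\<in>K. z \<prec> S u \<and> u = S (S i \<otimes> v) \<otimes> z) \<longleftrightarrow> dv (md v i) u" if "i \<in> K" for i
      unfolding dv_def md_def[symmetric] using le[OF that] u lt_suc_le by metis
    then show ?thesis unfolding p_def e_def by (simp del: suc_mul PA_axioms) blast
  qed
  have "sat M J (e(0 := w)) p" unfolding sat_p[OF w(1)] using w by blast
  from Delta0_least[of J p e w 0, OF ind p e w(1) this] obtain u where u: "u \<in> K" "sat M J (e(0 := u)) p"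
    and min: "\<And>x. x \<in> K \<Longrightarrow> x \<prec> u \<Longrightarrow> \<not> sat M J (e(0 := x)) p" by blast
  have u': "u \<noteq> Z" "\<And>i. i \<in> K \<Longrightarrow> i \<prec> a \<Longrightarrow> i \<in> J \<Longrightarrow> dv (md v i) u"
    using u(2) unfolding sat_p[OF u(1)] by blast+
  have "k \<in> J" if k: "k \<in> K" "k \<prec> a" "dv (md v k) u" for k
  proof (rule ccontr)
    assume kJ: "k \<notin> J"
    obtain x where x: "x \<in> K" "u = md v k \<otimes> x" using k(3) unfolding dv_def by blast
    have "x \<noteq> Z" using x u'(1) k(1) v(1) by auto
    moreover have "dv (md v i) x" if i: "i \<in> K" "i \<prec> a" "i \<in> J" for i
    proof (rule md_coprime[OF v(1) i(1) k(1) x(1) a _ i(2) k(2) v(3)])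
      show "i \<noteq> k" using i(3) kJ by blast
      show "dv (md v i) (md v k \<otimes> x)" using u'(2)[OF i] x(2) by simp
    qed
    ultimately have "sat M J (e(0 := x)) p" unfolding sat_p[OF x(1)] by blast
    moreover have "x \<prec> u"
    proof -
      have n: "(S k \<otimes> v) \<otimes> x \<noteq> Z" "(S k \<otimes> v) \<otimes> x \<in> K"
        using mul_neq_zero[of "S k \<otimes> v" x] mul_neq_zero[of "S k" v] \<open>x \<noteq> Z\<close> v(1,2) k(1) x(1)
        by (simp_all del: suc_mul)
      then obtain c where c: "c \<in> K" "(S k \<otimes> v) \<otimes> x = S c" using zero_or_suc by blast
      have "u = x \<oplus> S c"
        unfolding x(2) md_def c(2)[symmetric] using suc_mul[of x "S k \<otimes> v"] add_comm[of x "(S k \<otimes> v) \<otimes> x"]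
          v(1) k(1) x(1) n(2) by (simp del: suc_mul add: suc_mul[of x "S k \<otimes> v"])
      then show ?thesis using lt_iff[OF u(1) x(1)] c(1) by blast
    qed
    ultimately show False using min x(1) by blast
  qed
  with u'(2) have "\<forall>i\<in>K. i \<prec> a \<longrightarrow> (i \<in> J \<longleftrightarrow> dv (md v i) u)" by blast
  moreover have "dp1 (\<lambda>i. dv (md v i) u)"
    unfolding dv_def md_def by (intro dp_rules u v)
  ultimately show ?thesis by blast
qed


section \<open>Formulae with bounded solution sets\<close>

definition bdd :: "fm \<Rightarrow> bool" where
  "bdd p \<longleftrightarrow> (\<forall>e :: nat \<Rightarrow> 'a. e \<in> envs M \<longrightarrow> (\<exists>b\<in>K. \<forall>w\<in>K. sat M {} (e(0 := w)) p \<longrightarrow> w \<preceq> b))"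

text \<open>Variable 1 is reserved for the common bound on the parameters and variable 0 for the
  solution; k stands for one parameter.\<close>

definition bex :: "nat \<Rightarrow> fm \<Rightarrow> fm" where
  "bex k p = Ex k (Conj (Neg (Less (Var 1) (Var k))) p)"

text \<open>An instance of collection: the solution sets for all parameters below x have a common
  bound, by induction on x in \<open>M\<close>.\<close>

lemma bdd_bex:
  assumes p: "LA_formula p" "bdd p" and k: "k \<noteq> 0" "k \<noteq> 1"
  shows "bdd (bex k p)"
  unfolding bdd_def
proof (intro allI impI)
  fix e :: "nat \<Rightarrow> 'a" assume e: "e \<in> envs M"
  have eK: "e j \<in> K" for j using e by simp
  define \<Psi> where "\<Psi> z w \<longleftrightarrow> sat M {} (e(0 := w, k := z)) p" for z w
  define f where "f j = (if j = k then (\<lambda>z. fst z) else if j = 0 then snd else (\<lambda>_. e j))" for j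
  have f: "dfM (K \<times> K) (ext {\<lambda>x. x}) (f j)" for j
  proof -
    have "dfM (K \<times> K) (ext {\<lambda>x. x}) (\<lambda>z. fst z)" by (rule df_weaken[OF df_id])
    moreover have "dfM (K \<times> K) (ext {\<lambda>x. x}) snd" by (rule df_snd)
    moreover have "dfM (K \<times> K) (ext {\<lambda>x. x}) (\<lambda>_. e j)" by (rule df_const'[OF eK])
    ultimately show ?thesis unfolding f_def by simp
  qed
  have "dpM (K \<times> K) (ext {\<lambda>x. x}) (\<lambda>z. sat M {} (\<lambda>j. f j z) p)"
    by (rule dp_sat[OF p(1) f]) simp
  then have \<Psi>: "dp2 M K \<Psi>"
  proof (rule dp_cong)
    fix z :: "'a \<times> 'a"
    have "(\<lambda>j. f j z) = e(0 := snd z, k := fst z)" using k unfolding f_def by auto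
    then show "sat M {} (\<lambda>j. f j z) p \<longleftrightarrow> \<Psi> (fst z) (snd z)" unfolding \<Psi>_def by simp
  qed
  have bd: "\<exists>b\<in>K. \<forall>w\<in>K. \<Psi> z w \<longrightarrow> w \<preceq> b" if z: "z \<in> K" for z
  proof -
    have eq: "(e(k := z))(0 := w) = e(0 := w, k := z)" for w using k by auto
    show ?thesis
      using p(2)[unfolded bdd_def, rule_format, of "e(k := z)"] e z unfolding eq \<Psi>_def by simp
  qed
  have "\<exists>b\<in>K. \<forall>z\<in>K. z \<prec> x \<longrightarrow> (\<forall>w\<in>K. \<Psi> z w \<longrightarrow> w \<preceq> b)" if "x \<in> K" for x
    using that
  proof (induction x rule: induct)
    show "dp1 (\<lambda>x. \<exists>b\<in>K. \<forall>z\<in>K. z \<prec> x \<longrightarrow> (\<forall>w\<in>K. \<Psi> z w \<longrightarrow> w \<preceq> b))"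
      by (intro dp_rules dp_app2[OF \<Psi>])
    show "\<exists>b\<in>K. \<forall>z\<in>K. z \<prec> Z \<longrightarrow> (\<forall>w\<in>K. \<Psi> z w \<longrightarrow> w \<preceq> b)"
      by (intro bexI[of _ Z]) simp_all
  next
    fix x assume x: "x \<in> K" and "\<exists>b\<in>K. \<forall>z\<in>K. z \<prec> x \<longrightarrow> (\<forall>w\<in>K. \<Psi> z w \<longrightarrow> w \<preceq> b)"
    then obtain b where b: "b \<in> K" "\<And>z w. z \<in> K \<Longrightarrow> z \<prec> x \<Longrightarrow> w \<in> K \<Longrightarrow> \<Psi> z w \<Longrightarrow> w \<preceq> b"
      by blast
    obtain c where c: "c \<in> K" "\<And>w. w \<in> K \<Longrightarrow> \<Psi> x w \<Longrightarrow> w \<preceq> c"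
      using bd[OF x] by blast
    obtain d where d: "d \<in> K" "b \<preceq> d" "c \<preceq> d" using upper_bound2[OF b(1) c(1)] .
    have "w \<preceq> d" if "z \<in> K" "z \<prec> S x" "w \<in> K" "\<Psi> z w" for z w
    proof (cases "z = x")
      case True
      with that c(2) have "w \<preceq> c" by blast
      then show ?thesis using le_trans[OF _ d(3)] that(3) c(1) d(1) by blast
    next
      case False
      with that b(2) x have "w \<preceq> b" by simp
      then show ?thesis using le_trans[OF _ d(2)] that(3) b(1) d(1) by blast
    qed
    then show "\<exists>b\<in>K. \<forall>z\<in>K. z \<prec> S x \<longrightarrow> (\<forall>w\<in>K. \<Psi> z w \<longrightarrow> w \<preceq> b)"
      using d(1) by blast
  qed
  from this[of "S (e 1)"] obtain b where b: "b \<in> K"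
    "\<And>z w. z \<in> K \<Longrightarrow> z \<prec> S (e 1) \<Longrightarrow> w \<in> K \<Longrightarrow> \<Psi> z w \<Longrightarrow> w \<preceq> b"
    using carr_closed(2)[OF eK] by blast
  show "\<exists>b\<in>K. \<forall>w\<in>K. sat M {} (e(0 := w)) (bex k p) \<longrightarrow> w \<preceq> b"
  proof (intro bexI ballI impI)
    fix w assume w: "w \<in> K" "sat M {} (e(0 := w)) (bex k p)"
    then obtain z where z: "z \<in> K" "\<not> e 1 \<prec> z" "\<Psi> z w"
      unfolding bex_def \<Psi>_def using k by auto
    have "z \<prec> S (e 1)" using z(2) not_lt[OF eK z(1)] lt_suc_le[OF z(1) eK] by blast
    then show "w \<preceq> b" using b(2) z w(1) by blast
  qed (rule b(1))
qed

definition bexs :: "nat list \<Rightarrow> fm \<Rightarrow> fm" where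
  "bexs ks p = foldr bex ks p"

lemma LA_bexs [simp]: "LA_formula (bexs ks p) \<longleftrightarrow> LA_formula p"
  unfolding bexs_def by (induction ks) (simp_all add: bex_def)

lemma bdd_bexs: "LA_formula p \<Longrightarrow> bdd p \<Longrightarrow> 0 \<notin> set ks \<Longrightarrow> 1 \<notin> set ks \<Longrightarrow> bdd (bexs ks p)"
proof (induction ks)
  case (Cons k ks)
  then have "bdd (bex k (bexs ks p))" by (intro bdd_bex) auto
  then show ?case unfolding bexs_def by simp
qed (simp add: bexs_def)

lemma fvars_bexs: "fvars (bexs ks p) \<subseteq> insert 1 (fvars p - set ks)"
  unfolding bexs_def by (induction ks) (auto simp: bex_def)

lemma sat_bexs:
  "sat M {} e p \<Longrightarrow> e 1 \<in> K \<Longrightarrow> (\<And>k. k \<in> set ks \<Longrightarrow> e k \<in> K \<and> e k \<preceq> e 1) \<Longrightarrow>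
    1 \<notin> set ks \<Longrightarrow> sat M {} e (bexs ks p)"
proof (induction ks)
  case (Cons k ks)
  then have s: "sat M {} e (bexs ks p)" and k: "e k \<in> K" "e k \<preceq> e 1" "k \<noteq> 1" by auto
  have "sat M {} e (bex k (bexs ks p))"
    unfolding bex_def sat.simps
    by (rule bexI[OF _ k(1)]) (use s k not_lt[OF Cons.prems(2) k(1)] in simp)
  then show ?case unfolding bexs_def by simp
qed (simp add: bexs_def)

text \<open>The fresh variable w keeps the smaller candidate while variable 0 is quantified anew,
  which evaluates \<open>p\<close> at w.\<close>

definition least_fm :: "nat \<Rightarrow> fm \<Rightarrow> fm" where
  "least_fm w p = Conj p (Neg (Ex w (Conj (Less (Var w) (Var 0)) (Ex 0 (Conj (Eq (Var 0) (Var w)) p)))))"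

lemma sat_least_fm:
  assumes "w \<noteq> 0" "w \<notin> fvars p"
  shows "sat M {} e (least_fm w p) \<longleftrightarrow>
    sat M {} e p \<and> (\<forall>x\<in>K. x \<prec> e 0 \<longrightarrow> \<not> sat M {} (e(0 := x)) p)"
proof -
  have "sat M {} (e(w := x, 0 := x)) p \<longleftrightarrow> sat M {} (e(0 := x)) p" for x
    by (rule sat_cong) (use assms in auto)
  then show ?thesis unfolding least_fm_def using assms(1) by auto
qed

lemma bdd_least_fm:
  assumes "w \<noteq> 0" "w \<notin> fvars p"
  shows "bdd (least_fm w p)"
  unfolding bdd_def
proof (intro allI impI)
  fix e :: "nat \<Rightarrow> 'a" assume e: "e \<in> envs M"
  define P where "P x \<longleftrightarrow> sat M {} (e(0 := x)) p" for x
  have s: "sat M {} (e(0 := x)) (least_fm w p) \<longleftrightarrow> P x \<and> (\<forall>y\<in>K. y \<prec> x \<longrightarrow> \<not> P y)" for x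
    unfolding sat_least_fm[OF assms] P_def by simp
  show "\<exists>b\<in>K. \<forall>x\<in>K. sat M {} (e(0 := x)) (least_fm w p) \<longrightarrow> x \<preceq> b"
  proof (cases "\<exists>b\<in>K. P b")
    case True
    then obtain b where b: "b \<in> K" "P b" by blast
    have "x \<preceq> b" if "x \<in> K" "\<forall>y\<in>K. y \<prec> x \<longrightarrow> \<not> P y" for x
      using that b not_lt by blast
    then show ?thesis unfolding s using b(1) by blast
  next
    case False
    then show ?thesis unfolding s using carr_closed(1) by blast
  qed
qed

text \<open>
  Otherwise the successor function of \<open>J\<close> on \<open>H\<close> would be definable with parameters.  Quantifying
  the parameters below \<open>u\<close> gives a formula \<open>\<theta>(u, w)\<close> without parameters that has only a bounded set
  of solutions \<open>w\<close> for each \<open>u\<close>, but by indiscernibility it holds for all \<open>u < w\<close> in \<open>J\<close>.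
\<close>

lemma indiscernible_trace_undefinable:
  assumes J: "J \<subseteq> K" "order_indiscernibles M J" "unbounded_in M J"
    and R: "dp M A K {\<lambda>x. x} R" "A \<subseteq> K" and H: "H \<subseteq> K"
    and cof: "\<And>F. finite F \<Longrightarrow> F \<subseteq> A \<Longrightarrow> \<exists>j\<in>J \<inter> H. \<forall>a\<in>F. a \<preceq> j"
    and nomax: "\<And>j. j \<in> J \<inter> H \<Longrightarrow> \<exists>j'\<in>J \<inter> H. j \<prec> j'"
    and down: "\<And>a b. b \<in> H \<Longrightarrow> a \<in> K \<Longrightarrow> a \<preceq> b \<Longrightarrow> a \<in> H"
    and trace: "\<And>b. b \<in> H \<Longrightarrow> b \<in> J \<longleftrightarrow> R b"
  shows False
proof -
  obtain q0 d0 where q0: "LA_formula q0" "\<And>k. d0 k \<in> insert Z A"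
    and Rq0: "\<And>v. v \<in> K \<Longrightarrow> R v \<longleftrightarrow> sat M {} (d0(0 := v)) q0"
    by (rule dp_single_variable[OF R(1)]) (rule that)
  \<comment> \<open>The shift frees variable 1 for the bound u.\<close>
  define r where "r k = (if k = 0 then 0 else Suc k)" for k :: nat
  have "inj r" unfolding inj_def r_def by auto
  define q where "q = fm_rename r q0"
  define d where "d k = d0 (k - 1)" for k
  have q: "LA_formula q" unfolding q_def using q0(1) by simp
  have d: "d k \<in> insert Z A" for k unfolding d_def by (rule q0(2))
  have dK: "d k \<in> K" for k using d[of k] R(2) by auto
  have q1: "1 \<notin> fvars q" unfolding q_def fvars_rename[OF \<open>inj r\<close>] r_def by auto
  have Rq: "R v \<longleftrightarrow> sat M {} (d(1 := u, 0 := v)) q" if "v \<in> K" for v u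
  proof -
    have "sat M {} (d(1 := u, 0 := v)) q \<longleftrightarrow> sat M {} ((d(1 := u, 0 := v)) \<circ> r) q0"
      unfolding q_def by (rule sat_rename[OF \<open>inj r\<close>])
    also have "(d(1 := u, 0 := v)) \<circ> r = d0(0 := v)"
      by (auto simp: fun_eq_iff r_def d_def)
    finally show ?thesis unfolding Rq0[OF that] by (rule sym)
  qed
  define ks where "ks = sorted_list_of_set (fvars q - {0, 1})"
  have ks: "set ks = fvars q - {0, 1}" unfolding ks_def by simp
  define \<psi> where "\<psi> = Conj (Less (Var 1) (Var 0)) q"
  have "finite (insert 0 (fvars \<psi>))" by simp
  then obtain w where "w \<notin> insert 0 (fvars \<psi>)" using ex_new_if_finite infinite_UNIV_nat by blast
  then have w: "w \<noteq> 0" "w \<notin> fvars \<psi>" by auto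
  define \<theta> where "\<theta> = bexs ks (least_fm w \<psi>)"
  have LA: "LA_formula (least_fm w \<psi>)" unfolding least_fm_def \<psi>_def using q by simp
  have bdd: "bdd \<theta>"
    unfolding \<theta>_def by (rule bdd_bexs[OF LA bdd_least_fm[OF w]]) (simp_all add: ks)
  have fv: "fvars \<theta> \<subseteq> {0, 1}"
  proof -
    have "fvars (least_fm w \<psi>) \<subseteq> {0, 1} \<union> fvars q"
      unfolding least_fm_def \<psi>_def by auto
    then show ?thesis unfolding \<theta>_def using fvars_bexs[of ks "least_fm w \<psi>"] ks by blast
  qed
  \<comment> \<open>Each parameter lies in \<open>A\<close> or is the default zero, so cofinality of
    \<open>J\<close> in \<open>H\<close> puts j above all of them.\<close>
  obtain j where j: "j \<in> J" "j \<in> H" "\<And>a. a \<in> d ` set ks \<inter> A \<Longrightarrow> a \<preceq> j"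
    using cof[of "d ` set ks \<inter> A"] by auto
  have jK: "j \<in> K" using j(1) J(1) by blast
  have dj: "d k \<preceq> j" if "k \<in> set ks" for k
    using d[of k] j(3)[of "d k"] that zero_le[OF jK] by (cases "d k = Z") auto
  obtain j2 where j2: "j2 \<in> J" "j2 \<in> H" "j \<prec> j2" using nomax[of j] j by blast
  have j2K: "j2 \<in> K" using j2(1) J(1) by blast
  \<comment> \<open>\<open>j'\<close> will be the successor of j in \<open>J\<close>. Comparison
    with \<open>j2\<close> places it in \<open>H\<close>, where \<open>R\<close> describes
    \<open>J\<close>.\<close>
  have "dp1 (\<lambda>x. j \<prec> x \<and> R x)"
    by (intro dp_rules jK dp_app1[OF dp_mono[OF R]])
  from least[OF this j2K] j2 trace obtain j' where j': "j' \<in> K" "j \<prec> j'" "R j'"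
    and min: "\<And>x. x \<in> K \<Longrightarrow> x \<prec> j' \<Longrightarrow> \<not> (j \<prec> x \<and> R x)" by metis
  have "j' \<preceq> j2" using min[of j2] j2 trace[of j2] not_lt[OF j2K j'(1)] j2K by blast
  then have "j' \<in> H" using down[OF j2(2) j'(1)] by blast
  then have j'J: "j' \<in> J" using trace j'(3) by blast
  let ?e = "d(1 := j, 0 := j')"
  have "sat M {} ?e (least_fm w \<psi>)"
    unfolding sat_least_fm[OF w]
  proof (intro conjI ballI impI)
    show "sat M {} ?e \<psi>" unfolding \<psi>_def using j'(2,3) Rq[OF j'(1), of j] by simp
    fix x assume x: "x \<in> K" "x \<prec> ?e 0"
    then have "\<not> (j \<prec> x \<and> R x)" using min by simp
    moreover have "?e(0 := x) = d(1 := j, 0 := x)" by auto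
    ultimately show "\<not> sat M {} (?e(0 := x)) \<psi>" unfolding \<psi>_def using Rq[OF x(1), of j] by simp
  qed
  then have sat_\<theta>: "sat M {} ?e \<theta>"
    unfolding \<theta>_def by (rule sat_bexs) (use jK dj dK ks in auto)
  \<comment> \<open>Indiscernibility reads tuples in increasing order of the variables, whereas in
    \<theta> the larger element belongs to variable 0.\<close>
  define sw where "sw k = (if k = 0 then 1 else if k = 1 then 0 else k)" for k :: nat
  have "inj sw" unfolding inj_def sw_def by (metis zero_neq_one)
  define p where "p = fm_rename sw \<theta>"
  have p: "LA_formula p" "fvars p \<subseteq> {..<2}"
    unfolding p_def fvars_rename[OF \<open>inj sw\<close>] using fv LA unfolding \<theta>_def sw_def by auto
  have sat_p: "sat M {} e p \<longleftrightarrow> sat M {} (d(1 := e 0, 0 := e 1)) \<theta>" for e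
  proof -
    have "sat M {} e p \<longleftrightarrow> sat M {} (e \<circ> sw) \<theta>"
      unfolding p_def by (rule sat_rename[OF \<open>inj sw\<close>])
    also have "\<dots> \<longleftrightarrow> sat M {} (d(1 := e 0, 0 := e 1)) \<theta>"
      by (rule sat_cong) (use fv in \<open>auto simp: sw_def\<close>)
    finally show ?thesis .
  qed
  \<comment> \<open>(j, j') and (j, i) are both increasing pairs from \<open>J\<close>, so \<theta>
    cannot distinguish them.\<close>
  have all: "sat M {} (d(1 := j, 0 := i)) \<theta>" if i: "i \<in> J" "j \<prec> i" for i
  proof -
    have "sat M {} (\<lambda>k. if k = 0 then j else j') p \<longleftrightarrow> sat M {} (\<lambda>k. if k = 0 then j else i) p"
      using J(2)[unfolded order_indiscernibles_def, rule_format, OF p,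
          of "\<lambda>k. if k = 0 then j else j'" "\<lambda>k. if k = 0 then j else i"]
        j(1) j'J i j'(2) by (simp add: less_2_cases_iff)
    then show ?thesis unfolding sat_p using sat_\<theta> by simp
  qed
  have "d(1 := j) \<in> envs M" unfolding envs_def using dK jK by simp
  then obtain b where b: "b \<in> K" "\<And>x. x \<in> K \<Longrightarrow> sat M {} (d(1 := j, 0 := x)) \<theta> \<Longrightarrow> x \<preceq> b"
    using bdd unfolding bdd_def by blast
  obtain c where c: "c \<in> K" "b \<preceq> c" "j \<preceq> c" using upper_bound2[OF b(1) jK] .
  obtain i where i: "i \<in> J" "c \<prec> i" using J(3) c(1) unfolding unbounded_in_def by blast
  have iK: "i \<in> K" using i(1) J(1) by blast
  have "j \<prec> i" "b \<prec> i" using le_lt_trans[OF c(3) i(2) jK c(1) iK] le_lt_trans[OF c(2) i(2) b(1) c(1) iK] .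
  then show False using b(2)[OF iK all[OF i(1)]] not_lt[OF b(1) iK] by blast
qed

section \<open>Iterating the ultrafilter\<close>


lemma coords_cases:
  assumes "c \<in> coords"
  obtains j where "c = (\<lambda>y. y j)"
  using assms unfolding coords_def by (rule imageE) (rule that)

lemma coords_in_K: "\<forall>c\<in>coords. \<forall>x\<in>envs M. c x \<in> K"
  unfolding coords_def by simp

lemma dp_section:
  assumes P: "dpM (D \<times> K) (ext C) (\<lambda>z. P (fst z) (snd z))"
    and C: "\<forall>c\<in>C. \<forall>x\<in>D. c x \<in> K" and x: "x \<in> D"
  shows "dp1 (P x)"
proof (rule dp_reindex_pair[where P = P and g = "\<lambda>_. x" and f = "\<lambda>v. v", OF P])
  show "basic M K K {\<lambda>x. x} (\<lambda>v. c x)" if "c \<in> C" for c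
    by (rule basic_const) (use C that x in blast)
qed (simp_all add: x basic_coord)

text \<open>
  The last index of the list is quantified innermost.  In \<open>T\<close> the lists are increasing: an
  indiscernible is generic over everything generated by those with smaller index.
\<close>

primrec TL :: "'l list \<Rightarrow> (('l \<Rightarrow> 'a) \<Rightarrow> bool) \<Rightarrow> ('l \<Rightarrow> 'a) \<Rightarrow> bool" where
  "TL [] P x = P x"
| "TL (l # ls) P x = Uq (\<lambda>v. TL ls P (x(l := v)))"

text \<open>The type of values is left open because predicates and element-valued functions both
  need supports.\<close>

definition supp :: "'l set \<Rightarrow> (('l \<Rightarrow> 'a) \<Rightarrow> 'c) \<Rightarrow> bool" where
  "supp V P \<longleftrightarrow> (\<forall>x\<in>envs M. \<forall>y\<in>envs M. (\<forall>l\<in>V. x l = y l) \<longrightarrow> P x = P y)"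

lemma suppD: "supp V P \<Longrightarrow> x \<in> envs M \<Longrightarrow> y \<in> envs M \<Longrightarrow> (\<And>l. l \<in> V \<Longrightarrow> x l = y l) \<Longrightarrow> P x = P y"
  unfolding supp_def by blast

lemma suppI: "(\<And>x y. x \<in> envs M \<Longrightarrow> y \<in> envs M \<Longrightarrow> (\<And>l. l \<in> V \<Longrightarrow> x l = y l) \<Longrightarrow> P x = P y) \<Longrightarrow> supp V P"
  unfolding supp_def by blast

lemma supp_mono: "supp V P \<Longrightarrow> V \<subseteq> V' \<Longrightarrow> supp V' P"
  unfolding supp_def by blast

lemma supp_upd: "supp V P \<Longrightarrow> l \<notin> V \<Longrightarrow> x \<in> envs M \<Longrightarrow> v \<in> K \<Longrightarrow> P (x(l := v)) = P x"
  by (intro suppD[of V P "x(l := v)" x]) auto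

lemma TL_supp: "supp V P \<Longrightarrow> supp (V - set ls) (TL ls P)"
proof (induction ls)
  case Nil
  then show ?case by (auto intro!: suppI dest: suppD)
next
  case (Cons l ls)
  show ?case
  proof (rule suppI)
    fix x y :: "'b \<Rightarrow> 'a"
    assume x: "x \<in> envs M" and y: "y \<in> envs M" and eq: "\<And>k. k \<in> V - set (l # ls) \<Longrightarrow> x k = y k"
    have "TL ls P (x(l := v)) = TL ls P (y(l := v))" if v: "v \<in> K" for v
      by (rule suppD[OF Cons.IH[OF Cons.prems], of "x(l := v)" "y(l := v)"]) (use x y v eq in auto)
    then show "TL (l # ls) P x = TL (l # ls) P y"
      unfolding TL.simps by (rule Uq_cong)
  qed
qed

text \<open>Quantification over a coordinate outside the support is vacuous, since \<open>Uq\<close>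
  fixes constant predicates.\<close>

lemma TL_filter:
  "supp V P \<Longrightarrow> x \<in> envs M \<Longrightarrow> TL ls P x \<longleftrightarrow> TL (filter (\<lambda>l. l \<in> V) ls) P x"
proof (induction ls arbitrary: x)
  case (Cons l ls)
  let ?fs = "filter (\<lambda>l. l \<in> V) ls"
  have "TL (l # ls) P x \<longleftrightarrow> Uq (\<lambda>v. TL ?fs P (x(l := v)))"
    unfolding TL.simps
  proof (rule Uq_cong)
    fix v assume "v \<in> K"
    then show "TL ls P (x(l := v)) \<longleftrightarrow> TL ?fs P (x(l := v))"
      by (intro Cons.IH[OF Cons.prems(1), of "x(l := v)"] envs_upd Cons.prems(2))
  qed
  also have "\<dots> \<longleftrightarrow> TL (filter (\<lambda>l. l \<in> V) (l # ls)) P x"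
  proof (cases "l \<in> V")
    case False
    have "supp V (TL ?fs P)" by (rule supp_mono[OF TL_supp[OF Cons.prems(1)]]) blast
    then have "Uq (\<lambda>v. TL ?fs P (x(l := v))) \<longleftrightarrow> Uq (\<lambda>v. TL ?fs P x)"
      by (intro Uq_cong supp_upd[of V "TL ?fs P" l x] False Cons.prems(2))
    with False show ?thesis by simp
  qed simp
  finally show ?case .
qed simp

lemma TL_mono:
  "TL ls P x \<Longrightarrow> x \<in> envs M \<Longrightarrow> (\<And>y. y \<in> envs M \<Longrightarrow> P y \<Longrightarrow> Q y) \<Longrightarrow> TL ls Q x"
proof (induction ls arbitrary: x)
  case (Cons l ls)
  from Cons.prems(1) show ?case
    unfolding TL.simps
  proof (rule Uq_mono)
    fix v assume "v \<in> K" "TL ls P (x(l := v))"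
    then show "TL ls Q (x(l := v))"
      using Cons.IH[of "x(l := v)"] Cons.prems(2,3) envs_upd[OF Cons.prems(2)] by blast
  qed
qed simp

lemma TL_conj: "TL ls (\<lambda>x. P x \<and> Q x) x \<longleftrightarrow> TL ls P x \<and> TL ls Q x"
  by (induction ls arbitrary: x) (simp_all add: Uq_conj)

lemma TL_const [simp]: "TL ls (\<lambda>x. b) x \<longleftrightarrow> b"
  by (induction ls arbitrary: x) simp_all

lemma TL_append: "TL (ls @ ks) P x \<longleftrightarrow> TL ls (TL ks P) x"
  by (induction ls arbitrary: x) simp_all

text \<open>The core of indiscernibility: iterated quantification over the coordinates
  \<open>l k\<close> reduces to quantification over the positions k, whatever the injective choice
  of indices.\<close>

lemma TL_map:
  fixes l :: "nat \<Rightarrow> 'l"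
  assumes "set ks \<subseteq> {..<n}" "inj_on l {..<n}"
  shows "TL (map l ks) (\<lambda>z. Q (\<lambda>k. if k < n then z (l k) else Z)) z \<longleftrightarrow>
    TL ks Q (\<lambda>k. if k < n then z (l k) else Z)"
  using assms(1)
proof (induction ks arbitrary: z)
  case (Cons k ks)
  have k: "k < n" "set ks \<subseteq> {..<n}" using Cons.prems by simp_all
  have upd: "(\<lambda>j. if j < n then (z(l k := v)) (l j) else Z) = (\<lambda>j. if j < n then z (l j) else Z)(k := v)" for v
  proof
    fix j
    show "(if j < n then (z(l k := v)) (l j) else Z) = ((\<lambda>j. if j < n then z (l j) else Z)(k := v)) j"
      using k(1) inj_onD[OF assms(2), of j k] by auto
  qed
  show ?case unfolding list.map TL.simps Cons.IH[OF k(2)] upd ..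
qed simp

lemma dp_quant:
  fixes P :: "('l \<Rightarrow> 'a) \<Rightarrow> bool"
  assumes "dpM (envs M) coords P"
  shows "dpM (envs M) coords (\<lambda>x. Uq (\<lambda>v. P (x(l := v))))"
  by (rule dp_Uq[where P = "\<lambda>x v. P (x(l := v))" and D = "envs M" and C = coords,
        OF dp_upd[OF assms, where k = l] coords_in_K])

lemma TL_dp:
  fixes P :: "('l \<Rightarrow> 'a) \<Rightarrow> bool"
  assumes "dpM (envs M) coords P"
  shows "dpM (envs M) coords (TL ls P)"
proof (induction ls)
  case Nil
  show ?case using assms by (rule dp_cong) simp
next
  case (Cons l ls)
  show ?case unfolding TL.simps by (rule dp_quant[OF Cons.IH])
qed

lemma TL_neg:
  fixes P :: "('l \<Rightarrow> 'a) \<Rightarrow> bool"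
  assumes "dpM (envs M) coords P" "x \<in> envs M"
  shows "TL ls (\<lambda>x. \<not> P x) x \<longleftrightarrow> \<not> TL ls P x"
  using assms(2)
proof (induction ls arbitrary: x)
  case (Cons l ls)
  have "TL (l # ls) (\<lambda>x. \<not> P x) x \<longleftrightarrow> Uq (\<lambda>v. \<not> TL ls P (x(l := v)))"
    unfolding TL.simps
  proof (rule Uq_cong)
    fix v assume "v \<in> K"
    then show "TL ls (\<lambda>x. \<not> P x) (x(l := v)) \<longleftrightarrow> \<not> TL ls P (x(l := v))"
      by (intro Cons.IH[of "x(l := v)"] envs_upd Cons.prems)
  qed
  also have "\<dots> \<longleftrightarrow> \<not> Uq (\<lambda>v. TL ls P (x(l := v)))"
    by (rule Uq_neg, rule dp_section[where P = "\<lambda>x v. TL ls P (x(l := v))" and D = "envs M"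
          and C = coords and x = x, OF dp_upd[OF TL_dp[OF assms(1)], where k = l] coords_in_K Cons.prems])
  finally show ?case by simp
qed simp

lemma finite_supp_coords:
  fixes d :: "nat \<Rightarrow> ('l \<Rightarrow> 'a) \<Rightarrow> 'a"
  assumes d: "\<And>k. d k \<in> coords \<union> pconsts M K" and F: "finite F"
  obtains V where "finite V" "\<And>k. k \<in> F \<Longrightarrow> supp V (d k)"
proof -
  have "\<exists>V. finite V \<and> supp V (d k)" for k
    using d[of k]
  proof
    assume "d k \<in> coords"
    then obtain j where "d k = (\<lambda>y. y j)" by (rule coords_cases)
    then show ?thesis by (intro exI[of _ "{j}"]) (simp add: supp_def)
  next
    assume "d k \<in> pconsts M K"
    then obtain a where "d k = (\<lambda>_. a)" unfolding pconsts_def by auto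
    then show ?thesis by (intro exI[of _ "{}"]) (simp add: supp_def)
  qed
  then obtain V where V: "\<And>k. finite (V k) \<and> supp (V k) (d k)" by metis
  show thesis
  proof (rule that[of "\<Union>k\<in>F. V k"])
    show "finite (\<Union>k\<in>F. V k)" using F V by blast
    show "supp (\<Union>k\<in>F. V k) (d k)" if "k \<in> F" for k
      using supp_mono V that by (metis UN_upper)
  qed
qed

text \<open>The support is uniform in v because v enters only through variable 0 of one fixed
  formula.\<close>

lemma dp_finite_supp2:
  fixes P :: "('l \<Rightarrow> 'a) \<Rightarrow> 'a \<Rightarrow> bool"
  assumes "dpM (envs M \<times> K) (ext coords) (\<lambda>z. P (fst z) (snd z))"
  obtains V where "finite V" "\<And>v. v \<in> K \<Longrightarrow> supp V (\<lambda>x. P x v)"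
proof -
  obtain q and d :: "nat \<Rightarrow> ('l \<Rightarrow> 'a) \<Rightarrow> 'a" where q: "LA_formula q" "\<And>k. d k \<in> coords \<union> pconsts M K"
    and P: "\<And>x v. x \<in> envs M \<Longrightarrow> v \<in> K \<Longrightarrow>
      P (fst (x, v)) (snd (x, v)) \<longleftrightarrow> sat M {} ((\<lambda>k. d k x)(0 := v)) q"
    by (rule dp_normal_form[OF assms]) (rule that)
  obtain V where V: "finite V" "\<And>k. k \<in> fvars q \<Longrightarrow> supp V (d k)"
    by (rule finite_supp_coords[OF q(2) finite_fvars[of q]]) (rule that)
  show thesis
  proof (rule that[OF V(1)], rule suppI)
    fix v and x y :: "'l \<Rightarrow> 'a"
    assume v: "v \<in> K" and xy: "x \<in> envs M" "y \<in> envs M" "\<And>l. l \<in> V \<Longrightarrow> x l = y l"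
    have "sat M {} ((\<lambda>k. d k x)(0 := v)) q \<longleftrightarrow> sat M {} ((\<lambda>k. d k y)(0 := v)) q"
    proof (rule sat_cong)
      fix k assume "k \<in> fvars q"
      then have "d k x = d k y" using suppD[OF V(2) xy] by simp
      then show "((\<lambda>k. d k x)(0 := v)) k = ((\<lambda>k. d k y)(0 := v)) k" by simp
    qed
    then show "P x v = P y v" using P[OF xy(1) v] P[OF xy(2) v] by simp
  qed
qed

lemma dp_finite_supp:
  fixes P :: "('l \<Rightarrow> 'a) \<Rightarrow> bool"
  assumes "dpM (envs M) coords P"
  obtains V where "finite V" "supp V P"
proof -
  have "dpM (envs M \<times> K) (ext coords) (\<lambda>z. P (fst z))" by (rule dp_weaken[OF assms])
  from dp_finite_supp2[where P = "\<lambda>x v. P x", OF this] obtain V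
    where "finite V" "\<And>v. v \<in> K \<Longrightarrow> supp V P" by blast
  with that carr_closed(1) show thesis by blast
qed

lemma df_finite_supp:
  fixes F :: "('l \<Rightarrow> 'a) \<Rightarrow> 'a"
  assumes F: "dfM (envs M) coords F"
  obtains V where "finite V" "supp V F"
proof -
  have FK: "F x \<in> K" if "x \<in> envs M" for x using F that unfolding df_def by blast
  have "dpM (envs M \<times> K) (ext coords) (\<lambda>z. F (fst z) = snd z)" using F unfolding df_def by blast
  from dp_finite_supp2[where P = "\<lambda>x v. F x = v", OF this] obtain V
    where V: "finite V" "\<And>v. v \<in> K \<Longrightarrow> supp V (\<lambda>x. F x = v)" by blast
  have "supp V F"
  proof (rule suppI)
    fix x y :: "'l \<Rightarrow> 'a" assume xy: "x \<in> envs M" "y \<in> envs M" "\<And>l. l \<in> V \<Longrightarrow> x l = y l"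
    have "(F x = F x) = (F y = F x)"
      by (rule suppD[OF V(2)[OF FK[OF xy(1)]] xy])
    then show "F x = F y" by simp
  qed
  with V(1) show thesis by (rule that)
qed

section \<open>Quantification over all coordinates at once\<close>

definition T :: "(('l::linorder \<Rightarrow> 'a) \<Rightarrow> bool) \<Rightarrow> bool" where
  "T P \<longleftrightarrow> (\<exists>V. finite V \<and> supp V P \<and> TL (sorted_list_of_set V) P (\<lambda>_. Z))"

lemma zero_env [simp]: "(\<lambda>_. Z) \<in> envs M"
  unfolding envs_def by simp

lemma T_eq:
  fixes P :: "('l::linorder \<Rightarrow> 'a) \<Rightarrow> bool"
  assumes V: "finite V" "supp V P" and x: "x \<in> envs M"
  shows "T P \<longleftrightarrow> TL (sorted_list_of_set V) P x"
proof -
  have filter: "filter (\<lambda>l. l \<in> A) (sorted_list_of_set (A \<union> B)) = sorted_list_of_set A"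
    if "finite A" "finite B" for A B :: "'l set"
    by (rule sorted_distinct_set_unique) (use that in \<open>auto intro: sorted_wrt_filter\<close>)
  have indep: "TL (sorted_list_of_set A) P y \<longleftrightarrow> TL (sorted_list_of_set A) P z"
    if "finite A" "supp A P" "y \<in> envs M" "z \<in> envs M" for A y z
    by (rule suppD[OF TL_supp[OF that(2)] that(3,4)]) (use that(1) in simp)
  have "TL (sorted_list_of_set A) P y \<longleftrightarrow> TL (sorted_list_of_set B) P z"
    if "finite A" "supp A P" "finite B" "supp B P" "y \<in> envs M" "z \<in> envs M" for A B y z
  proof -
    have "TL (sorted_list_of_set A) P y \<longleftrightarrow> TL (sorted_list_of_set (A \<union> B)) P y"
      unfolding TL_filter[OF that(2,5), of "sorted_list_of_set (A \<union> B)"]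
      using filter[OF that(1,3)] by simp
    also have "\<dots> \<longleftrightarrow> TL (sorted_list_of_set (B \<union> A)) P z"
      using indep[of "A \<union> B" y z] supp_mono[OF that(2)] that by (simp add: Un_commute)
    also have "\<dots> \<longleftrightarrow> TL (sorted_list_of_set B) P z"
      unfolding TL_filter[OF that(4,6), of "sorted_list_of_set (B \<union> A)"]
      using filter[OF that(3,1)] by simp
    finally show ?thesis .
  qed
  from this[OF _ _ V _ x] V show ?thesis
    unfolding T_def using zero_env by blast
qed

lemma T_mono:
  fixes P Q :: "('l::linorder \<Rightarrow> 'a) \<Rightarrow> bool"
  assumes P: "dpM (envs M) coords P" and Q: "dpM (envs M) coords Q"
    and PQ: "\<And>x. x \<in> envs M \<Longrightarrow> P x \<Longrightarrow> Q x" and TP: "T P"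
  shows "T Q"
proof -
  obtain A where A: "finite A" "supp A P" by (rule dp_finite_supp[OF P]) (rule that)
  obtain B where B: "finite B" "supp B Q" by (rule dp_finite_supp[OF Q]) (rule that)
  have "TL (sorted_list_of_set (A \<union> B)) P (\<lambda>_. Z)"
    using TP T_eq[of "A \<union> B" P "\<lambda>_. Z"] A B supp_mono[OF A(2)] by simp
  then have "TL (sorted_list_of_set (A \<union> B)) Q (\<lambda>_. Z)"
    by (rule TL_mono) (simp_all add: PQ)
  then show ?thesis
    using T_eq[of "A \<union> B" Q "\<lambda>_. Z"] A B supp_mono[OF B(2)] by simp
qed

lemma T_conjI:
  fixes P Q :: "('l::linorder \<Rightarrow> 'a) \<Rightarrow> bool"
  assumes P: "dpM (envs M) coords P" and Q: "dpM (envs M) coords Q" and "T P" "T Q"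
  shows "T (\<lambda>x. P x \<and> Q x)"
proof -
  obtain A where A: "finite A" "supp A P" by (rule dp_finite_supp[OF P]) (rule that)
  obtain B where B: "finite B" "supp B Q" by (rule dp_finite_supp[OF Q]) (rule that)
  have 1: "supp (A \<union> B) P" "supp (A \<union> B) Q" using supp_mono A(2) B(2) by blast+
  then have 2: "supp (A \<union> B) (\<lambda>x. P x \<and> Q x)" unfolding supp_def by blast
  show ?thesis
    using assms(3,4) A(1) B(1) T_eq[OF _ 1(1) zero_env] T_eq[OF _ 1(2) zero_env] T_eq[OF _ 2 zero_env]
    by (simp add: TL_conj)
qed

lemma T_conj:
  fixes P Q :: "('l::linorder \<Rightarrow> 'a) \<Rightarrow> bool"
  assumes P: "dpM (envs M) coords P" and Q: "dpM (envs M) coords Q"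
  shows "T (\<lambda>x. P x \<and> Q x) \<longleftrightarrow> T P \<and> T Q"
  using T_conjI[OF P Q] T_mono[OF dp_conj[OF P Q] P] T_mono[OF dp_conj[OF P Q] Q] by blast

lemma T_neg:
  fixes P :: "('l::linorder \<Rightarrow> 'a) \<Rightarrow> bool"
  assumes P: "dpM (envs M) coords P"
  shows "T (\<lambda>x. \<not> P x) \<longleftrightarrow> \<not> T P"
proof -
  obtain A where A: "finite A" "supp A P" by (rule dp_finite_supp[OF P]) (rule that)
  then have A': "supp A (\<lambda>x. \<not> P x)" unfolding supp_def by blast
  show ?thesis
    unfolding T_eq[OF A zero_env] T_eq[OF A(1) A' zero_env] by (rule TL_neg[OF P zero_env])
qed

lemma T_const [simp]: "T (\<lambda>x :: 'l::linorder \<Rightarrow> 'a. b) \<longleftrightarrow> b"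
  using T_eq[of "{}" "\<lambda>x :: 'l \<Rightarrow> 'a. b" "\<lambda>_. Z"] by (simp add: supp_def)

lemma T_true:
  fixes P :: "('l::linorder \<Rightarrow> 'a) \<Rightarrow> bool"
  assumes "dpM (envs M) coords P" "\<And>x. x \<in> envs M \<Longrightarrow> P x"
  shows "T P"
  by (rule T_mono[where P = "\<lambda>_. True", OF dp_const assms(1)]) (simp_all add: assms(2))

lemma T_cong:
  fixes P Q :: "('l::linorder \<Rightarrow> 'a) \<Rightarrow> bool"
  assumes P: "dpM (envs M) coords P" and "\<And>x. x \<in> envs M \<Longrightarrow> P x \<longleftrightarrow> Q x"
  shows "T P \<longleftrightarrow> T Q"
proof -
  have Q: "dpM (envs M) coords Q" using P assms(2) by (rule dp_cong)
  show ?thesis using T_mono[OF P Q] T_mono[OF Q P] assms(2) by blast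
qed

lemma T_cong_mod:
  fixes P Q R :: "('l::linorder \<Rightarrow> 'a) \<Rightarrow> bool"
  assumes P: "dpM (envs M) coords P" and Q: "dpM (envs M) coords Q" and R: "dpM (envs M) coords R" "T R"
    and eq: "\<And>x. x \<in> envs M \<Longrightarrow> R x \<Longrightarrow> P x \<longleftrightarrow> Q x"
  shows "T P \<longleftrightarrow> T Q"
proof
  assume "T P"
  show "T Q"
    by (rule T_mono[OF dp_conj[OF P R(1)] Q _ T_conjI[OF P R(1) \<open>T P\<close> R(2)]]) (use eq in blast)
next
  assume "T Q"
  show "T P"
    by (rule T_mono[OF dp_conj[OF Q R(1)] P _ T_conjI[OF Q R(1) \<open>T Q\<close> R(2)]]) (use eq in blast)
qed

text \<open>The largest index comes last in the sorted list and is therefore quantified innermost,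
  directly in front of \<open>P\<close>.\<close>

lemma T_top:
  fixes P :: "('l::linorder \<Rightarrow> 'a) \<Rightarrow> bool"
  assumes V: "finite V" "supp V P" "\<And>s. s \<in> V \<Longrightarrow> s \<noteq> l \<Longrightarrow> s < l"
  shows "T P \<longleftrightarrow> T (\<lambda>x. Uq (\<lambda>v. P (x(l := v))))"
proof -
  let ?V = "V - {l}"
  have i: "supp (insert l V) P" using supp_mono[OF V(2)] by blast
  have 1: "sorted_list_of_set (insert l V) = sorted_list_of_set ?V @ [l]"
  proof (rule sorted_distinct_set_unique)
    show "sorted (sorted_list_of_set ?V @ [l])"
      using V(1,3) by (auto simp: sorted_append intro: less_imp_le)
    show "distinct (sorted_list_of_set ?V @ [l])" using V(1) by simp
    show "set (sorted_list_of_set (insert l V)) = set (sorted_list_of_set ?V @ [l])"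
      unfolding set_append set_sorted_list_of_set[OF finite_insert[THEN iffD2, OF V(1)]]
        set_sorted_list_of_set[OF finite_Diff[OF V(1)]] by auto
  qed (rule sorted_sorted_list_of_set distinct_sorted_list_of_set)+
  have Q: "TL [l] P = (\<lambda>x. Uq (\<lambda>v. P (x(l := v))))" by (rule ext) simp
  have "supp (V - set [l]) (TL [l] P)" by (rule TL_supp[OF V(2)])
  then have 2: "supp ?V (\<lambda>x. Uq (\<lambda>v. P (x(l := v))))" unfolding Q by simp
  have "T P \<longleftrightarrow> TL (sorted_list_of_set ?V @ [l]) P (\<lambda>_. Z)"
    using T_eq[OF _ i zero_env] V(1) unfolding 1 by simp
  also have "\<dots> \<longleftrightarrow> TL (sorted_list_of_set ?V) (\<lambda>x. Uq (\<lambda>v. P (x(l := v)))) (\<lambda>_. Z)"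
    unfolding TL_append Q ..
  also have "\<dots> \<longleftrightarrow> T (\<lambda>x. Uq (\<lambda>v. P (x(l := v))))"
    using T_eq[OF _ 2 zero_env] V(1) by simp
  finally show ?thesis .
qed

text \<open>Least witnesses serve as definable Skolem functions, which \<open>los\<close> needs for
  existential formulae.\<close>

definition wit :: "('a \<Rightarrow> bool) \<Rightarrow> 'a" where
  "wit P = (if \<exists>v\<in>K. P v then (THE m. m \<in> K \<and> P m \<and> (\<forall>x\<in>K. x \<prec> m \<longrightarrow> \<not> P x)) else Z)"

lemma wit_cong: "(\<And>v. v \<in> K \<Longrightarrow> P v \<longleftrightarrow> Q v) \<Longrightarrow> wit P = wit Q"
proof -
  assume eq: "\<And>v. v \<in> K \<Longrightarrow> P v \<longleftrightarrow> Q v"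
  then have "(\<lambda>m. m \<in> K \<and> P m \<and> (\<forall>x\<in>K. x \<prec> m \<longrightarrow> \<not> P x)) =
      (\<lambda>m. m \<in> K \<and> Q m \<and> (\<forall>x\<in>K. x \<prec> m \<longrightarrow> \<not> Q x))"
    by blast
  moreover have "(\<exists>v\<in>K. P v) \<longleftrightarrow> (\<exists>v\<in>K. Q v)" using eq by blast
  ultimately show ?thesis unfolding wit_def by simp
qed

lemma wit_eq_iff:
  assumes P: "dp1 P" and w: "w \<in> K"
  shows "wit P = w \<longleftrightarrow> (P w \<and> (\<forall>x\<in>K. x \<prec> w \<longrightarrow> \<not> P x)) \<or> (\<not> (\<exists>v\<in>K. P v) \<and> Z = w)"
proof (cases "\<exists>v\<in>K. P v")
  case True
  then obtain m where m: "m \<in> K" "P m" "\<And>x. x \<in> K \<Longrightarrow> x \<prec> m \<Longrightarrow> \<not> P x"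
    using least[OF P] by metis
  have u: "y = m" if "y \<in> K" "P y" "\<forall>x\<in>K. x \<prec> y \<longrightarrow> \<not> P x" for y
    using lt_total[OF m(1) that(1)] m that by blast
  have "(THE m. m \<in> K \<and> P m \<and> (\<forall>x\<in>K. x \<prec> m \<longrightarrow> \<not> P x)) = m"
    by (rule the_equality) (use m u in blast)+
  with True have "wit P = m" unfolding wit_def by simp
  then show ?thesis using True u[OF w] m by auto
next
  case False
  then show ?thesis unfolding wit_def using w by auto
qed

lemma wit_carr: "dp1 P \<Longrightarrow> wit P \<in> K"
  and wit_sat: "dp1 P \<Longrightarrow> v \<in> K \<Longrightarrow> P v \<Longrightarrow> P (wit P)"
proof -
  assume P: "dp1 P"
  have "\<exists>w\<in>K. wit P = w \<and> ((\<exists>v\<in>K. P v) \<longrightarrow> P w)"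
  proof (cases "\<exists>v\<in>K. P v")
    case True
    then obtain m where m: "m \<in> K" "P m" "\<And>x. x \<in> K \<Longrightarrow> x \<prec> m \<Longrightarrow> \<not> P x"
      using least[OF P] by metis
    then have "wit P = m" using wit_eq_iff[OF P m(1)] by blast
    with m show ?thesis by blast
  next
    case False
    then have "wit P = Z" unfolding wit_def by simp
    with False show ?thesis using carr_closed(1) by blast
  qed
  then show "wit P \<in> K" "v \<in> K \<Longrightarrow> P v \<Longrightarrow> P (wit P)" by blast+
qed

lemma df_wit:
  assumes P: "dpM (D \<times> K) (ext C) (\<lambda>z. P (fst z) (snd z))"
    and C: "\<forall>c\<in>C. \<forall>x\<in>D. c x \<in> K"
  shows "dfM D C (\<lambda>x. wit (P x))"
  unfolding df_def
proof
  have dp1: "dp1 (P x)" if "x \<in> D" for x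
    by (rule dp_section[where P = P and D = D and C = C and x = x, OF P C that])
  then show "\<forall>x\<in>D. wit (P x) \<in> K" using wit_carr by blast
  have P2: "dpM ((D \<times> K) \<times> K) (ext (ext C)) (\<lambda>z. P (fst (fst z)) (snd z))"
    by (rule dp_weaken_mid[where P = P, OF P])
  have "dpM (D \<times> K) (ext C) (\<lambda>z. (P (fst z) (snd z) \<and> (\<forall>x\<in>K. x \<prec> snd z \<longrightarrow> \<not> P (fst z) x)) \<or>
      (\<not> (\<exists>v\<in>K. P (fst z) v) \<and> Z = snd z))"
    by (intro dp_rules P P2 carr_closed)
  then show "dpM (D \<times> K) (ext C) (\<lambda>z. wit (P (fst z)) = snd z)"
  proof (rule dp_cong)
    fix z assume "z \<in> D \<times> K"
    then have z: "fst z \<in> D" "snd z \<in> K" by (simp_all add: mem_Times_iff)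
    show "(P (fst z) (snd z) \<and> (\<forall>x\<in>K. x \<prec> snd z \<longrightarrow> \<not> P (fst z) x)) \<or>
      (\<not> (\<exists>v\<in>K. P (fst z) v) \<and> Z = snd z) \<longleftrightarrow> wit (P (fst z)) = snd z"
      unfolding wit_eq_iff[OF dp1[OF z(1)] z(2)] ..
  qed
qed

end

section \<open>The extension generated by the indiscernibles\<close>

definition imp :: "fm \<Rightarrow> fm \<Rightarrow> fm" where
  "imp p q = Neg (Conj p (Neg q))"

text \<open>The induction axiom as a single formula, so that it can be transferred to the extension.
  The fresh variable m carries the successor of k across the second quantification over k.\<close>

definition ind_fm :: "nat \<Rightarrow> nat \<Rightarrow> fm \<Rightarrow> fm" where
  "ind_fm k m p =
    imp (Ex k (Conj (Eq (Var k) Zero) p))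
     (imp (Neg (Ex k (Conj p (Neg (Ex m (Conj (Eq (Var m) (Sc (Var k)))
        (Ex k (Conj (Eq (Var k) (Var m)) p))))))))
      (Neg (Ex k (Neg p))))"

lemma sat_imp [simp]: "sat M I e (imp p q) \<longleftrightarrow> (sat M I e p \<longrightarrow> sat M I e q)"
  unfolding imp_def by simp

lemma LA_imp [simp]: "LA_formula (imp p q) \<longleftrightarrow> LA_formula p \<and> LA_formula q"
  unfolding imp_def by simp

lemma sat_ind_fm:
  assumes M: "LA_structure M" and m: "m \<noteq> k" "m \<notin> fvars p"
  shows "sat M I e (ind_fm k m p) \<longleftrightarrow> (sat M I (e(k := zeroM M)) p \<longrightarrow>
    (\<forall>a\<in>carr M. sat M I (e(k := a)) p \<longrightarrow> sat M I (e(k := sucM M a)) p) \<longrightarrow>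
    (\<forall>a\<in>carr M. sat M I (e(k := a)) p))"
proof -
  have Z: "zeroM M \<in> carr M" and S: "sucM M a \<in> carr M" if "a \<in> carr M" for a
    using M that unfolding LA_structure_def by blast+
  have c: "sat M I (e(m := a, k := b)) p \<longleftrightarrow> sat M I (e(k := b)) p" for a b
    by (rule sat_cong) (use m in auto)
  show ?thesis
    unfolding ind_fm_def sat_imp sat.simps using m(1) M[unfolded LA_structure_def]
    by (simp add: c cong: conj_cong)
qed

text \<open>
  The elements of the iterated ultrapower are the definable functions of finitely many coordinates,
  modulo equality almost everywhere in the sense of \<open>T\<close>; \<open>h\<close> names their classes in the type \<open>'b\<close>.
\<close>

locale iterated = arith M for M :: "'a LA_struct" +
  fixes h :: "(('l::linorder \<Rightarrow> 'a) \<Rightarrow> 'a) \<Rightarrow> 'b"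
  assumes h_eq: "dfM (envs M) coords F \<Longrightarrow> dfM (envs M) coords G \<Longrightarrow> h F = h G \<longleftrightarrow> T (\<lambda>x. F x = G x)"
begin

abbreviation EE :: "('l \<Rightarrow> 'a) set" where "EE \<equiv> envs M"

abbreviation dpE :: "(('l \<Rightarrow> 'a) \<Rightarrow> bool) \<Rightarrow> bool" where "dpE \<equiv> dpM EE coords"

abbreviation dpE2 :: "(('l \<Rightarrow> 'a) \<Rightarrow> 'a \<Rightarrow> bool) \<Rightarrow> bool" where
  "dpE2 P \<equiv> dpM (EE \<times> K) (ext coords) (\<lambda>z. P (fst z) (snd z))"

definition DF :: "(('l \<Rightarrow> 'a) \<Rightarrow> 'a) set" where
  "DF = {F. dfM EE coords F}"

lemma DF_df: "F \<in> DF \<Longrightarrow> dfM EE coords F"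
  unfolding DF_def by simp

lemma DF_carr [simp]: "F \<in> DF \<Longrightarrow> x \<in> EE \<Longrightarrow> F x \<in> K"
  unfolding DF_def df_def by blast

lemma DF_const: "a \<in> K \<Longrightarrow> (\<lambda>_. a) \<in> DF"
  unfolding DF_def by (simp add: df_const')

lemma DF_coord: "(\<lambda>x. x l) \<in> DF"
  unfolding DF_def mem_Collect_eq by (rule df_coord) simp_all

lemma DF_ops:
  "F \<in> DF \<Longrightarrow> (\<lambda>x. S (F x)) \<in> DF"
  "F \<in> DF \<Longrightarrow> G \<in> DF \<Longrightarrow> (\<lambda>x. F x \<oplus> G x) \<in> DF"
  "F \<in> DF \<Longrightarrow> G \<in> DF \<Longrightarrow> (\<lambda>x. F x \<otimes> G x) \<in> DF"
  unfolding DF_def by (simp_all add: df_suc df_add df_mul)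

lemma dpE_eq: "F \<in> DF \<Longrightarrow> G \<in> DF \<Longrightarrow> dpE (\<lambda>x. F x = G x)"
  by (intro dp_eq DF_df)

lemma dpE_lt: "F \<in> DF \<Longrightarrow> G \<in> DF \<Longrightarrow> dpE (\<lambda>x. F x \<prec> G x)"
  by (intro dp_lt DF_df)

lemma h_iff: "F \<in> DF \<Longrightarrow> G \<in> DF \<Longrightarrow> h F = h G \<longleftrightarrow> T (\<lambda>x. F x = G x)"
  by (intro h_eq DF_df)

text \<open>\<open>N\<close> lives on the type of names, so its operations have to choose
  representatives; \<open>N_suc\<close>, \<open>N_add\<close>, \<open>N_mul\<close> and
  \<open>N_lt\<close> show that the choice does not matter.\<close>

definition rep :: "'b \<Rightarrow> ('l \<Rightarrow> 'a) \<Rightarrow> 'a" where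
  "rep b = (SOME F. F \<in> DF \<and> h F = b)"

lemma rep: "b \<in> h ` DF \<Longrightarrow> rep b \<in> DF \<and> h (rep b) = b"
  unfolding rep_def by (rule someI_ex[of "\<lambda>F. F \<in> DF \<and> h F = b"]) blast

lemma rep_DF [simp]: "b \<in> h ` DF \<Longrightarrow> rep b \<in> DF"
  using rep by blast

lemma rep_h [simp]: "F \<in> DF \<Longrightarrow> rep (h F) \<in> DF"
  using rep by blast

lemma T_rep: "F \<in> DF \<Longrightarrow> T (\<lambda>x. rep (h F) x = F x)"
  using rep[of "h F"] h_iff[of "rep (h F)" F] by blast

definition N :: "'b LA_struct" where
  "N = \<lparr>carr = h ` DF, zeroM = h (\<lambda>_. Z), sucM = (\<lambda>a. h (\<lambda>x. S (rep a x))),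
     addM = (\<lambda>a b. h (\<lambda>x. rep a x \<oplus> rep b x)), mulM = (\<lambda>a b. h (\<lambda>x. rep a x \<otimes> rep b x)),
     ltM = (\<lambda>a b. T (\<lambda>x. rep a x \<prec> rep b x))\<rparr>"

lemma N_carr [simp]: "carr N = h ` DF"
  unfolding N_def by simp

lemma N_zero: "zeroM N = h (\<lambda>_. Z)"
  unfolding N_def by simp

lemma T_rep2:
  "F \<in> DF \<Longrightarrow> G \<in> DF \<Longrightarrow> T (\<lambda>x. rep (h F) x = F x \<and> rep (h G) x = G x)"
  "F \<in> DF \<Longrightarrow> G \<in> DF \<Longrightarrow> dpE (\<lambda>x. rep (h F) x = F x \<and> rep (h G) x = G x)"
  by (intro T_conjI T_rep dpE_eq rep_h dp_conj; assumption)+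

lemma N_suc:
  assumes "F \<in> DF"
  shows "sucM N (h F) = h (\<lambda>x. S (F x))"
proof -
  have 1: "(\<lambda>x. S (rep (h F) x)) \<in> DF" "(\<lambda>x. S (F x)) \<in> DF"
    using assms by (simp_all add: DF_ops)
  have "T (\<lambda>x. S (rep (h F) x) = S (F x))"
    by (rule T_mono[OF dpE_eq[OF rep_h[OF assms] assms] dpE_eq[OF 1] _ T_rep[OF assms]]) simp
  then show ?thesis unfolding N_def LA_struct.simps h_iff[OF 1] .
qed

lemma N_add:
  assumes "F \<in> DF" "G \<in> DF"
  shows "addM N (h F) (h G) = h (\<lambda>x. F x \<oplus> G x)"
proof -
  have 1: "(\<lambda>x. rep (h F) x \<oplus> rep (h G) x) \<in> DF" "(\<lambda>x. F x \<oplus> G x) \<in> DF"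
    using assms by (simp_all add: DF_ops)
  have "T (\<lambda>x. rep (h F) x \<oplus> rep (h G) x = F x \<oplus> G x)"
    by (rule T_mono[OF T_rep2(2)[OF assms] dpE_eq[OF 1] _ T_rep2(1)[OF assms]]) simp
  then show ?thesis unfolding N_def LA_struct.simps h_iff[OF 1] .
qed

lemma N_mul:
  assumes "F \<in> DF" "G \<in> DF"
  shows "mulM N (h F) (h G) = h (\<lambda>x. F x \<otimes> G x)"
proof -
  have 1: "(\<lambda>x. rep (h F) x \<otimes> rep (h G) x) \<in> DF" "(\<lambda>x. F x \<otimes> G x) \<in> DF"
    using assms by (simp_all add: DF_ops)
  have "T (\<lambda>x. rep (h F) x \<otimes> rep (h G) x = F x \<otimes> G x)"
    by (rule T_mono[OF T_rep2(2)[OF assms] dpE_eq[OF 1] _ T_rep2(1)[OF assms]]) simp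
  then show ?thesis unfolding N_def LA_struct.simps h_iff[OF 1] .
qed

lemma N_lt:
  assumes "F \<in> DF" "G \<in> DF"
  shows "ltM N (h F) (h G) \<longleftrightarrow> T (\<lambda>x. F x \<prec> G x)"
proof -
  have "T (\<lambda>x. rep (h F) x \<prec> rep (h G) x) \<longleftrightarrow> T (\<lambda>x. F x \<prec> G x)"
    by (rule T_cong_mod[OF dpE_lt dpE_lt T_rep2(2)[OF assms] T_rep2(1)[OF assms]])
      (simp_all add: assms)
  then show ?thesis unfolding N_def LA_struct.simps .
qed

lemma LA_structure_N: "LA_structure N"
  unfolding LA_structure_def N_carr N_zero
  by (auto simp: N_suc N_add N_mul intro!: imageI DF_const DF_ops)

lemma tval_N:
  assumes "\<And>k. F k \<in> DF"
  shows "(\<lambda>x. tval M (\<lambda>k. F k x) t) \<in> DF \<and> tval N (\<lambda>k. h (F k)) t = h (\<lambda>x. tval M (\<lambda>k. F k x) t)"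
  by (induction t) (simp_all add: assms N_zero DF_const N_suc N_add N_mul DF_ops)

lemma dpE_sat: "(\<And>k. F k \<in> DF) \<Longrightarrow> LA_formula p \<Longrightarrow> dpE (\<lambda>x. sat M {} (\<lambda>k. F k x) p)"
  by (rule dp_sat) (simp_all add: DF_df)

lemma dpE2_sat:
  assumes F: "\<And>j. F j \<in> DF" and p: "LA_formula p"
  shows "dpE2 (\<lambda>x v. sat M {} ((\<lambda>j. F j x)(k := v)) p)"
proof -
  define f where "f j = (if j = k then snd else (\<lambda>z. F j (fst z)))" for j
  have f: "dfM (EE \<times> K) (ext coords) (f j)" for j
  proof (cases "j = k")
    case True
    then have "f j = snd" unfolding f_def by simp
    then show ?thesis using df_snd by simp
  next
    case False
    then have "f j = (\<lambda>z. F j (fst z))" unfolding f_def by simp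
    then show ?thesis using df_weaken[OF DF_df[OF F]] by simp
  qed
  have "dpM (EE \<times> K) (ext coords) (\<lambda>z. sat M {} (\<lambda>j. f j z) p)"
    by (rule dp_sat[OF p f]) simp
  then show ?thesis
  proof (rule dp_cong)
    fix z :: "('l \<Rightarrow> 'a) \<times> 'a"
    have "(\<lambda>j. f j z) = (\<lambda>j. F j (fst z))(k := snd z)" unfolding f_def by auto
    then show "sat M {} (\<lambda>j. f j z) p \<longleftrightarrow> sat M {} ((\<lambda>j. F j (fst z))(k := snd z)) p" by simp
  qed
qed

lemma dpE_subst:
  assumes "dpE2 P" "G \<in> DF"
  shows "dpE (\<lambda>x. P x (G x))"
  by (rule dp_subst[where P = P, OF assms(1) DF_df[OF assms(2)]])

text \<open>Negation uses that \<open>T\<close> is an ultrafilter on definable predicates. In the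
  existential case the least witness is a definable function of the coordinates and hence itself an
  element of \<open>N\<close>.\<close>

lemma los:
  assumes "\<And>k. F k \<in> DF" "LA_formula p"
  shows "sat N {} (\<lambda>k. h (F k)) p \<longleftrightarrow> T (\<lambda>x. sat M {} (\<lambda>k. F k x) p)"
  using assms
proof (induction p arbitrary: F)
  case (Eq s t)
  then show ?case using tval_N[of F s] tval_N[of F t] by (simp add: h_iff)
next
  case (Less s t)
  then show ?case using tval_N[of F s] tval_N[of F t] by (simp add: N_lt)
next
  case (InI t)
  then show ?case by simp
next
  case (Neg p)
  then have p: "LA_formula p" by simp
  show ?case unfolding sat.simps T_neg[OF dpE_sat[OF Neg.prems(1) p]] Neg.IH[OF Neg.prems(1) p] ..
next
  case (Conj p q)
  then have pq: "LA_formula p" "LA_formula q" by simp_all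
  show ?case
    unfolding sat.simps Conj.IH(1)[OF Conj.prems(1) pq(1)] Conj.IH(2)[OF Conj.prems(1) pq(2)]
      T_conj[OF dpE_sat[OF Conj.prems(1) pq(1)] dpE_sat[OF Conj.prems(1) pq(2)]] ..
next
  case (Ex k p)
  then have p: "LA_formula p" by simp
  define P where "P x v \<longleftrightarrow> sat M {} ((\<lambda>j. F j x)(k := v)) p" for x v
  have P: "dpE2 P" unfolding P_def by (rule dpE2_sat[OF Ex.prems(1) p])
  have IH: "sat N {} ((\<lambda>j. h (F j))(k := h G)) p \<longleftrightarrow> T (\<lambda>x. P x (G x))" if G: "G \<in> DF" for G
  proof -
    have FG: "(F(k := G)) j \<in> DF" for j using G Ex.prems(1) by simp
    have 1: "(\<lambda>j. h (F j))(k := h G) = (\<lambda>j. h ((F(k := G)) j))" by auto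
    have 2: "(\<lambda>j. (F(k := G)) j x) = (\<lambda>j. F j x)(k := G x)" for x by auto
    show ?thesis unfolding 1 Ex.IH[OF FG p] unfolding 2 P_def ..
  qed
  have dpEx: "dpE (\<lambda>x. \<exists>v\<in>K. P x v)" by (rule dp_ex[OF P])
  have W: "(\<lambda>x. wit (P x)) \<in> DF"
    unfolding DF_def mem_Collect_eq by (rule df_wit[where P = P, OF P coords_in_K])
  have "sat N {} (\<lambda>j. h (F j)) (Ex k p) \<longleftrightarrow> (\<exists>G\<in>DF. T (\<lambda>x. P x (G x)))"
    using IH by simp
  also have "\<dots> \<longleftrightarrow> T (\<lambda>x. \<exists>v\<in>K. P x v)"
  proof
    assume "\<exists>G\<in>DF. T (\<lambda>x. P x (G x))"
    then obtain G where G: "G \<in> DF" "T (\<lambda>x. P x (G x))" by blast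
    show "T (\<lambda>x. \<exists>v\<in>K. P x v)"
    proof (rule T_mono[OF dpE_subst[OF P G(1)] dpEx _ G(2)])
      show "\<exists>v\<in>K. P x v" if "x \<in> EE" "P x (G x)" for x using that G(1) DF_carr by blast
    qed
  next
    assume T: "T (\<lambda>x. \<exists>v\<in>K. P x v)"
    have "T (\<lambda>x. P x (wit (P x)))"
    proof (rule T_mono[OF dpEx dpE_subst[OF P W] _ T])
      fix x assume x: "x \<in> EE" and "\<exists>v\<in>K. P x v"
      then obtain v where v: "v \<in> K" "P x v" by blast
      show "P x (wit (P x))"
        by (rule wit_sat[OF dp_section[where P = P, OF P coords_in_K x] v])
    qed
    then show "\<exists>G\<in>DF. T (\<lambda>x. P x (G x))" by (rule bexI[OF _ W])
  qed
  finally show ?case unfolding P_def sat.simps .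
qed

text \<open>Every axiom of PA reaches \<open>N\<close> this way, induction axioms included.\<close>

lemma N_valid:
  assumes p: "LA_formula p" and valid: "\<And>y :: nat \<Rightarrow> 'a. y \<in> envs M \<Longrightarrow> sat M {} y p"
    and e: "\<And>k. e k \<in> carr N"
  shows "sat N {} e p"
proof -
  have F: "rep (e k) \<in> DF" for k using e[of k] by simp
  have eq: "e k = h (rep (e k))" for k using e[of k] rep[of "e k"] by simp
  have "sat N {} e p \<longleftrightarrow> sat N {} (\<lambda>k. h (rep (e k))) p"
    using eq by (intro sat_cong)
  also have "\<dots> \<longleftrightarrow> T (\<lambda>x. sat M {} (\<lambda>k. rep (e k) x) p)"
    by (rule los[of "\<lambda>k. rep (e k)", OF F p])
  also have \<dots>
  proof (rule T_true[OF dpE_sat[of "\<lambda>k. rep (e k)", OF F p]])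
    fix x assume "x \<in> EE"
    then have "rep (e k) x \<in> K" for k using F by (intro DF_carr)
    then have "(\<lambda>k. rep (e k) x) \<in> envs M" unfolding envs_def by (intro CollectI allI)
    then show "sat M {} (\<lambda>k. rep (e k) x) p" by (rule valid)
  qed
  finally show ?thesis .
qed

lemma N_valid2:
  assumes "LA_formula p" "\<And>y :: nat \<Rightarrow> 'a. y \<in> envs M \<Longrightarrow> sat M {} y p" "a \<in> carr N" "b \<in> carr N"
  shows "sat N {} (\<lambda>k. if k = 0 then a else b) p"
  by (rule N_valid[of p "\<lambda>k. if k = 0 then a else b", OF assms(1,2)]) (use assms(3,4) in simp_all)

lemma model_PA_N: "model_PA N"
  unfolding model_PA_def
proof (intro conjI ballI allI impI)
  show "LA_structure N" by (rule LA_structure_N)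
  fix a assume a: "a \<in> carr N"
  show "sucM N a \<noteq> zeroM N"
    using N_valid2[of "Neg (Eq (Sc (Var 0)) Zero)", OF _ _ a a] by simp
  show "addM N a (zeroM N) = a"
    using N_valid2[of "Eq (Add (Var 0) Zero) (Var 0)", OF _ _ a a] by simp
  show "mulM N a (zeroM N) = zeroM N"
    using N_valid2[of "Eq (Mul (Var 0) Zero) Zero", OF _ _ a a] by simp
  show "\<not> ltM N a (zeroM N)"
    using N_valid2[of "Neg (Less (Var 0) Zero)", OF _ _ a a] by simp
  fix b assume b: "b \<in> carr N"
  show "addM N a (sucM N b) = sucM N (addM N a b)"
    using N_valid2[of "Eq (Add (Var 0) (Sc (Var 1))) (Sc (Add (Var 0) (Var 1)))", OF _ _ a b] by simp
  show "mulM N a (sucM N b) = addM N (mulM N a b) a"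
    using N_valid2[of "Eq (Mul (Var 0) (Sc (Var 1))) (Add (Mul (Var 0) (Var 1)) (Var 0))", OF _ _ a b]
    by simp
  show "ltM N a (sucM N b) \<longleftrightarrow> ltM N a b \<or> a = b"
    using N_valid2[of "imp (Less (Var 0) (Sc (Var 1))) (imp (Neg (Less (Var 0) (Var 1))) (Eq (Var 0) (Var 1)))",
        OF _ _ a b]
      N_valid2[of "imp (Less (Var 0) (Var 1)) (Less (Var 0) (Sc (Var 1)))", OF _ _ a b]
      N_valid2[of "imp (Eq (Var 0) (Var 1)) (Less (Var 0) (Sc (Var 1)))", OF _ _ a b] by auto
  show "a = b" if "sucM N a = sucM N b"
    using N_valid2[of "imp (Eq (Sc (Var 0)) (Sc (Var 1))) (Eq (Var 0) (Var 1))", OF _ _ a b] that by simp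
next
  fix p assume p: "LA_formula p"
  show "induction_axiom N {} p"
    unfolding induction_axiom_def
  proof (intro allI, rule impI)
    fix e :: "nat \<Rightarrow> 'b" and k assume e: "\<forall>j. e j \<in> carr N"
    have "finite (insert k (fvars p))" by simp
    then obtain m where "m \<notin> insert k (fvars p)" using ex_new_if_finite infinite_UNIV_nat by blast
    then have m: "m \<noteq> k" "m \<notin> fvars p" by auto
    have LM: "LA_structure M" using PA unfolding model_PA_def by blast
    have "sat N {} e (ind_fm k m p)"
    proof (rule N_valid)
      show "LA_formula (ind_fm k m p)" unfolding ind_fm_def using p by simp
      show "sat M {} y (ind_fm k m p)" if "y \<in> envs M" for y :: "nat \<Rightarrow> 'a"
        using PA_induction[OF p] that
        unfolding sat_ind_fm[OF LM m] induction_axiom_def envs_def by blast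
    qed (simp add: e[rule_format] del: N_carr)
    then show "sat N {} (e(k := zeroM N)) p \<longrightarrow>
        (\<forall>a\<in>carr N. sat N {} (e(k := a)) p \<longrightarrow> sat N {} (e(k := sucM N a)) p) \<longrightarrow>
        (\<forall>a\<in>carr N. sat N {} (e(k := a)) p)"
      unfolding sat_ind_fm[OF LA_structure_N m] .
  qed
qed

lemma arith_N: "arith N"
  by unfold_locales (rule model_PA_N)


section \<open>Cuts generated by initial segments of the index set\<close>

lemma ext_in_K: "\<forall>c\<in>ext coords. \<forall>z\<in>EE \<times> K. c z \<in> K"
  unfolding ext_def coords_def by (simp add: mem_Times_iff)

lemma dp_upd2:
  assumes "dpE2 P"
  shows "dpM ((EE \<times> K) \<times> K) (ext (ext coords)) (\<lambda>z. P ((fst (fst z))(l := snd z)) (snd (fst z)))"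
proof (rule dp_reindex_pair[where P = P and g = "\<lambda>z. (fst (fst z))(l := snd z)" and
      f = "\<lambda>z. snd (fst z)", OF assms])
  fix c :: "('l \<Rightarrow> 'a) \<Rightarrow> 'a" assume "c \<in> coords"
  then show "basic M K ((EE \<times> K) \<times> K) (ext (ext coords)) (\<lambda>z. c ((fst (fst z))(l := snd z)))"
    by (rule basic_coords)
      (intro basic_upd basic_snd basic_fst[OF basic_fst[OF basic_coord[OF coords_app]]])
qed (auto intro: basic_fst[OF basic_snd])

lemma dpE2_quant:
  assumes "dpE2 P"
  shows "dpE2 (\<lambda>x w. Uq (\<lambda>u. P (x(l := u)) w))"
  by (rule dp_Uq[where P = "\<lambda>z u. P ((fst z)(l := u)) (snd z)" and D = "EE \<times> K" and C = "ext coords",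
        OF dp_upd2[OF assms] ext_in_K])

text \<open>Peels off the innermost generic coordinate l; as \<open>B\<close> does not depend on it,
  \<open>B x\<close> acts as a parameter under \<open>Uq\<close>.\<close>

lemma T_top_subst:
  assumes P: "dpE2 P" and A: "finite A" "\<And>v. v \<in> K \<Longrightarrow> supp A (\<lambda>x. P x v)"
    and B: "B \<in> DF" "finite C" "supp C B" "l \<notin> C"
    and top: "\<And>s. s \<in> A \<union> C \<Longrightarrow> s \<noteq> l \<Longrightarrow> s < l"
  shows "T (\<lambda>x. P x (B x)) \<longleftrightarrow> T (\<lambda>x. Uq (\<lambda>u. P (x(l := u)) (B x)))"
proof -
  have s: "supp (A \<union> C) (\<lambda>x. P x (B x))"
  proof (rule suppI)
    fix x y assume xy: "x \<in> EE" "y \<in> EE" "\<And>k. k \<in> A \<union> C \<Longrightarrow> x k = y k"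
    have "P x (B x) = P y (B x)"
      by (rule suppD[OF A(2)[OF DF_carr[OF B(1) xy(1)]] xy(1,2)]) (use xy(3) in blast)
    moreover have "B x = B y"
      by (rule suppD[OF B(3) xy(1,2)]) (use xy(3) in blast)
    ultimately show "P x (B x) = P y (B y)" by simp
  qed
  have "T (\<lambda>x. P x (B x)) \<longleftrightarrow> T (\<lambda>x. Uq (\<lambda>u. P (x(l := u)) (B (x(l := u)))))"
    by (rule T_top[where P = "\<lambda>x. P x (B x)", OF _ s top]) (use A(1) B(2) in simp_all)
  also have "\<dots> \<longleftrightarrow> T (\<lambda>x. Uq (\<lambda>u. P (x(l := u)) (B x)))"
  proof (rule T_cong[OF dp_quant[OF dpE_subst[OF P B(1)]]])
    fix x assume x: "x \<in> EE"
    show "Uq (\<lambda>u. P (x(l := u)) (B (x(l := u)))) \<longleftrightarrow> Uq (\<lambda>u. P (x(l := u)) (B x))"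
    proof (rule Uq_cong)
      fix u assume "u \<in> K"
      then have "B (x(l := u)) = B x" using supp_upd[OF B(3,4) x] by blast
      then show "P (x(l := u)) (B (x(l := u))) \<longleftrightarrow> P (x(l := u)) (B x)" by simp
    qed
  qed
  finally show ?thesis .
qed

text \<open>For downward closed \<Lambda> these are the cuts \<open>H\<close> over which the
  extension is conservative.\<close>

definition KL :: "'l set \<Rightarrow> 'b set" where
  "KL \<Lambda> = {h F |F. F \<in> DF \<and> (\<exists>A. finite A \<and> A \<subseteq> \<Lambda> \<and> supp A F)}"

lemma KL_I: "F \<in> DF \<Longrightarrow> finite A \<Longrightarrow> A \<subseteq> \<Lambda> \<Longrightarrow> supp A F \<Longrightarrow> h F \<in> KL \<Lambda>"
  unfolding KL_def by blast

lemma KL_E: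
  assumes "b \<in> KL \<Lambda>"
  obtains F A where "b = h F" "F \<in> DF" "finite A" "A \<subseteq> \<Lambda>" "supp A F"
  using assms unfolding KL_def by blast

lemma KL_carr: "KL \<Lambda> \<subseteq> carr N"
  unfolding KL_def by auto

lemma df_slice:
  assumes G: "G \<in> DF" and x: "x \<in> EE"
  shows "dfM K {\<lambda>x. x} (\<lambda>u. G (x(l := u)))"
  unfolding df_def
proof
  show "\<forall>u\<in>K. G (x(l := u)) \<in> K" using G x by (simp add: DF_carr)
  have "dpE2 (\<lambda>y v. G y = v)"
    using DF_df[OF G] unfolding df_def by blast
  then show "dpM (K \<times> K) (ext {\<lambda>x. x}) (\<lambda>z. G (x(l := fst z)) = snd z)"
  proof (rule dp_reindex_pair[where P = "\<lambda>y v. G y = v" and g = "\<lambda>z. x(l := fst z)" and f = snd])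
    fix c :: "('l \<Rightarrow> 'a) \<Rightarrow> 'a" assume "c \<in> coords"
    then show "basic M K (K \<times> K) (ext {\<lambda>x. x}) (\<lambda>z. c (x(l := fst z)))"
      by (rule basic_coords) (intro basic_upd basic_const envs_app[OF x]
          basic_fst[of M K K "{\<lambda>x. x}" "\<lambda>x. x"] basic_coord singletonI)
  qed (auto intro: basic_snd simp: x)
qed

text \<open>Along the largest coordinate l the values of \<open>G\<close> stay below a value of
  \<open>F\<close> that does not move with l, so they are constant almost everywhere. That constant,
  found by \<open>wit\<close>, is a definable function of the remaining coordinates.\<close>

lemma reduce_bounded:
  assumes G: "G \<in> DF" "finite A" "supp A G" "\<And>s. s \<in> A \<Longrightarrow> s \<noteq> l \<Longrightarrow> s < l"
    and F: "F \<in> DF" "finite C" "supp C F" "\<And>s. s \<in> C \<Longrightarrow> s < l"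
    and lt: "T (\<lambda>x. G x \<prec> F x)"
  shows "\<exists>G'\<in>DF. supp (A - {l}) G' \<and> h G = h G'"
proof -
  define P where "P x w \<longleftrightarrow> G x = w" for x w
  have P: "dpE2 P"
    using DF_df[OF G(1)] unfolding P_def df_def by blast
  have P': "dpE2 (\<lambda>x w. G x \<prec> w)"
    by (rule dp_lt[OF df_weaken[OF DF_df[OF G(1)]] df_snd])
  define Q where "Q x w \<longleftrightarrow> Uq (\<lambda>u. P (x(l := u)) w)" for x w
  have Q: "dpE2 Q" unfolding Q_def by (rule dpE2_quant[OF P])
  define G' where "G' x = wit (Q x)" for x
  have G': "G' \<in> DF"
    unfolding G'_def DF_def mem_Collect_eq by (rule df_wit[where P = Q, OF Q coords_in_K])
  have sG': "supp (A - {l}) G'"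
  proof (rule suppI)
    fix x y assume xy: "x \<in> EE" "y \<in> EE" "\<And>k. k \<in> A - {l} \<Longrightarrow> x k = y k"
    have "G (x(l := u)) = G (y(l := u))" if "u \<in> K" for u
      by (rule suppD[OF G(3), of "x(l := u)" "y(l := u)"]) (use xy that in auto)
    then have "Q x w \<longleftrightarrow> Q y w" for w
      unfolding Q_def P_def by (intro Uq_cong) simp
    then show "G' x = G' y" unfolding G'_def by (intro wit_cong)
  qed
  have lC: "l \<notin> C" "l \<notin> A - {l}" using F(4) by auto
  have "T (\<lambda>x. Uq (\<lambda>u. G (x(l := u)) \<prec> F x))"
  proof (rule T_top_subst[where P = "\<lambda>x w. G x \<prec> w" and B = F, OF P' G(2) _ F(1,2,3) lC(1), THEN iffD1, OF _ _ lt])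
    show "supp A (\<lambda>x. G x \<prec> v)" for v using G(3) unfolding supp_def by metis
    show "s < l" if "s \<in> A \<union> C" "s \<noteq> l" for s using that G(4) F(4) by blast
  qed
  then have "T (\<lambda>x. Q x (G' x))"
  proof (rule T_mono[rotated -1])
    show "dpE (\<lambda>x. Uq (\<lambda>u. G (x(l := u)) \<prec> F x))"
      by (rule dpE_subst[where P = "\<lambda>x w. Uq (\<lambda>u. G (x(l := u)) \<prec> w)", OF dpE2_quant[OF P'] F(1)])
    show "dpE (\<lambda>x. Q x (G' x))" by (rule dpE_subst[OF Q G'])
    fix x assume x: "x \<in> EE" and "Uq (\<lambda>u. G (x(l := u)) \<prec> F x)"
    then obtain w where "w \<in> K" "Uq (\<lambda>u. G (x(l := u)) = w)"
      using Uq_bounded_imp_constant[OF df_slice[OF G(1) x] DF_carr[OF F(1) x]] by blast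
    then show "Q x (G' x)"
      unfolding G'_def by (intro wit_sat[OF dp_section[where P = Q, OF Q coords_in_K x]]) (simp_all add: Q_def P_def)
  qed
  then have "T (\<lambda>x. P x (G' x))"
    unfolding Q_def
  proof (rule T_top_subst[where P = P and B = G', OF P G(2) _ G' _ sG' lC(2), THEN iffD2, rotated -1])
    show "supp A (\<lambda>x. P x v)" for v using G(3) unfolding P_def supp_def by metis
    show "finite (A - {l})" using G(2) by simp
    show "s < l" if "s \<in> A \<union> (A - {l})" "s \<noteq> l" for s using that G(4) by blast
  qed
  then have "h G = h G'" unfolding P_def h_iff[OF G(1) G'] .
  with G' sG' show ?thesis by blast
qed

text \<open>Indices outside \<Lambda> lie above all of \<Lambda>. The largest of them is thus the
  top coordinate, and \<open>reduce_bounded\<close> removes these indices one at a time.\<close>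

lemma KL_initial:
  assumes down: "\<forall>l\<in>\<Lambda>. \<forall>l'\<le>l. l' \<in> \<Lambda>"
    and a: "a \<in> KL \<Lambda>" and b: "b \<in> carr N" "ltM N b a"
  shows "b \<in> KL \<Lambda>"
proof -
  obtain F C where F: "a = h F" "F \<in> DF" "finite C" "C \<subseteq> \<Lambda>" "supp C F" using a by (rule KL_E)
  obtain G where G: "b = h G" "G \<in> DF" using b(1) by auto
  obtain A where A: "finite A" "supp A G" by (rule df_finite_supp[OF DF_df[OF G(2)]]) (rule that)
  have "h G \<in> KL \<Lambda>" if "G \<in> DF" "finite A" "supp A G" "T (\<lambda>x. G x \<prec> F x)" for G A
    using that
  proof (induction "card (A - \<Lambda>)" arbitrary: A G rule: less_induct)
    case less
    show ?case
    proof (cases "A \<subseteq> \<Lambda>")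
      case True
      with less.prems show ?thesis by (intro KL_I)
    next
      case False
      define l where "l = Max (A - \<Lambda>)"
      have ne: "finite (A - \<Lambda>)" "A - \<Lambda> \<noteq> {}" using False less.prems(2) by auto
      have l: "l \<in> A" "l \<notin> \<Lambda>" using Max_in[OF ne] unfolding l_def by auto
      have below: "s < l" if "s \<in> \<Lambda>" for s using down[rule_format, OF that, of l] l(2) by force
      have top: "s < l" if "s \<in> A" "s \<noteq> l" for s
      proof (cases "s \<in> \<Lambda>")
        case False
        then have "s \<le> l" unfolding l_def using ne(1) that(1) by (intro Max_ge) auto
        with that(2) show ?thesis by simp
      qed (rule below)
      have "\<exists>G'\<in>DF. supp (A - {l}) G' \<and> h G = h G'"
        by (rule reduce_bounded[OF less.prems(1,2,3) top F(2,3,5) _ less.prems(4)])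
          (use below F(4) in auto)
      then obtain G' where G': "G' \<in> DF" "supp (A - {l}) G'" "h G = h G'" by blast
      have "T (\<lambda>x. G' x \<prec> F x)"
        using less.prems(4) G'(3) N_lt[OF less.prems(1) F(2)] N_lt[OF G'(1) F(2)] by simp
      moreover have "card ((A - {l}) - \<Lambda>) < card (A - \<Lambda>)"
        using l ne(1) by (intro psubset_card_mono) auto
      ultimately show ?thesis
        using less.hyps[of "A - {l}" G'] G' less.prems(2) by simp
    qed
  qed
  from this[OF G(2) A] show ?thesis using b(2) unfolding G(1) F(1) N_lt[OF G(2) F(2)] .
qed

definition cst :: "'l \<Rightarrow> 'b" where
  "cst l = h (\<lambda>x. x l)"

lemma cst_carr: "cst l \<in> carr N"
  unfolding cst_def using DF_coord by simp

text \<open>All final segments belong to the filter, so a generic element exceeds everything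
  generated by smaller indices.\<close>

lemma below_cst:
  assumes F: "F \<in> DF" "finite A" "supp A F" "\<And>s. s \<in> A \<Longrightarrow> s < l"
  shows "ltM N (h F) (cst l)"
proof -
  have s: "supp (insert l A) (\<lambda>x. F x \<prec> x l)"
  proof (rule suppI)
    fix x y assume xy: "x \<in> EE" "y \<in> EE" "\<And>k. k \<in> insert l A \<Longrightarrow> x k = y k"
    have "F x = F y" by (rule suppD[OF F(3) xy(1,2)]) (use xy(3) in blast)
    then show "(F x \<prec> x l) = (F y \<prec> y l)" using xy(3)[of l] by simp
  qed
  have lA: "l \<notin> A" using F(4) by blast
  have d: "dpE (\<lambda>x. F x \<prec> x l)" by (rule dpE_lt[OF F(1) DF_coord])
  have "T (\<lambda>x. F x \<prec> x l) \<longleftrightarrow> T (\<lambda>x. Uq (\<lambda>v. F (x(l := v)) \<prec> (x(l := v)) l))"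
    by (rule T_top[where P = "\<lambda>x. F x \<prec> x l", OF _ s]) (use F(2,4) in auto)
  moreover have "T (\<lambda>x. Uq (\<lambda>v. F (x(l := v)) \<prec> (x(l := v)) l))"
  proof (rule T_true[OF dp_quant[where P = "\<lambda>x. F x \<prec> x l", OF d]])
    fix x assume x: "x \<in> EE"
    show "Uq (\<lambda>v. F (x(l := v)) \<prec> (x(l := v)) l)"
    proof (rule Uq_mono[OF Uq_gt[OF DF_carr[OF F(1) x]]])
      fix v assume "v \<in> K" "F x \<prec> v"
      then show "F (x(l := v)) \<prec> (x(l := v)) l" using supp_upd[OF F(3) lA x] by simp
    qed
  qed
  ultimately show ?thesis unfolding cst_def N_lt[OF F(1) DF_coord] by blast
qed

lemma cst_less: "l < l' \<Longrightarrow> ltM N (cst l) (cst l')"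
  unfolding cst_def[of l] by (rule below_cst[OF DF_coord, of "{l}"]) (auto simp: supp_def)

lemma carr_below_cst:
  assumes "b \<in> carr N"
  obtains A where "finite A" "\<forall>l. (\<forall>s\<in>A. s < l) \<longrightarrow> ltM N b (cst l)"
proof -
  obtain F where F: "b = h F" "F \<in> DF" using assms by auto
  obtain A where A: "finite A" "supp A F" by (rule df_finite_supp[OF DF_df[OF F(2)]]) (rule that)
  show thesis by (rule that[OF A(1)]) (use below_cst[OF F(2) A] F(1) in simp)
qed

lemma los_upd:
  assumes D: "\<And>k. D k \<in> DF" and B: "B \<in> DF" and q: "LA_formula q"
  shows "sat N {} ((\<lambda>k. h (D k))(0 := h B)) q \<longleftrightarrow> T (\<lambda>x. sat M {} ((\<lambda>k. D k x)(0 := B x)) q)"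
proof -
  have DB: "(D(0 := B)) j \<in> DF" for j using D B by simp
  have 1: "(\<lambda>j. h (D j))(0 := h B) = (\<lambda>j. h ((D(0 := B)) j))" by auto
  have 2: "(\<lambda>j. (D(0 := B)) j x) = (\<lambda>j. D j x)(0 := B x)" for x by auto
  show ?thesis unfolding 1 los[of "D(0 := B)", OF DB q] unfolding 2 ..
qed

text \<open>An element \<open>B\<close> generated from \<Lambda> does not depend on the coordinates
  above \<Lambda>, so these can be quantified away by \<open>Uq\<close>, from the top downwards,
  without losing definability. \<open>P'\<close> is found before \<open>B\<close> is given.\<close>

lemma reduce_support:
  assumes down: "\<forall>l\<in>\<Lambda>. \<forall>l'\<le>l. l' \<in> \<Lambda>"
    and "dpE2 P" "finite A" "\<forall>v\<in>K. supp A (\<lambda>x. P x v)"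
  shows "\<exists>P' A'. dpE2 P' \<and> finite A' \<and> A' \<subseteq> \<Lambda> \<and> (\<forall>v\<in>K. supp A' (\<lambda>x. P' x v)) \<and>
    (\<forall>B C. B \<in> DF \<longrightarrow> finite C \<longrightarrow> C \<subseteq> \<Lambda> \<longrightarrow> supp C B \<longrightarrow> (T (\<lambda>x. P x (B x)) \<longleftrightarrow> T (\<lambda>x. P' x (B x))))"
  using assms(2-)
proof (induction "card (A - \<Lambda>)" arbitrary: A P rule: less_induct)
  case less
  show ?case
  proof (cases "A \<subseteq> \<Lambda>")
    case True
    with less.prems show ?thesis by blast
  next
    case False
    define l where "l = Max (A - \<Lambda>)"
    have ne: "finite (A - \<Lambda>)" "A - \<Lambda> \<noteq> {}" using False less.prems(2) by auto
    have l: "l \<in> A" "l \<notin> \<Lambda>" using Max_in[OF ne] unfolding l_def by auto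
    have below: "s < l" if "s \<in> \<Lambda>" for s using down[rule_format, OF that, of l] l(2) by force
    have top: "s < l" if "s \<in> A" "s \<noteq> l" for s
    proof (cases "s \<in> \<Lambda>")
      case False
      then have "s \<le> l" unfolding l_def using ne(1) that(1) by (intro Max_ge) auto
      with that(2) show ?thesis by simp
    qed (rule below)
    define Q where "Q x w \<longleftrightarrow> Uq (\<lambda>u. P (x(l := u)) w)" for x w
    have Q: "dpE2 Q" unfolding Q_def by (rule dpE2_quant[OF less.prems(1)])
    have sQ: "supp (A - {l}) (\<lambda>x. Q x w)" if "w \<in> K" for w
    proof (rule suppI)
      fix x y assume xy: "x \<in> EE" "y \<in> EE" "\<And>k. k \<in> A - {l} \<Longrightarrow> x k = y k"
      have "P (x(l := u)) w = P (y(l := u)) w" if "u \<in> K" for u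
        by (rule suppD[OF less.prems(3)[rule_format, OF \<open>w \<in> K\<close>], of "x(l := u)" "y(l := u)"]) (use xy that in auto)
      then show "Q x w = Q y w" unfolding Q_def by (intro Uq_cong)
    qed
    have TQ: "T (\<lambda>x. P x (B x)) \<longleftrightarrow> T (\<lambda>x. Q x (B x))"
      if B: "B \<in> DF" "finite C" "C \<subseteq> \<Lambda>" "supp C B" for B C
      unfolding Q_def
    proof (rule T_top_subst[where P = P and B = B, OF less.prems(1,2) less.prems(3)[rule_format] B(1,2,4)])
      show "l \<notin> C" using l(2) B(3) by blast
      show "s < l" if "s \<in> A \<union> C" "s \<noteq> l" for s using that top below B(3) by blast
    qed
    have "card ((A - {l}) - \<Lambda>) < card (A - \<Lambda>)"
      using l ne(1) by (intro psubset_card_mono) auto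
    from less.hyps[OF this Q] sQ less.prems(2) obtain P' A' where
      P': "dpE2 P'" "finite A'" "A' \<subseteq> \<Lambda>" "\<forall>v\<in>K. supp A' (\<lambda>x. P' x v)"
      and TP': "\<forall>B C. B \<in> DF \<longrightarrow> finite C \<longrightarrow> C \<subseteq> \<Lambda> \<longrightarrow> supp C B \<longrightarrow>
        (T (\<lambda>x. Q x (B x)) \<longleftrightarrow> T (\<lambda>x. P' x (B x)))" by auto
    show ?thesis
      by (intro exI[of _ P'] exI[of _ A'] conjI P' allI impI) (use TQ TP' in simp)
  qed
qed

lemma conservative:
  assumes down: "\<forall>l\<in>\<Lambda>. \<forall>l'\<le>l. l' \<in> \<Lambda>"
    and q: "LA_formula q" and D: "\<And>k. D k \<in> DF"
  shows "\<exists>R. dp N (KL \<Lambda>) (carr N) {\<lambda>x. x} R \<and>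
    (\<forall>b\<in>KL \<Lambda>. sat N {} ((\<lambda>k. h (D k))(0 := b)) q \<longleftrightarrow> R b)"
proof -
  define P where "P x v \<longleftrightarrow> sat M {} ((\<lambda>k. D k x)(0 := v)) q" for x v
  have P: "dpE2 P" unfolding P_def by (rule dpE2_sat[OF D q])
  obtain A where A: "finite A" "\<forall>v\<in>K. supp A (\<lambda>x. P x v)"
    by (rule dp_finite_supp2[where P = P, OF P]) (use that in blast)
  from reduce_support[OF down P A] obtain P' A' where
    P': "dpE2 P'" "finite A'" "A' \<subseteq> \<Lambda>" "\<forall>v\<in>K. supp A' (\<lambda>x. P' x v)"
    and TP': "\<forall>B C. B \<in> DF \<longrightarrow> finite C \<longrightarrow> C \<subseteq> \<Lambda> \<longrightarrow> supp C B \<longrightarrow>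
      (T (\<lambda>x. P x (B x)) \<longleftrightarrow> T (\<lambda>x. P' x (B x)))" by blast
  obtain r and \<delta> :: "nat \<Rightarrow> ('l \<Rightarrow> 'a) \<Rightarrow> 'a" where r: "LA_formula r" "\<And>k. \<delta> k \<in> coords \<union> pconsts M K"
    and P'r: "\<And>x v. x \<in> EE \<Longrightarrow> v \<in> K \<Longrightarrow>
      P' (fst (x, v)) (snd (x, v)) \<longleftrightarrow> sat M {} ((\<lambda>k. \<delta> k x)(0 := v)) r"
    by (rule dp_normal_form[OF P'(1)]) (rule that)
  \<comment> \<open>The formula for \<open>P'\<close> may still mention coordinates outside
    \<Lambda>. Setting them to zero does not change \<open>P'\<close>, whose support lies in
    \<Lambda>, and turns all parameters into elements of \<open>KL \<Lambda>\<close>.\<close>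
  define \<rho> :: "('l \<Rightarrow> 'a) \<Rightarrow> 'l \<Rightarrow> 'a" where "\<rho> x = (\<lambda>l. if l \<in> \<Lambda> then x l else Z)" for x
  define \<delta>' where "\<delta>' k x = \<delta> k (\<rho> x)" for k x
  have \<rho>: "\<rho> x \<in> EE" if "x \<in> EE" for x using that unfolding \<rho>_def envs_def by simp
  have \<delta>': "\<delta>' k \<in> DF \<and> (\<exists>A. finite A \<and> A \<subseteq> \<Lambda> \<and> supp A (\<delta>' k))" for k
    using r(2)[of k]
  proof
    assume "\<delta> k \<in> coords"
    then obtain j where j: "\<delta> k = (\<lambda>y. y j)" by (rule coords_cases)
    show ?thesis
    proof (cases "j \<in> \<Lambda>")
      case True
      then have "\<delta>' k = (\<lambda>x. x j)" unfolding \<delta>'_def j \<rho>_def by simp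
      with True DF_coord show ?thesis by (auto intro!: exI[of _ "{j}"] simp: supp_def)
    next
      case False
      then have "\<delta>' k = (\<lambda>x. Z)" unfolding \<delta>'_def j \<rho>_def by simp
      with DF_const[OF carr_closed(1)] show ?thesis by (auto intro!: exI[of _ "{}"] simp: supp_def)
    qed
  next
    assume "\<delta> k \<in> pconsts M K"
    then obtain a where a: "a \<in> insert Z K" "\<delta> k = (\<lambda>_. a)" unfolding pconsts_def by blast
    have "a \<in> K" using a(1) by auto
    moreover have "\<delta>' k = (\<lambda>_. a)" unfolding \<delta>'_def a(2) ..
    ultimately show ?thesis using DF_const[of a] by (auto intro!: exI[of _ "{}"] simp: supp_def)
  qed
  define R where "R b \<longleftrightarrow> sat N {} ((\<lambda>k. h (\<delta>' k))(0 := b)) r" for b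
  have dpR: "dp N (KL \<Lambda>) (carr N) {\<lambda>x. x} R"
  proof (rule dpI_basic[OF r(1), where f = "\<lambda>k. if k = 0 then (\<lambda>x. x) else (\<lambda>_. h (\<delta>' k))"])
    have "h (\<delta>' k) \<in> KL \<Lambda>" for k using \<delta>'[of k] KL_I by blast
    then show "basic N (KL \<Lambda>) (carr N) {\<lambda>x. x} (if k = 0 then (\<lambda>x. x) else (\<lambda>_. h (\<delta>' k)))" for k
      by (simp add: basic_coord basic_const)
    show "R b \<longleftrightarrow> sat N {} (\<lambda>k. (if k = 0 then (\<lambda>x. x) else (\<lambda>_. h (\<delta>' k))) b) r" for b
      unfolding R_def by (rule sat_cong) simp
  qed
  have "sat N {} ((\<lambda>k. h (D k))(0 := b)) q \<longleftrightarrow> R b" if "b \<in> KL \<Lambda>" for b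
  proof -
    obtain B C where B: "b = h B" "B \<in> DF" "finite C" "C \<subseteq> \<Lambda>" "supp C B" using \<open>b \<in> KL \<Lambda>\<close> by (rule KL_E)
    have \<delta>'DF: "\<delta>' k \<in> DF" for k using \<delta>'[of k] by blast
    have "sat N {} ((\<lambda>k. h (D k))(0 := b)) q \<longleftrightarrow> T (\<lambda>x. P x (B x))"
      unfolding B(1) P_def by (rule los_upd[OF D B(2) q])
    also have "\<dots> \<longleftrightarrow> T (\<lambda>x. P' x (B x))" using TP' B(2-5) by blast
    also have "\<dots> \<longleftrightarrow> T (\<lambda>x. sat M {} ((\<lambda>k. \<delta>' k x)(0 := B x)) r)"
    proof (rule T_cong[OF dpE_subst[OF P'(1) B(2)]])
      fix x assume x: "x \<in> EE"
      have BK: "B x \<in> K" by (rule DF_carr[OF B(2) x])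
      have "P' x (B x) = P' (\<rho> x) (B x)"
        by (rule suppD[OF P'(4)[rule_format, OF BK] x \<rho>[OF x]]) (use P'(3) in \<open>auto simp: \<rho>_def\<close>)
      also have "\<dots> \<longleftrightarrow> sat M {} ((\<lambda>k. \<delta>' k x)(0 := B x)) r"
        unfolding \<delta>'_def using P'r[OF \<rho>[OF x] BK] by simp
      finally show "P' x (B x) \<longleftrightarrow> sat M {} ((\<lambda>k. \<delta>' k x)(0 := B x)) r" .
    qed
    also have "\<dots> \<longleftrightarrow> R b"
      unfolding R_def B(1) by (rule los_upd[OF \<delta>'DF B(2) r(1), symmetric])
    finally show ?thesis .
  qed
  with dpR show ?thesis by blast
qed


lemma elementary_end_extension: "elementary_end_extension_via (\<lambda>m. h (\<lambda>_. m)) M N"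
  unfolding elementary_end_extension_via_def elementary_embedding_def
proof (intro conjI allI impI ballI)
  show "LA_structure N" by (rule LA_structure_N)
  show "(\<lambda>m. h (\<lambda>_. m)) ` K \<subseteq> carr N" using DF_const by auto
  fix p and e :: "nat \<Rightarrow> 'a" assume p: "LA_formula p" and e: "\<forall>k. e k \<in> K"
  have "sat N {} (\<lambda>k. h (\<lambda>_. e k)) p \<longleftrightarrow> T (\<lambda>x :: 'l \<Rightarrow> 'a. sat M {} e p)"
    by (rule los[of "\<lambda>k _. e k", OF DF_const p]) (simp add: e)
  then show "sat M {} e p \<longleftrightarrow> sat N {} ((\<lambda>m. h (\<lambda>_. m)) \<circ> e) p" by (simp add: o_def)
next
  fix a b assume a: "a \<in> K" and b: "b \<in> carr N" "ltM N b (h (\<lambda>_. a))"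
  \<comment> \<open>The cut for the empty index set is the image of \<open>M\<close>: a function
    with empty support is constant, with its value at the zero assignment.\<close>
  have "h (\<lambda>_. a) \<in> KL {}" by (rule KL_I[OF DF_const[OF a]]) (auto simp: supp_def)
  from KL_initial[OF _ this b] obtain F where F: "b = h F" "F \<in> DF" "supp {} F"
    unfolding KL_def by auto
  have c: "F (\<lambda>_. Z) \<in> K" by (rule DF_carr[OF F(2) zero_env])
  have "T (\<lambda>x. F x = F (\<lambda>_. Z))"
    by (rule T_true[OF dpE_eq[OF F(2) DF_const[OF c]]]) (rule suppD[OF F(3)], simp_all)
  then have "h F = h (\<lambda>_. F (\<lambda>_. Z))" unfolding h_iff[OF F(2) DF_const[OF c]] .
  then show "b \<in> (\<lambda>m. h (\<lambda>_. m)) ` K" unfolding F(1) using c by simp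
qed

lemma order_indiscernibles_cst: "order_indiscernibles N (range cst)"
  unfolding order_indiscernibles_def
proof (intro allI impI)
  interpret N: arith N by (rule arith_N)
  fix p n and x y :: "nat \<Rightarrow> 'b"
  assume p: "LA_formula p" "fvars p \<subseteq> {..<n}" and xy: "\<forall>i<n. x i \<in> range cst \<and> y i \<in> range cst"
    and less: "\<forall>j<n. \<forall>i<j. ltM N (x i) (x j) \<and> ltM N (y i) (y j)"
  \<comment> \<open>The right-hand side does not mention x, so any two increasing tuples agree on
    p.\<close>
  have *: "sat N {} x p \<longleftrightarrow> TL [0..<n] (\<lambda>y. sat M {} y p) (\<lambda>_. Z)"
    if x: "\<forall>i<n. x i \<in> range cst" and less: "\<forall>j<n. \<forall>i<j. ltM N (x i) (x j)" for x
  proof -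
    have "\<forall>i. \<exists>l. i < n \<longrightarrow> x i = cst l" using x by blast
    then obtain l where l: "\<And>i. i < n \<Longrightarrow> x i = cst (l i)" by metis
    have mono: "l i < l j" if "i < j" "j < n" for i j
    proof (rule ccontr)
      assume "\<not> l i < l j"
      then have "l i = l j \<or> l j < l i" by auto
      moreover have "ltM N (x i) (x j)" using less that by blast
      then have "ltM N (cst (l i)) (cst (l j))" using that l[of i] l[of j] by simp
      ultimately show False
        using N.lt_irrefl[OF cst_carr] N.lt_asym[OF _ _ cst_carr cst_carr] cst_less by metis
    qed
    have inj: "inj_on l {..<n}"
      by (rule inj_onI) (metis lessThan_iff linorder_neqE_nat mono order_less_irrefl)
    define emb :: "('l \<Rightarrow> 'a) \<Rightarrow> nat \<Rightarrow> 'a" where "emb z = (\<lambda>k. if k < n then z (l k) else Z)" for z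
    define F :: "nat \<Rightarrow> ('l \<Rightarrow> 'a) \<Rightarrow> 'a" where "F k = (if k < n then (\<lambda>z. z (l k)) else (\<lambda>_. Z))" for k
    have F: "F k \<in> DF" for k unfolding F_def using DF_coord DF_const[OF carr_closed(1)] by simp
    have Fe: "(\<lambda>k. F k z) = emb z" for z unfolding F_def emb_def by auto
    have "sat N {} x p \<longleftrightarrow> sat N {} (\<lambda>k. h (F k)) p"
    proof (rule sat_cong)
      fix k assume "k \<in> fvars p"
      then have "k < n" using p(2) by blast
      then show "x k = h (F k)" using l unfolding F_def cst_def by simp
    qed
    also have "\<dots> \<longleftrightarrow> T (\<lambda>z. sat M {} (emb z) p)"
      unfolding los[of F, OF F p(1)] Fe ..
    also have "\<dots> \<longleftrightarrow> TL (sorted_list_of_set (l ` {..<n})) (\<lambda>z. sat M {} (emb z) p) (\<lambda>_. Z)"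
    proof (rule T_eq)
      show "supp (l ` {..<n}) (\<lambda>z. sat M {} (emb z) p)"
      proof (rule suppI)
        fix z z' :: "'l \<Rightarrow> 'a" assume "\<And>k. k \<in> l ` {..<n} \<Longrightarrow> z k = z' k"
        then have "emb z = emb z'" unfolding emb_def by auto
        then show "sat M {} (emb z) p = sat M {} (emb z') p" by simp
      qed
    qed simp_all
    also have "sorted_list_of_set (l ` {..<n}) = map l [0..<n]"
    proof (rule sorted_distinct_set_unique)
      show "sorted (map l [0..<n])"
        unfolding sorted_iff_nth_mono_less by (auto intro: less_imp_le mono)
      show "distinct (map l [0..<n])" using inj by (simp add: distinct_map atLeast0LessThan)
    qed (simp_all add: atLeast0LessThan)
    also have "TL (map l [0..<n]) (\<lambda>z. sat M {} (emb z) p) (\<lambda>_. Z) \<longleftrightarrow>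
        TL [0..<n] (\<lambda>y. sat M {} y p) (emb (\<lambda>_. Z))"
      unfolding emb_def by (rule TL_map[OF _ inj, where Q = "\<lambda>y. sat M {} y p"]) auto
    also have "emb (\<lambda>_. Z) = (\<lambda>_. Z)" unfolding emb_def by simp
    finally show ?thesis .
  qed
  show "sat N {} x p \<longleftrightarrow> sat N {} y p"
    using *[of x] *[of y] xy less by simp
qed

text \<open>Strict bounds for countable sets of indices give unboundedness of the indiscernibles,
  uncountability of \<open>N\<close> and an element above the cut of countable cofinality.\<close>

context
  assumes cof: "\<And>C :: 'l set. countable C \<Longrightarrow> \<exists>u. \<forall>c\<in>C. c < u"
begin

lemma carr_below_some_cst:
  assumes "b \<in> carr N"
  shows "\<exists>u > l. ltM N b (cst u)"
proof -
  obtain A where A: "finite A" "\<forall>l. (\<forall>s\<in>A. s < l) \<longrightarrow> ltM N b (cst l)"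
    by (rule carr_below_cst[OF assms]) (rule that)
  have "countable (insert l A)" using A(1) by (simp add: countable_finite)
  from cof[OF this] obtain u where "\<forall>c\<in>insert l A. c < u" by blast
  with A(2) show ?thesis by auto
qed

lemma model_PAI_minus_N: "model_PAI_minus N (range cst)"
  unfolding model_PAI_minus_def unbounded_in_def
  using model_PA_N cst_carr order_indiscernibles_cst carr_below_some_cst by blast

lemma uncountable_carr_N: "uncountable (carr N)"
proof
  interpret N: arith N by (rule arith_N)
  assume "countable (carr N)"
  moreover have "range cst \<subseteq> carr N" using cst_carr by blast
  ultimately have "countable (range cst)" by (rule countable_subset[rotated])
  moreover have "inj cst"
  proof (rule injI)
    fix l l' assume eq: "cst l = cst l'"
    show "l = l'"
      using cst_less[of l l'] cst_less[of l' l] N.lt_irrefl[OF cst_carr] unfolding eq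
      by (metis linorder_neqE)
  qed
  ultimately have "countable (UNIV :: 'l set)" using countable_image_inj_on by blast
  from cof[OF this] show False by blast
qed

lemma no_model_PAI0: "\<not> model_PAI0 N J"
proof
  interpret N: arith N by (rule arith_N)
  assume "model_PAI0 N J"
  then have JN: "J \<subseteq> carr N" and J: "order_indiscernibles N J" "unbounded_in N J"
    and ind: "\<And>p. Delta0_I p \<Longrightarrow> induction_axiom N J p"
    unfolding model_PAI0_def model_PAI_minus_def by blast+
  \<comment> \<open>The interleaving: a member of \<open>J\<close> between any two consecutive
    chosen indiscernibles.\<close>
  have "\<exists>L. \<forall>n. True \<and> (L n < L (Suc n) \<and> (\<exists>j\<in>J. ltM N (cst (L n)) j \<and> ltM N j (cst (L (Suc n)))))"
  proof (rule dependent_nat_choice)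
    fix l :: 'l and n :: nat
    obtain j where j: "j \<in> J" "ltM N (cst l) j"
      using J(2) cst_carr unfolding unbounded_in_def by blast
    have "j \<in> carr N" using j(1) JN by blast
    from carr_below_some_cst[OF this] j
    show "\<exists>u. True \<and> (l < u \<and> (\<exists>j\<in>J. ltM N (cst l) j \<and> ltM N j (cst u)))" by blast
  qed simp
  then obtain L where L: "\<And>n. L n < L (Suc n)"
    and "\<And>n. \<exists>j\<in>J. ltM N (cst (L n)) j \<and> ltM N j (cst (L (Suc n)))" by blast
  then obtain j where j: "\<And>n. j n \<in> J" "\<And>n. ltM N (cst (L n)) (j n)" "\<And>n. ltM N (j n) (cst (L (Suc n)))"
    by metis
  have jN: "j n \<in> carr N" for n using j(1) JN by blast
  have smono: "strict_mono L" using L by (rule strict_mono_Suc_iff[THEN iffD2, rule_format])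
  define \<Lambda> where "\<Lambda> = {l. \<exists>n. l \<le> L n}"
  have down: "\<forall>l\<in>\<Lambda>. \<forall>l'\<le>l. l' \<in> \<Lambda>" unfolding \<Lambda>_def using order_trans by blast
  have L\<Lambda>: "L n \<in> \<Lambda>" for n unfolding \<Lambda>_def by blast
  \<comment> \<open>\<open>cst u\<close> lies above the whole cut \<open>KL \<Lambda>\<close>, so
    coding \<open>J\<close> below \<open>cst u\<close> captures its trace on the cut.\<close>
  have "countable (range L)" by simp
  from cof[OF this] obtain u where u: "\<And>n. L n < u" by blast
  have below_u: "ltM N b (cst u)" if "b \<in> KL \<Lambda>" for b
  proof -
    obtain F A where F: "b = h F" "F \<in> DF" "finite A" "A \<subseteq> \<Lambda>" "supp A F" using \<open>b \<in> KL \<Lambda>\<close> by (rule KL_E)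
    have "s < u" if "s \<in> A" for s
    proof -
      obtain n where "s \<le> L n" using \<open>s \<in> A\<close> F(4) unfolding \<Lambda>_def by blast
      then show ?thesis using u[of n] by (rule order_le_less_trans)
    qed
    with below_cst[OF F(2,3,5)] show ?thesis unfolding F(1) by blast
  qed
  have bound: "\<exists>n. \<forall>s\<in>A. s < L n" if "finite A" "A \<subseteq> \<Lambda>" for A
    using that
  proof (induction A rule: finite_induct)
    case (insert a A)
    then obtain n where n: "\<forall>s\<in>A. s < L n" by auto
    obtain m where m: "a \<le> L m" using insert.prems unfolding \<Lambda>_def by auto
    have "L n \<le> L (max n (Suc m))" "L m < L (max n (Suc m))"
      using smono by (simp_all add: strict_mono_less_eq strict_mono_less)
    with n m have "\<forall>s\<in>insert a A. s < L (max n (Suc m))" by auto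
    then show ?case by blast
  qed simp
  have below_L: "\<exists>n. ltM N b (cst (L n))" if "b \<in> KL \<Lambda>" for b
  proof -
    obtain F A where F: "b = h F" "F \<in> DF" "finite A" "A \<subseteq> \<Lambda>" "supp A F" using \<open>b \<in> KL \<Lambda>\<close> by (rule KL_E)
    from bound[OF F(3,4)] below_cst[OF F(2,3,5)] show ?thesis unfolding F(1) by blast
  qed
  have cst_le: "N.le (cst (L m)) (cst (L n))" if "m \<le> n" for m n
    using that cst_less[of "L m" "L n"] smono unfolding N.le_def by (metis order_le_less strict_mono_less)
  have fin: "\<exists>n. \<forall>b\<in>F. ltM N b (cst (L n))" if "finite F" "F \<subseteq> KL \<Lambda>" for F
    using that
  proof (induction F rule: finite_induct)
    case (insert b F)
    then obtain n where n: "\<forall>c\<in>F. ltM N c (cst (L n))" by auto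
    obtain m where m: "ltM N b (cst (L m))" using below_L insert.prems by blast
    have FN: "c \<in> carr N" if "c \<in> insert b F" for c using that insert.prems KL_carr by blast
    have "ltM N c (cst (L (max n m)))" if c: "c \<in> insert b F" for c
    proof (cases "c = b")
      case True
      then show ?thesis
        using N.lt_le_trans[OF _ cst_le[of m "max n m"] FN[OF c] cst_carr cst_carr] m by simp
    next
      case False
      then show ?thesis
        using N.lt_le_trans[OF _ cst_le[of n "max n m"] FN[OF c] cst_carr cst_carr] n c by simp
    qed
    then show ?case by blast
  qed simp
  have jK: "j n \<in> KL \<Lambda>" for n
  proof (rule KL_initial[OF down _ jN j(3)])
    show "cst (L (Suc n)) \<in> KL \<Lambda>"
      unfolding cst_def by (rule KL_I[OF DF_coord, of "{L (Suc n)}"]) (auto simp: supp_def L\<Lambda>)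
  qed
  have cofJ: "\<exists>n. \<forall>b\<in>F. ltM N b (j n)" if F: "finite F" "F \<subseteq> KL \<Lambda>" for F
  proof -
    obtain n where n: "\<forall>b\<in>F. ltM N b (cst (L n))" using fin[OF F] by blast
    have "ltM N b (j n)" if "b \<in> F" for b
      using N.lt_trans[OF _ j(2) _ cst_carr jN] n that F(2) KL_carr by blast
    then show ?thesis by blast
  qed
  \<comment> \<open>The parameters of \<open>R\<close> may lie above the cut; conservativity will
    replace \<open>R\<close> by \<open>R'\<close> with parameters inside it.\<close>
  obtain R where R: "N.dp1 R" "\<forall>i\<in>carr N. ltM N i (cst u) \<longrightarrow> (i \<in> J \<longleftrightarrow> R i)"
    using N.Delta0_initial_segment_definable[OF ind cst_carr[of u]] by blast
  obtain q d where q: "LA_formula q" "\<And>k. d k \<in> carr N"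
    "\<And>v. v \<in> carr N \<Longrightarrow> R v \<longleftrightarrow> sat N {} (d(0 := v)) q"
    by (rule N.dp1_single_variable[OF R(1)]) (rule that)
  have D: "rep (d k) \<in> DF" "h (rep (d k)) = d k" for k using q(2)[of k] rep[of "d k"] by simp_all
  obtain R' where R': "dp N (KL \<Lambda>) (carr N) {\<lambda>x. x} R'"
    "\<forall>b\<in>KL \<Lambda>. sat N {} ((\<lambda>k. h (rep (d k)))(0 := b)) q \<longleftrightarrow> R' b"
    using conservative[of \<Lambda> q "\<lambda>k. rep (d k)", OF down q(1) D(1)] by blast
  have dd: "(\<lambda>k. h (rep (d k))) = d" using D(2) by (rule ext)
  have trace: "b \<in> J \<longleftrightarrow> R' b" if b: "b \<in> KL \<Lambda>" for b
  proof -
    have bN: "b \<in> carr N" using b KL_carr by blast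
    have "b \<in> J \<longleftrightarrow> R b" using R(2) below_u[OF b] bN by blast
    also have "\<dots> \<longleftrightarrow> R' b" using R'(2) b q(3)[OF bN] unfolding dd by simp
    finally show ?thesis .
  qed
  show False
  proof (rule N.indiscernible_trace_undefinable[OF JN J R'(1) KL_carr KL_carr])
    fix F assume "finite F" "F \<subseteq> KL \<Lambda>"
    from cofJ[OF this] obtain n where "\<forall>b\<in>F. ltM N b (j n)" by blast
    then show "\<exists>j\<in>J \<inter> KL \<Lambda>. \<forall>a\<in>F. N.le a j" using j(1) jK N.lt_imp_le by blast
  next
    fix i assume "i \<in> J \<inter> KL \<Lambda>"
    then obtain n where "ltM N i (j n)" using cofJ[of "{i}"] by auto
    then show "\<exists>j'\<in>J \<inter> KL \<Lambda>. ltM N i j'" using j(1) jK by blast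
  next
    fix a b assume ab: "b \<in> KL \<Lambda>" "a \<in> carr N" "N.le a b"
    then show "a \<in> KL \<Lambda>" using KL_initial[OF down ab(1,2)] unfolding N.le_def by blast
  qed (rule trace)
qed

end

end

section \<open>An index set of uncountable cofinality\<close>

text \<open>The first uncountable cardinal, realised on a set of sets of natural numbers; the
  representation map therefore also codes indices by such sets.\<close>

typedef omega1 = "Field (cardSuc natLeq)"
proof -
  have "Field (cardSuc natLeq) \<noteq> {}"
    using cardSuc_Card_order[OF natLeq_Card_order] Field_cardSuc_not_empty[OF natLeq_Card_order] by simp
  then show ?thesis by blast
qed

instantiation omega1 :: linorder
begin

definition less_eq_omega1 :: "omega1 \<Rightarrow> omega1 \<Rightarrow> bool" where
  "a \<le> b \<longleftrightarrow> (Rep_omega1 a, Rep_omega1 b) \<in> cardSuc natLeq"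

definition less_omega1 :: "omega1 \<Rightarrow> omega1 \<Rightarrow> bool" where
  "(a :: omega1) < b \<longleftrightarrow> a \<le> b \<and> \<not> b \<le> a"

instance
proof
  have "Well_order (cardSuc natLeq)"
    using cardSuc_Card_order[OF natLeq_Card_order] by (rule card_order_on_well_order_on)
  then have lin: "Linear_order (cardSuc natLeq)"
    unfolding well_order_on_def by blast
  fix a b c :: omega1
  note ops = lin[unfolded linear_order_on_def partial_order_on_def preorder_on_def]
  show "a < b \<longleftrightarrow> a \<le> b \<and> \<not> b \<le> a" by (rule less_omega1_def)
  show "a \<le> a"
    using ops Rep_omega1[of a] unfolding less_eq_omega1_def refl_on_def by blast
  show "a \<le> c" if "a \<le> b" "b \<le> c"
    using ops that unfolding less_eq_omega1_def by (meson transD)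
  show "a = b" if "a \<le> b" "b \<le> a"
    using ops that unfolding less_eq_omega1_def by (metis Rep_omega1_inject antisymD)
  show "a \<le> b \<or> b \<le> a"
  proof (cases "a = b")
    case True
    then show ?thesis
      using ops Rep_omega1[of a] unfolding less_eq_omega1_def refl_on_def by blast
  next
    case False
    then have "Rep_omega1 a \<noteq> Rep_omega1 b" by (simp add: Rep_omega1_inject)
    with ops Rep_omega1[of a] Rep_omega1[of b] show ?thesis
      unfolding less_eq_omega1_def total_on_def by blast
  qed
qed

end

lemma omega1_no_max: "\<exists>b :: omega1. a < b"
proof -
  have inf: "\<not> finite (Field (cardSuc natLeq))"
    using cardSuc_finite[OF natLeq_Card_order] by (simp add: Field_natLeq)
  from infinite_Card_order_limit[OF cardSuc_Card_order[OF natLeq_Card_order] inf Rep_omega1[of a]]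
  obtain b where b: "b \<in> Field (cardSuc natLeq)" "Rep_omega1 a \<noteq> b" "(Rep_omega1 a, b) \<in> cardSuc natLeq"
    by blast
  then have "a \<le> Abs_omega1 b" "a \<noteq> Abs_omega1 b"
    unfolding less_eq_omega1_def by (auto simp: Abs_omega1_inverse)
  then show ?thesis by (metis order_le_less)
qed

text \<open>Regularity of a successor cardinal: a countable set covered by the chain of initial
  segments is contained in one of them. The bound becomes strict because there is no largest
  element.\<close>

lemma omega1_cofinality:
  fixes C :: "omega1 set"
  assumes "countable C"
  shows "\<exists>u. \<forall>c\<in>C. c < u"
proof -
  have "Well_order (cardSuc natLeq)"
    using cardSuc_Card_order[OF natLeq_Card_order] by (rule card_order_on_well_order_on)
  then have tr: "trans (cardSuc natLeq)"
    unfolding well_order_on_def linear_order_on_def partial_order_on_def preorder_on_def by blast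
  define As where "As i = {j. (j, i) \<in> cardSuc natLeq}" for i
  have "\<exists>i\<in>Field (cardSuc natLeq). Rep_omega1 ` C \<subseteq> As i"
  proof (rule cardSuc_UNION[OF natLeq_Card_order])
    show "infinite (Field natLeq)" by (simp add: Field_natLeq)
    show "relChain (cardSuc natLeq) As"
      unfolding relChain_def As_def using tr by (auto dest: transD)
    show "Rep_omega1 ` C \<subseteq> (\<Union>i\<in>Field (cardSuc natLeq). As i)"
    proof
      fix x assume "x \<in> Rep_omega1 ` C"
      then obtain c where c: "x = Rep_omega1 c" by blast
      have "(x, x) \<in> cardSuc natLeq" using order_refl[of c] unfolding c less_eq_omega1_def .
      then show "x \<in> (\<Union>i\<in>Field (cardSuc natLeq). As i)"
        unfolding As_def c using Rep_omega1[of c] by blast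
    qed
    show "(card_of (Rep_omega1 ` C), natLeq) \<in> ordLeq"
      using countable_card_le_natLeq assms by blast
  qed
  then obtain i where i: "i \<in> Field (cardSuc natLeq)" "Rep_omega1 ` C \<subseteq> As i" by blast
  have le: "c \<le> Abs_omega1 i" if "c \<in> C" for c
    using i that unfolding less_eq_omega1_def As_def by (auto simp: Abs_omega1_inverse)
  obtain u where "Abs_omega1 i < u" using omega1_no_max by blast
  with le show ?thesis by (meson order_le_less_trans)
qed

section \<open>Coding the elements of the extension by sets of natural numbers\<close>

text \<open>Slot 0 holds the number m and the length, slot i + 1 the set that codes entry i. The
  length is recorded because an entry coded by the empty set leaves its slot empty.\<close>

definition list_code :: "('c \<Rightarrow> nat set) \<Rightarrow> nat \<Rightarrow> 'c list \<Rightarrow> nat set" where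
  "list_code w m xs = insert (prod_encode (0, prod_encode (m, length xs)))
    {prod_encode (Suc i, n) |i n. i < length xs \<and> n \<in> w (xs ! i)}"

lemma list_code_inject:
  assumes w: "inj_on w A" and xs: "set xs \<subseteq> A" "set ys \<subseteq> A" and eq: "list_code w m xs = list_code w k ys"
  shows "m = k \<and> xs = ys"
proof -
  have 0: "prod_encode (0, n) \<in> list_code w m xs \<longleftrightarrow> n = prod_encode (m, length xs)" for n m xs
    unfolding list_code_def by (auto simp: prod_encode_eq)
  have Suc: "prod_encode (Suc i, n) \<in> list_code w m xs \<longleftrightarrow> i < length xs \<and> n \<in> w (xs ! i)" for i n m xs
    unfolding list_code_def by (auto simp: prod_encode_eq)
  have "prod_encode (m, length xs) = prod_encode (k, length ys)"
    using 0[of "prod_encode (m, length xs)" m xs] 0[of "prod_encode (m, length xs)" k ys] eq by simp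
  then have mk: "m = k" and len: "length xs = length ys" by (simp_all add: prod_encode_eq)
  have "xs = ys"
  proof (rule nth_equalityI[OF len])
    fix i assume i: "i < length xs"
    have "w (xs ! i) = w (ys ! i)"
      using Suc[of i _ m xs] Suc[of i _ k ys] eq i len by auto
    moreover have "xs ! i \<in> A" "ys ! i \<in> A" using xs i len nth_mem by (metis subsetD)+
    ultimately show "xs ! i = ys ! i" using w by (metis inj_onD)
  qed
  with mk show ?thesis by blast
qed

context arith
begin

text \<open>A definable function is determined by a formula and a finite list of indices and
  parameters. Formulae and parameters are countably many and indices are coded by sets of numbers,
  so all these data fit into one set of numbers.\<close>

lemma coding_exists:
  fixes \<iota> :: "'l::linorder \<Rightarrow> nat set"
  assumes inj: "inj \<iota>" and K: "countable K"
  shows "\<exists>h :: (('l \<Rightarrow> 'a) \<Rightarrow> 'a) \<Rightarrow> nat set. \<forall>F G. dfM (envs M) coords F \<longrightarrow> dfM (envs M) coords G \<longrightarrow>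
    (h F = h G \<longleftrightarrow> T (\<lambda>x. F x = G x))"
proof -
  \<comment> \<open>Positions beyond the list get the default zero; the lists chosen below are long
    enough to cover the free variables of the formula.\<close>
  define ev where "ev xs x k = (if k < length xs then (case xs ! k of Inl l \<Rightarrow> x l | Inr a \<Rightarrow> a) else Z)"
    for xs :: "('l + 'a) list" and x and k
  define rp where "rp F c \<longleftrightarrow> set (snd c) \<subseteq> range Inl \<union> Inr ` K \<and>
    (\<forall>x\<in>envs M. \<forall>v\<in>K. F x = v \<longleftrightarrow> sat M {} ((ev (snd c) x)(0 := v)) (fst c))"
    for F :: "('l \<Rightarrow> 'a) \<Rightarrow> 'a" and c
  define DF where "DF = {F :: ('l \<Rightarrow> 'a) \<Rightarrow> 'a. dfM (envs M) coords F}"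
  have carr: "F x \<in> K" if "F \<in> DF" "x \<in> envs M" for F x
    using that unfolding DF_def df_def by blast
  have ex: "\<exists>c. rp F c" if F: "F \<in> DF" for F
  proof -
    have "dpM (envs M \<times> K) (ext coords) (\<lambda>z. F (fst z) = snd z)"
      using F unfolding DF_def df_def by blast
    then obtain q and d :: "nat \<Rightarrow> ('l \<Rightarrow> 'a) \<Rightarrow> 'a" where q: "LA_formula q" "\<And>k. d k \<in> coords \<union> pconsts M K"
      and P: "\<And>x v. x \<in> envs M \<Longrightarrow> v \<in> K \<Longrightarrow>
        (F (fst (x, v)) = snd (x, v)) \<longleftrightarrow> sat M {} ((\<lambda>k. d k x)(0 := v)) q"
      by (rule dp_normal_form) (rule that)
    obtain n where n: "\<And>k. k \<in> fvars q \<Longrightarrow> k < n"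
      using finite_nat_set_iff_bounded[of "fvars q"] by auto
    have "\<exists>s. s \<in> range Inl \<union> Inr ` K \<and> (\<forall>x. d k x = (case s of Inl l \<Rightarrow> x l | Inr a \<Rightarrow> a))" for k
      using q(2)[of k]
    proof
      assume "d k \<in> coords"
      then obtain l where "d k = (\<lambda>x. x l)" unfolding coords_def by (rule imageE)
      then show ?thesis by (intro exI[of _ "Inl l"]) simp
    next
      assume "d k \<in> pconsts M K"
      then obtain a where a: "a \<in> insert Z K" "d k = (\<lambda>_. a)" unfolding pconsts_def by blast
      have "a \<in> K" using a(1) by auto
      with a(2) show ?thesis by (intro exI[of _ "Inr a"]) simp
    qed
    then obtain s where s: "\<And>k. s k \<in> range Inl \<union> Inr ` K"
      "\<And>k x. d k x = (case s k of Inl l \<Rightarrow> x l | Inr a \<Rightarrow> a)" by metis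
    have "rp F (q, map s [0..<n])"
      unfolding rp_def fst_conv snd_conv
    proof (intro conjI ballI)
      show "set (map s [0..<n]) \<subseteq> range Inl \<union> Inr ` K" using s(1) by auto
      fix x :: "'l \<Rightarrow> 'a" and v assume x: "x \<in> envs M" and v: "v \<in> K"
      have "sat M {} ((\<lambda>k. d k x)(0 := v)) q \<longleftrightarrow> sat M {} ((ev (map s [0..<n]) x)(0 := v)) q"
      proof (rule sat_cong)
        fix k assume "k \<in> fvars q"
        from n[OF this] show "((\<lambda>k. d k x)(0 := v)) k = ((ev (map s [0..<n]) x)(0 := v)) k"
          unfolding ev_def using s(2) by simp
      qed
      then show "F x = v \<longleftrightarrow> sat M {} ((ev (map s [0..<n]) x)(0 := v)) q"
        using P[OF x v] by simp
    qed
    then show ?thesis by blast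
  qed
  have unique: "F x = G x" if "rp F c" "rp G c" "F \<in> DF" "G \<in> DF" "x \<in> envs M" for F G c x
    using that carr[of F x] unfolding rp_def by metis
  \<comment> \<open>The number 0 marks the codes of indices; a parameter is coded by a singleton
    without 0.\<close>
  define w :: "'l + 'a \<Rightarrow> nat set" where
    "w s = (case s of Inl l \<Rightarrow> insert 0 (Suc ` \<iota> l) | Inr a \<Rightarrow> {Suc (to_nat_on K a)})" for s
  have w: "inj_on w (range Inl \<union> Inr ` K)"
  proof (rule inj_onI)
    fix s t assume s: "s \<in> range Inl \<union> Inr ` K" and t: "t \<in> range Inl \<union> Inr ` K" and eq: "w s = w t"
    have z: "0 \<in> w r \<longleftrightarrow> isl r" for r by (cases r) (auto simp: w_def)
    show "s = t"
    proof (cases s)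
      case (Inl l)
      then obtain l' where l': "t = Inl l'" using z[of s] z[of t] eq by (cases t) auto
      have "Suc ` \<iota> l = Suc ` \<iota> l'"
        using eq unfolding Inl l' w_def by (auto simp: set_eq_iff)
      then have "\<iota> l = \<iota> l'" by (simp add: inj_image_eq_iff)
      then show ?thesis using inj unfolding Inl l' by (simp add: inj_eq)
    next
      case (Inr a)
      then obtain a' where a': "t = Inr a'" using z[of s] z[of t] eq by (cases t) auto
      have "to_nat_on K a = to_nat_on K a'" using eq unfolding Inr a' w_def by simp
      moreover have "a \<in> K" "a' \<in> K" using s t unfolding Inr a' by auto
      ultimately show ?thesis using K unfolding Inr a' by simp
    qed
  qed
  define code where "code F = (SOME c. rp F c)" for F
  have code: "rp F (code F)" if "F \<in> DF" for F
    unfolding code_def using ex[OF that] by (rule someI_ex)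
  \<comment> \<open>The representative is chosen by a property that depends only on the class of
    \<open>F\<close>, so equivalent functions receive the same representative and the same
    code.\<close>
  define rep where "rep F = (SOME G. G \<in> DF \<and> T (\<lambda>x. F x = G x))" for F
  have dp: "dpM (envs M) coords (\<lambda>x. F x = G x)" if "F \<in> DF" "G \<in> DF" for F G
    using that unfolding DF_def by (intro dp_eq) simp_all
  have rep: "rep F \<in> DF \<and> T (\<lambda>x. F x = rep F x)" if F: "F \<in> DF" for F
    unfolding rep_def
  proof (rule someI_ex[of "\<lambda>G. G \<in> DF \<and> T (\<lambda>x. F x = G x)"])
    show "\<exists>G. G \<in> DF \<and> T (\<lambda>x. F x = G x)" using F by (intro exI[of _ F]) simp
  qed
  define h where "h F = list_code w (to_nat (fst (code (rep F)))) (snd (code (rep F)))" for F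
  have "h F = h G \<longleftrightarrow> T (\<lambda>x. F x = G x)" if F: "F \<in> DF" and G: "G \<in> DF" for F G
  proof
    assume FG: "T (\<lambda>x. F x = G x)"
    have "T (\<lambda>x. F x = H x) \<longleftrightarrow> T (\<lambda>x. G x = H x)" if H: "H \<in> DF" for H
      by (rule T_cong_mod[OF dp[OF F H] dp[OF G H] dp[OF F G] FG]) simp
    then have "(\<lambda>H. H \<in> DF \<and> T (\<lambda>x. F x = H x)) = (\<lambda>H. H \<in> DF \<and> T (\<lambda>x. G x = H x))" by blast
    then have "rep F = rep G" unfolding rep_def by simp
    then show "h F = h G" unfolding h_def by simp
  next
    assume "h F = h G"
    then have "to_nat (fst (code (rep F))) = to_nat (fst (code (rep G))) \<and>
        snd (code (rep F)) = snd (code (rep G))"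
      unfolding h_def
      by (rule list_code_inject[OF w, rotated -1]) (use code rep F G in \<open>auto simp: rp_def\<close>)
    then have "code (rep F) = code (rep G)" by (simp add: prod_eq_iff)
    then have eq: "rep F x = rep G x" if "x \<in> envs M" for x
      using unique[of "rep F" "code (rep F)" "rep G"] code rep F G that by metis
    have TF: "dpM (envs M) coords (\<lambda>x. F x = rep F x)" "T (\<lambda>x. F x = rep F x)"
      using dp[OF F] rep[OF F] by blast+
    have TG: "dpM (envs M) coords (\<lambda>x. G x = rep G x)" "T (\<lambda>x. G x = rep G x)"
      using dp[OF G] rep[OF G] by blast+
    show "T (\<lambda>x. F x = G x)"
      by (rule T_mono[OF dp_conj[OF TF(1) TG(1)] dp[OF F G] _ T_conjI[OF TF(1) TG(1) TF(2) TG(2)]])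
        (use eq in auto)
  qed
  then show ?thesis unfolding DF_def by blast
qed

end

theorem theorem6p3:
  shows "(\<forall>M :: 'a LA_struct.
            model_PA M \<longrightarrow> countable_cofinality M \<longrightarrow>
            (\<exists>I. model_PAI_minus M I) \<longrightarrow> (\<exists>I. model_PAI0 M I)) \<and>
         (\<forall>M :: 'a LA_struct.
            model_PA M \<longrightarrow> countable (carr M) \<longrightarrow>
            (\<exists>(N :: nat set LA_struct) f.
               elementary_end_extension_via f M N \<and> uncountable (carr N) \<and>
               (\<exists>I. model_PAI_minus N I) \<and> \<not> (\<exists>I. model_PAI0 N I)))"
proof (intro conjI allI impI)
  fix M :: "'a LA_struct"
  assume PA: "model_PA M" and "countable_cofinality M" "\<exists>I. model_PAI_minus M I"
  interpret arith M by unfold_locales (rule PA)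
  show "\<exists>I. model_PAI0 M I"
    using model_PAI0_of_countable_cofinality \<open>countable_cofinality M\<close> \<open>\<exists>I. model_PAI_minus M I\<close> by blast
next
  fix M :: "'a LA_struct"
  assume PA: "model_PA M" and K: "countable (carr M)"
  interpret arith M by unfold_locales (rule PA)
  \<comment> \<open>\<open>Rep_omega1\<close> takes its values in the sets of natural numbers and so
    serves as the coding of indices.\<close>
  have "inj Rep_omega1" by (rule injI) (simp add: Rep_omega1_inject)
  from coding_exists[OF this K] obtain h :: "((omega1 \<Rightarrow> 'a) \<Rightarrow> 'a) \<Rightarrow> nat set" where
    h: "\<forall>F G. dfM (envs M) coords F \<longrightarrow> dfM (envs M) coords G \<longrightarrow>
      (h F = h G \<longleftrightarrow> T (\<lambda>x. F x = G x))" ..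
  interpret iterated M h
    by unfold_locales (use h in blast)
  have "elementary_end_extension_via (\<lambda>m. h (\<lambda>_. m)) M N \<and> uncountable (carr N) \<and>
       (\<exists>I. model_PAI_minus N I) \<and> \<not> (\<exists>I. model_PAI0 N I)"
    using elementary_end_extension uncountable_carr_N[OF omega1_cofinality]
      model_PAI_minus_N[OF omega1_cofinality] no_model_PAI0[OF omega1_cofinality] by blast
  then show "\<exists>(N :: nat set LA_struct) f.
       elementary_end_extension_via f M N \<and> uncountable (carr N) \<and>
       (\<exists>I. model_PAI_minus N I) \<and> \<not> (\<exists>I. model_PAI0 N I)" by blast
qed

end
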